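(* Let $L$ have dimension $d_L$, $A=A_1\otimes\cdots\otimes A_n$ finite-dimensional, and $V:L\to A$ an isometry with $\mathcal{E}(\cdot)=V(\cdot)V^\dagger$. Let $T_L$ be Hermitian on $L$ and $T_A=\sum_{i=1}^nT_i$ with $T_i$ Hermitian acting only on $A_i$, and suppose the code is covariant: $T_AV=V(T_L-\nu\mathbb{1}_L)$ for some $\nu\in\mathbb{R}$. For each $i$ let $\mathcal{N}^i(\cdot)=|\phi_i\rangle\langle\phi_i|_{A_i}\otimes\operatorname{tr}_{A_i}(\cdot)$ be the erasure of $A_i$, and let $\Delta T_i$ be the difference between the maximal and minimal eigenvalues of $T_i$. Then $$\frac{1}{2d_L}\left\|T_L-\operatorname{tr}(T_L)\frac{\mathbb{1}}{d_L}\right\|_1\leq\sum_{i=1}^n\Delta T_i\,\epsilon_{\mathrm e}(\mathcal{N}^i\circ\mathcal{E}).$$ Furthermore, for the noise $\mathcal{N}(\cdot)=\sum_iq_i|i\rangle\langle i|_C\otimes\mathcal{N}^i(\cdot)$ with a probability distribution $q_i>0$, $$\epsilon_{\mathrm e}(\mathcal{N}\circ\mathcal{E})\geq\frac{1}{2d_L}\frac{\|T_L-\operatorname{tr}(T_L)\mathbb{1}/d_L\|_1}{\max_iq_i^{-1}\Delta T_i}.$$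
   Context: Fidelity $F(\rho,\sigma)=\|\sqrt\rho\sqrt\sigma\|_1$; $|\hat\phi\rangle_{LR}=\sum_k|k\rangle|k\rangle/\sqrt{d_L}$ with $R\cong L$. For a channel $\mathcal{M}$ from $L$ to $B$, $f_{\mathrm e}(\mathcal{M})=\max_{\mathcal{R}}F((\mathcal{R}\circ\mathcal{M}\otimes\mathrm{id}_R)(\hat\phi),\hat\phi)$ over channels $\mathcal{R}:B\to L$, and $\epsilon_{\mathrm e}(\mathcal{M})=\sqrt{1-f_{\mathrm e}^2(\mathcal{M})}$. *)

theory Defs
  imports Complex_Main "Jordan_Normal_Form.Matrix" "Jordan_Normal_Form.Char_Poly"
begin

definition mtrace :: "complex mat \<Rightarrow> complex" where
  "mtrace M = (\<Sum>i<dim_row M. M $$ (i,i))"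

definition adj :: "complex mat \<Rightarrow> complex mat" where
  "adj M = mat (dim_col M) (dim_row M) (\<lambda>(i,j). cnj (M $$ (j,i)))"

definition psd :: "nat \<Rightarrow> complex mat \<Rightarrow> bool" where
  "psd k M \<longleftrightarrow> M \<in> carrier_mat k k \<and>
     (\<forall>v :: nat \<Rightarrow> complex.
        let z = (\<Sum>i<k. \<Sum>j<k. cnj (v i) * M $$ (i,j) * v j) in Im z = 0 \<and> Re z \<ge> 0)"

definition msqrt :: "nat \<Rightarrow> complex mat \<Rightarrow> complex mat" where
  "msqrt k M = (THE B. psd k B \<and> B * B = M)"

definition trace_norm :: "complex mat \<Rightarrow> real" where
  "trace_norm M = Re (mtrace (msqrt (dim_col M) (adj M * M)))"

definition fidelity :: "nat \<Rightarrow> complex mat \<Rightarrow> complex mat \<Rightarrow> real" where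
  "fidelity k \<rho> \<sigma> = trace_norm (msqrt k \<rho> * msqrt k \<sigma>)"

text \<open>(Phi \<otimes> id_k)(X) for a map Phi from din x din to dout x dout matrices;
  the system factor comes first: composite index  s * k + t.\<close>
definition tensor_id ::
  "(complex mat \<Rightarrow> complex mat) \<Rightarrow> nat \<Rightarrow> nat \<Rightarrow> nat \<Rightarrow> complex mat \<Rightarrow> complex mat" where
  "tensor_id \<Phi> din dout k X =
     mat (dout * k) (dout * k)
       (\<lambda>(r,c). \<Phi> (mat din din (\<lambda>(s,s'). X $$ (s * k + r mod k, s' * k + c mod k)))
                 $$ (r div k, c div k))"

definition is_channel :: "nat \<Rightarrow> nat \<Rightarrow> (complex mat \<Rightarrow> complex mat) \<Rightarrow> bool" where
  "is_channel din dout \<Phi> \<longleftrightarrow>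
     (\<forall>X \<in> carrier_mat din din. \<Phi> X \<in> carrier_mat dout dout) \<and>
     (\<forall>X \<in> carrier_mat din din. \<forall>Y \<in> carrier_mat din din. \<Phi> (X + Y) = \<Phi> X + \<Phi> Y) \<and>
     (\<forall>a. \<forall>X \<in> carrier_mat din din. \<Phi> (a \<cdot>\<^sub>m X) = a \<cdot>\<^sub>m \<Phi> X) \<and>
     (\<forall>X \<in> carrier_mat din din. mtrace (\<Phi> X) = mtrace X) \<and>
     (\<forall>k X. psd (din * k) X \<longrightarrow> psd (dout * k) (tensor_id \<Phi> din dout k X))"

definition max_ent :: "nat \<Rightarrow> complex mat" where
  "max_ent dL = mat (dL * dL) (dL * dL)
     (\<lambda>(r,c). if r div dL = r mod dL \<and> c div dL = c mod dL then 1 / of_nat dL else 0)"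

text \<open>Entanglement fidelity f_e(M) of a channel M from L (dim dL) to B (dim dB):
  the optimum over recovery channels R : B \<rightarrow> L (the maximum is attained).\<close>
definition ent_fid :: "nat \<Rightarrow> nat \<Rightarrow> (complex mat \<Rightarrow> complex mat) \<Rightarrow> real" where
  "ent_fid dL dB M = Sup {fidelity (dL * dL) (tensor_id (\<lambda>X. R (M X)) dL dL dL (max_ent dL)) (max_ent dL)
                          | R. is_channel dB dL R}"

definition ent_err :: "nat \<Rightarrow> nat \<Rightarrow> (complex mat \<Rightarrow> complex mat) \<Rightarrow> real" where
  "ent_err dL dB M = sqrt (1 - (ent_fid dL dB M)\<^sup>2)"

definition dimA :: "(nat \<Rightarrow> nat) \<Rightarrow> nat \<Rightarrow> nat" where
  "dimA d n = (\<Prod>k<n. d k)"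

definition stride :: "(nat \<Rightarrow> nat) \<Rightarrow> nat \<Rightarrow> nat \<Rightarrow> nat" where
  "stride d n i = (\<Prod>k\<in>{i<..<n}. d k)"

text \<open>The i-th tensor-factor index of a product basis index r (mixed radix, factor 0 most significant).\<close>
definition digit :: "(nat \<Rightarrow> nat) \<Rightarrow> nat \<Rightarrow> nat \<Rightarrow> nat \<Rightarrow> nat" where
  "digit d n i r = (r div stride d n i) mod d i"

definition set_digit :: "(nat \<Rightarrow> nat) \<Rightarrow> nat \<Rightarrow> nat \<Rightarrow> nat \<Rightarrow> nat \<Rightarrow> nat" where
  "set_digit d n i a r = r - digit d n i r * stride d n i + a * stride d n i"

definition embed_op :: "(nat \<Rightarrow> nat) \<Rightarrow> nat \<Rightarrow> nat \<Rightarrow> complex mat \<Rightarrow> complex mat" where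
  "embed_op d n i M = mat (dimA d n) (dimA d n)
     (\<lambda>(r,c). if (\<forall>k<n. k \<noteq> i \<longrightarrow> digit d n k r = digit d n k c)
              then M $$ (digit d n i r, digit d n i c) else 0)"

definition local_sum :: "(nat \<Rightarrow> nat) \<Rightarrow> nat \<Rightarrow> (nat \<Rightarrow> complex mat) \<Rightarrow> complex mat" where
  "local_sum d n T = mat (dimA d n) (dimA d n) (\<lambda>(r,c). \<Sum>i<n. embed_op d n i (T i) $$ (r,c))"

definition erase :: "(nat \<Rightarrow> nat) \<Rightarrow> nat \<Rightarrow> nat \<Rightarrow> complex vec \<Rightarrow> complex mat \<Rightarrow> complex mat" where
  "erase d n i \<phi> X = mat (dimA d n) (dimA d n)
     (\<lambda>(r,c). \<phi> $ (digit d n i r) * cnj (\<phi> $ (digit d n i c)) *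
              (\<Sum>a<d i. X $$ (set_digit d n i a r, set_digit d n i a c)))"

text \<open>N(X) = sum_i q_i |i><i|_C \<otimes> N^i(X), on C \<otimes> A with dim C = n (C first).\<close>
definition noise :: "(nat \<Rightarrow> nat) \<Rightarrow> nat \<Rightarrow> (nat \<Rightarrow> real) \<Rightarrow> (nat \<Rightarrow> complex vec) \<Rightarrow> complex mat \<Rightarrow> complex mat" where
  "noise d n q \<phi> X = mat (n * dimA d n) (n * dimA d n)
     (\<lambda>(r,c). if r div dimA d n = c div dimA d n
              then of_real (q (r div dimA d n)) *
                   erase d n (r div dimA d n) (\<phi> (r div dimA d n)) X $$ (r mod dimA d n, c mod dimA d n)
              else 0)"

definition spread :: "complex mat \<Rightarrow> real" where
  "spread M = Max (Re ` {k. eigenvalue M k}) - Min (Re ` {k. eigenvalue M k})"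

end

theory Submission
  imports Defs "Jordan_Normal_Form.Schur_Decomposition" "Jordan_Normal_Form.Spectral_Radius"
    "HOL-Analysis.Convex"
begin

text \<open>A recovery after the erasure of \<open>A\<^sub>i\<close> never sees \<open>A\<^sub>i\<close>, so \<open>T\<^sub>i\<close> together with a contraction \<open>Z\<close> of the
  reference can still be measured on the recovered state. Purified, that state has overlap \<open>F\<close> (the
  entanglement fidelity) with a product of some state of the lost factor and its environment with
  the maximally entangled state, and two unit vectors of overlap \<open>F\<close> differ on an observable of norm
  \<open>m\<close> by at most \<open>2 m sqrt (1 - F\<^sup>2)\<close>; shifting \<open>T\<^sub>i\<close> by a constant makes \<open>m = \<Delta>T\<^sub>i / 2\<close>. Summing over
  \<open>i\<close> and using covariance bounds \<open>tr (Z (T\<^sub>L - \<mu>)) / d\<^sub>L\<close> for some real \<open>\<mu>\<close> independent of \<open>Z\<close>. The sign of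
  \<open>T\<^sub>L - \<mu>\<close> as \<open>Z\<close> gives its trace norm, and replacing \<open>\<mu>\<close> by the mean eigenvalue costs a factor 2.
  A recovery for the mixed noise restricts to recoveries for the single erasures whose squared
  fidelities average to its own, so concavity of the square root gives the second bound.\<close>

section \<open>Spectral theorem for Hermitian matrices\<close>

text \<open>The order of quantifiers shapes everything. The contraction \<open>Z\<close> ends up as
  the sign of \<open>TL - \<mu>\<close>, and \<open>\<mu>\<close> collects the expectations of the
  \<open>T i\<close> in the product states; so each such expectation \<open>\<tau>\<close> must be
  fixed before \<open>Z\<close> is known, and every bound reads: some \<open>\<tau>\<close> serves
  all \<open>Z\<close>. This is possible because the nearby product state is built from the
  recovered state alone. In it the reference is maximally mixed, so the expectation is
  \<open>\<tau>\<close> times tr Z / d. In the recovered state the recovery drops out, since it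
  preserves the trace: what remains is the marginal of the code on the lost factor and the
  reference, which pairs \<open>Z\<close> entrywise with the compression of \<open>T i\<close> to
  the code. Purifications appear as Gram vectors of a positive matrix, their index acting as the
  environment. The constant 2 m sqrt (1 - F^2) is m times the norms of difference and sum of two
  unit vectors of real overlap F, sqrt (2 - 2 F) and sqrt (2 + 2 F). Inequalities are proved for
  arbitrary recoveries and carried to the supremum in \<open>ent_fid\<close> along a maximising
  sequence.\<close>

lemma mult_mat_entry:
  assumes "A \<in> carrier_mat n m" "B \<in> carrier_mat m p" "i < n" "j < p"
  shows "(A * B) $$ (i,j) = (\<Sum>k<m. A $$ (i,k) * B $$ (k,j))"
  using assms by (auto simp: scalar_prod_def lessThan_atLeast0 intro!: sum.cong)

lemma adj_carrier [simp]: "A \<in> carrier_mat n m \<Longrightarrow> adj A \<in> carrier_mat m n"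
  by (auto simp: adj_def)

lemma adj_entry:
  assumes "A \<in> carrier_mat n m" "i < m" "j < n"
  shows "adj A $$ (i,j) = cnj (A $$ (j,i))"
  using assms by (auto simp: adj_def)

lemma hermitian_entry:
  assumes "A \<in> carrier_mat n n" "adj A = A" "i < n" "j < n"
  shows "cnj (A $$ (j,i)) = A $$ (i,j)"
  using adj_entry[OF assms(1,3,4)] assms(2) by simp

lemma mtrace_mult_comm:
  assumes "A \<in> carrier_mat n m" "B \<in> carrier_mat m n"
  shows "mtrace (A * B) = mtrace (B * A)"
proof -
  have "mtrace (A * B) = (\<Sum>i<n. \<Sum>k<m. A $$ (i,k) * B $$ (k,i))"
    using assms by (auto simp: mtrace_def mult_mat_entry[OF assms] simp del: index_mult_mat(1))
  also have "\<dots> = (\<Sum>k<m. \<Sum>i<n. B $$ (k,i) * A $$ (i,k))"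
    by (subst sum.swap) (simp add: mult.commute)
  also have "\<dots> = mtrace (B * A)"
    using assms by (auto simp: mtrace_def mult_mat_entry[OF assms(2,1)] simp del: index_mult_mat(1))
  finally show ?thesis .
qed

text \<open>Schur triangularisation puts the eigenvalues on the diagonal and preserves the trace. It
  serves in contrapositive form: a trace other than n c yields an eigenvalue other than c.\<close>

lemma mtrace_eq_mult_if_unique_eigenvalue:
  assumes A: "A \<in> carrier_mat n n" and c: "\<And>e. eigenvalue A e \<Longrightarrow> e = c"
  shows "mtrace A = of_nat n * c"
proof -
  obtain es where es: "char_poly A = (\<Prod>e\<leftarrow>es. [:- e, 1:])" "length es = n"
    using char_poly_factorized[OF A] by auto
  obtain B P Q where s: "schur_decomposition A es = (B,P,Q)"
    by (cases "schur_decomposition A es") auto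
  have w: "similar_mat_wit A B P Q" and d: "diag_mat B = es"
    using schur_decomposition[OF A es(1) s] by auto
  have B: "B \<in> carrier_mat n n" and P: "P \<in> carrier_mat n n" and Q: "Q \<in> carrier_mat n n"
    and QP: "Q * P = 1\<^sub>m n" and AB: "A = P * B * Q"
    using similar_mat_witD2[OF A w] by auto
  have "mtrace A = mtrace (Q * (P * B))"
    unfolding AB using mtrace_mult_comm[of "P * B" n n Q] P B Q by auto
  also have "Q * (P * B) = B"
    using assoc_mult_mat[OF Q P B] QP B by simp
  also have "mtrace B = (\<Sum>i<n. c)"
    unfolding mtrace_def
  proof (rule sum.cong)
    show "{..<dim_row B} = {..<n}" using B by auto
    fix i assume "i \<in> {..<n}"
    hence i: "i < n" by simp
    have "es ! i = B $$ (i,i)" using d B i by (auto simp: diag_mat_def)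
    moreover have "eigenvalue A (es ! i)"
      unfolding eigenvalue_root_char_poly[OF A] es(1)
      using i es(2) by (auto simp: poly_prod_list prod_list_zero_iff)
    ultimately show "B $$ (i,i) = c" using c by auto
  qed
  finally show ?thesis by simp
qed

text \<open>Vectors are plain functions of an index, so that a family is extended by a function
  update and sums carry no dimension side conditions.\<close>

definition orthonormal :: "nat \<Rightarrow> nat \<Rightarrow> (nat \<Rightarrow> nat \<Rightarrow> complex) \<Rightarrow> bool" where
  "orthonormal n m u \<longleftrightarrow>
     (\<forall>k<m. \<forall>l<m. (\<Sum>i<n. cnj (u k i) * u l i) = (if k = l then 1 else 0))"

lemma eigenvalue_obtain_function:
  assumes A: "A \<in> carrier_mat n n" and e: "eigenvalue A e"
  obtains v where "\<And>i. i < n \<Longrightarrow> (\<Sum>j<n. A $$ (i,j) * v j) = e * v i" "\<exists>i<n. v i \<noteq> 0"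
proof -
  obtain x where x: "x \<in> carrier_vec n" "x \<noteq> 0\<^sub>v n" "A *\<^sub>v x = e \<cdot>\<^sub>v x"
    using e A unfolding eigenvalue_def eigenvector_def by auto
  have 1: "(\<Sum>j<n. A $$ (i,j) * x $ j) = e * x $ i" if "i < n" for i
  proof -
    have "(A *\<^sub>v x) $ i = (\<Sum>j<n. A $$ (i,j) * x $ j)"
      using that A x(1) by (auto simp: scalar_prod_def lessThan_atLeast0 intro!: sum.cong)
    thus ?thesis using x that by simp
  qed
  have "\<exists>i<n. x $ i \<noteq> 0" using x by (metis carrier_vecD eq_vecI index_zero_vec)
  with 1 show ?thesis using that by blast
qed

lemma eigenvalue_of_function:
  assumes A: "A \<in> carrier_mat n n"
    and v: "\<And>i. i < n \<Longrightarrow> (\<Sum>j<n. A $$ (i,j) * v j) = e * v i" "\<exists>i<n. v i \<noteq> 0"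
  shows "eigenvalue A e"
proof -
  have "eigenvector A (vec n v) e"
    unfolding eigenvector_def
  proof (intro conjI)
    show "vec n v \<in> carrier_vec (dim_row A)" using A by auto
    show "vec n v \<noteq> 0\<^sub>v (dim_row A)"
      using v(2) A by (metis carrier_matD(1) index_vec index_zero_vec(1))
    show "A *\<^sub>v vec n v = e \<cdot>\<^sub>v vec n v"
    proof (rule eq_vecI)
      fix i assume "i < dim_vec (e \<cdot>\<^sub>v vec n v)"
      hence i: "i < n" by simp
      have "(A *\<^sub>v vec n v) $ i = (\<Sum>j<n. A $$ (i,j) * v j)"
        using i A by (auto simp: scalar_prod_def lessThan_atLeast0 intro!: sum.cong)
      thus "(A *\<^sub>v vec n v) $ i = (e \<cdot>\<^sub>v vec n v) $ i" using v(1) i by simp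
    qed (use A in auto)
  qed
  thus ?thesis unfolding eigenvalue_def by blast
qed

lemma sum_cnj_mult_self: "(\<Sum>i\<in>S. cnj (v i) * v i) = of_real (\<Sum>i\<in>S. (cmod (v i))\<^sup>2)"
  by (simp only: of_real_sum) (intro sum.cong refl, metis complex_norm_square mult.commute)

lemma hermitian_form_swap:
  assumes A: "A \<in> carrier_mat n n" "adj A = A"
  shows "(\<Sum>i<n. cnj (\<Sum>j<n. A $$ (i,j) * u j) * v i) = (\<Sum>i<n. cnj (u i) * (\<Sum>j<n. A $$ (i,j) * v j))"
proof -
  have "(\<Sum>i<n. cnj (\<Sum>j<n. A $$ (i,j) * u j) * v i)
      = (\<Sum>i<n. \<Sum>j<n. cnj (u j) * A $$ (j,i) * v i)"
    by (simp add: sum_distrib_left sum_distrib_right cnj_sum)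
       (intro sum.cong refl, simp add: hermitian_entry[OF A])
  also have "\<dots> = (\<Sum>j<n. \<Sum>i<n. cnj (u j) * A $$ (j,i) * v i)" by (rule sum.swap)
  finally show ?thesis by (simp add: sum_distrib_left mult.assoc)
qed

lemma hermitian_new_eigenvector:
  assumes A: "A \<in> carrier_mat n n" "adj A = A" and mn: "m < n"
    and on: "orthonormal n m u"
    and ev: "\<And>k i. k < m \<Longrightarrow> i < n \<Longrightarrow> (\<Sum>j<n. A $$ (i,j) * u k j) = of_real (\<kappa> k) * u k i"
  obtains v and r :: real where "\<And>i. i < n \<Longrightarrow> (\<Sum>j<n. A $$ (i,j) * v j) = of_real r * v i"
    "(\<Sum>i<n. cnj (v i) * v i) = 1" "\<And>k. k < m \<Longrightarrow> (\<Sum>i<n. cnj (u k i) * v i) = 0"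
proof -
  \<comment> \<open>Move the known eigenvalues to a common value c that differs from the mean of the others:
    an eigenvalue other than c then exists, and its eigenvector is orthogonal to the known ones.\<close>
  define x where "x = mtrace A - (\<Sum>k<m. of_real (\<kappa> k))"
  define c where "c = x / of_nat (n - m) + 1"
  define A' where "A' = mat n n (\<lambda>(i,j). A $$ (i,j) + (\<Sum>k<m. (c - of_real (\<kappa> k)) * u k i * cnj (u k j)))"
  have A': "A' \<in> carrier_mat n n" by (simp add: A'_def)
  have norm1: "(\<Sum>i<n. cnj (u k i) * u l i) = (if k = l then 1 else 0)" if "k < m" "l < m" for k l
    using on that by (simp add: orthonormal_def)
  have "mtrace A' = mtrace A + (\<Sum>i<n. \<Sum>k<m. (c - of_real (\<kappa> k)) * (cnj (u k i) * u k i))"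
    using A by (simp add: mtrace_def A'_def sum.distrib mult_ac)
  also have "(\<Sum>i<n. \<Sum>k<m. (c - of_real (\<kappa> k)) * (cnj (u k i) * u k i)) = (\<Sum>k<m. c - of_real (\<kappa> k))"
    by (subst sum.swap) (simp add: sum_distrib_left[symmetric] norm1)
  finally have tr: "mtrace A' = x + of_nat m * c" by (simp add: x_def sum_subtractf)
  have "mtrace A' \<noteq> of_nat n * c"
  proof
    assume "mtrace A' = of_nat n * c"
    hence "x = of_nat (n - m) * c" using mn tr by (simp add: of_nat_diff algebra_simps)
    also have "\<dots> = x + of_nat (n - m)"
      using mn by (simp only: c_def distrib_left) simp
    finally show False using mn by simp
  qed
  then obtain e where e: "eigenvalue A' e" "e \<noteq> c"
    using mtrace_eq_mult_if_unique_eigenvalue[OF A'] by blast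
  obtain v where v: "\<And>i. i < n \<Longrightarrow> (\<Sum>j<n. A' $$ (i,j) * v j) = e * v i" "\<exists>i<n. v i \<noteq> 0"
    using eigenvalue_obtain_function[OF A' e(1)] by blast
  define p where "p k = (\<Sum>j<n. cnj (u k j) * v j)" for k
  have split: "(\<Sum>j<n. A' $$ (i,j) * v j) =
      (\<Sum>j<n. A $$ (i,j) * v j) + (\<Sum>k<m. (c - of_real (\<kappa> k)) * u k i * p k)" if i: "i < n" for i
  proof -
    have "(\<Sum>j<n. A' $$ (i,j) * v j) = (\<Sum>j<n. A $$ (i,j) * v j)
        + (\<Sum>j<n. \<Sum>k<m. (c - of_real (\<kappa> k)) * u k i * (cnj (u k j) * v j))"
      using i by (simp add: A'_def distrib_right sum.distrib sum_distrib_right mult.assoc)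
    also have "(\<Sum>j<n. \<Sum>k<m. (c - of_real (\<kappa> k)) * u k i * (cnj (u k j) * v j))
        = (\<Sum>k<m. (c - of_real (\<kappa> k)) * u k i * p k)"
      by (subst sum.swap) (simp add: p_def sum_distrib_left)
    finally show ?thesis .
  qed
  \<comment> \<open>\<open>u l\<close> is an eigenvector of \<open>A'\<close> with eigenvalue
    \<open>c\<close>. Pairing it with the eigenvector \<open>v\<close> gives e p = c p, and
    \<open>e\<close> differs from \<open>c\<close>.\<close>
  have p0: "p l = 0" if l: "l < m" for l
  proof -
    have "e * p l = (\<Sum>i<n. cnj (u l i) * (\<Sum>j<n. A' $$ (i,j) * v j))"
      by (simp add: v(1) p_def mult.left_commute flip: sum_distrib_left)
    also have "\<dots> = (\<Sum>i<n. cnj (u l i) * ((\<Sum>j<n. A $$ (i,j) * v j)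
        + (\<Sum>k<m. (c - of_real (\<kappa> k)) * u k i * p k)))"
      by (rule sum.cong) (simp_all add: split)
    also have "\<dots> = (\<Sum>i<n. cnj (u l i) * (\<Sum>j<n. A $$ (i,j) * v j))
        + (\<Sum>i<n. \<Sum>k<m. (c - of_real (\<kappa> k)) * p k * (cnj (u l i) * u k i))"
      by (simp add: distrib_left sum.distrib sum_distrib_left mult_ac)
    also have "(\<Sum>i<n. cnj (u l i) * (\<Sum>j<n. A $$ (i,j) * v j)) = of_real (\<kappa> l) * p l"
      by (subst hermitian_form_swap[OF A, symmetric])
         (simp add: ev[OF l] p_def mult.assoc flip: sum_distrib_left)
    also have "(\<Sum>i<n. \<Sum>k<m. (c - of_real (\<kappa> k)) * p k * (cnj (u l i) * u k i))
        = (c - of_real (\<kappa> l)) * p l"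
    proof (subst sum.swap, simp add: sum_distrib_left[symmetric])
      have "(\<Sum>k<m. (c - of_real (\<kappa> k)) * p k * (\<Sum>i<n. cnj (u l i) * u k i))
          = (\<Sum>k<m. if k = l then (c - of_real (\<kappa> k)) * p k else 0)"
        by (rule sum.cong) (use l norm1 in auto)
      thus "(\<Sum>k<m. (c - of_real (\<kappa> k)) * p k * (\<Sum>i<n. cnj (u l i) * u k i)) = (c - of_real (\<kappa> l)) * p l"
        using l by simp
    qed
    finally have "e * p l = c * p l" by (simp add: algebra_simps)
    thus ?thesis using e(2) by simp
  qed
  have Av: "(\<Sum>j<n. A $$ (i,j) * v j) = e * v i" if "i < n" for i
    using split[OF that] v(1)[OF that] p0 by simp
  define N where "N = (\<Sum>i<n. (cmod (v i))\<^sup>2)"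
  have N: "N > 0"
    using v(2) unfolding N_def by (auto intro!: sum_pos2)
  have nv: "(\<Sum>i<n. cnj (v i) * v i) = of_real N" unfolding N_def by (rule sum_cnj_mult_self)
  have "cnj e * of_real N = (\<Sum>i<n. cnj (\<Sum>j<n. A $$ (i,j) * v j) * v i)"
    unfolding nv[symmetric] sum_distrib_left by (rule sum.cong) (simp_all add: Av mult.assoc del: cnj_sum)
  also have "\<dots> = (\<Sum>i<n. cnj (v i) * (\<Sum>j<n. A $$ (i,j) * v j))"
    by (rule hermitian_form_swap[OF A])
  also have "\<dots> = e * of_real N"
    unfolding nv[symmetric] sum_distrib_left[of e] by (rule sum.cong) (simp_all add: Av mult.left_commute)
  finally have "cnj e * of_real N = e * of_real N" .
  hence "cnj e = e" using N by simp
  then obtain r where r: "e = of_real r" by (metis Reals_cnj_iff Reals_cases)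
  define w where "w i = v i / of_real (sqrt N)" for i
  have 1: "(\<Sum>j<n. A $$ (i,j) * w j) = of_real r * w i" if "i < n" for i
    using Av[OF that] by (simp add: w_def r sum_divide_distrib[symmetric])
  have "(\<Sum>i<n. cnj (w i) * w i) = (\<Sum>i<n. cnj (v i) * v i) / of_real (sqrt N * sqrt N)"
    by (simp add: w_def sum_divide_distrib flip: of_real_mult)
  hence 2: "(\<Sum>i<n. cnj (w i) * w i) = 1" using nv N by simp
  have 3: "(\<Sum>i<n. cnj (u k i) * w i) = 0" if "k < m" for k
    using p0[OF that] by (simp add: p_def w_def sum_divide_distrib[symmetric])
  show ?thesis using that[of w r] 1 2 3 by blast
qed

lemma hermitian_orthonormal_eigenvectors:
  assumes A: "A \<in> carrier_mat n n" "adj A = A" and "m \<le> n"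
  shows "\<exists>u (\<kappa> :: nat \<Rightarrow> real). orthonormal n m u \<and>
    (\<forall>k<m. \<forall>i<n. (\<Sum>j<n. A $$ (i,j) * u k j) = of_real (\<kappa> k) * u k i)"
  using \<open>m \<le> n\<close>
proof (induction m)
  case 0
  show ?case by (auto simp: orthonormal_def)
next
  case (Suc m)
  then obtain u and \<kappa> :: "nat \<Rightarrow> real" where IH: "orthonormal n m u"
    "\<And>k i. k < m \<Longrightarrow> i < n \<Longrightarrow> (\<Sum>j<n. A $$ (i,j) * u k j) = of_real (\<kappa> k) * u k i"
    by auto
  obtain v and r :: real where v: "\<And>i. i < n \<Longrightarrow> (\<Sum>j<n. A $$ (i,j) * v j) = of_real r * v i"
    "(\<Sum>i<n. cnj (v i) * v i) = 1" "\<And>k. k < m \<Longrightarrow> (\<Sum>i<n. cnj (u k i) * v i) = 0"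
    using hermitian_new_eigenvector[OF A _ IH] Suc.prems by auto
  have v': "(\<Sum>i<n. cnj (v i) * u k i) = 0" if "k < m" for k
  proof -
    have "(\<Sum>i<n. cnj (v i) * u k i) = cnj (\<Sum>i<n. cnj (u k i) * v i)"
      by (simp add: mult.commute)
    thus ?thesis using v(3)[OF that] by simp
  qed
  have "orthonormal n (Suc m) (u(m := v))"
    using IH(1) v(2,3) v' by (auto simp: orthonormal_def less_Suc_eq)
  moreover have "\<forall>k<Suc m. \<forall>i<n. (\<Sum>j<n. A $$ (i,j) * (u(m := v)) k j)
      = of_real ((\<kappa>(m := r)) k) * (u(m := v)) k i"
    using IH(2) v(1) by (auto simp: less_Suc_eq)
  ultimately show ?case by blast
qed

text \<open>Orthonormality says that the square matrix U with columns \<open>u k\<close> has left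
  inverse \<open>adj U\<close>; a left inverse of a square matrix is also a right inverse, which is
  the resolution of the identity.\<close>

lemma orthonormal_complete:
  assumes on: "orthonormal n n u" and "i < n" "j < n"
  shows "(\<Sum>k<n. u k i * cnj (u k j)) = (if i = j then 1 else 0)"
proof -
  define U where "U = mat n n (\<lambda>(i,k). u k i)"
  have U: "U \<in> carrier_mat n n" by (simp add: U_def)
  have "adj U * U = 1\<^sub>m n"
  proof (rule eq_matI)
    fix k l assume "k < dim_row (1\<^sub>m n :: complex mat)" "l < dim_col (1\<^sub>m n :: complex mat)"
    hence "k < n" "l < n" by auto
    thus "(adj U * U) $$ (k,l) = 1\<^sub>m n $$ (k,l)"
      using on mult_mat_entry[OF adj_carrier[OF U] U, of k l]
      by (simp add: orthonormal_def adj_entry[OF U] del: index_mult_mat(1)) (simp add: U_def)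
  qed (simp_all add: U_def adj_def)
  hence "U * adj U = 1\<^sub>m n" using mat_mult_left_right_inverse[of "adj U" n U] U by auto
  moreover have "(U * adj U) $$ (i,j) = (\<Sum>k<n. u k i * cnj (u k j))"
    using mult_mat_entry[OF U adj_carrier[OF U], of i j] assms(2,3)
    by (simp add: adj_entry[OF U] del: index_mult_mat(1)) (simp add: U_def)
  ultimately show ?thesis using assms(2,3) by simp
qed

text \<open>This is U diag(\<kappa>) U^dagger, with real \<kappa> so that it is Hermitian by form.
  The eigenbasis is a parameter: matrices sharing it are multiplied, shifted and compared through
  their eigenvalues only.\<close>

definition spectral_mat :: "nat \<Rightarrow> (nat \<Rightarrow> nat \<Rightarrow> complex) \<Rightarrow> (nat \<Rightarrow> real) \<Rightarrow> complex mat" where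
  "spectral_mat n u \<kappa> = mat n n (\<lambda>(i,j). \<Sum>k<n. of_real (\<kappa> k) * u k i * cnj (u k j))"

lemma spectral_mat_carrier [simp]: "spectral_mat n u \<kappa> \<in> carrier_mat n n"
  by (simp add: spectral_mat_def)

lemma dim_spectral_mat [simp]: "dim_row (spectral_mat n u \<kappa>) = n" "dim_col (spectral_mat n u \<kappa>) = n"
  by (simp_all add: spectral_mat_def)

text \<open>A matrix is determined by its action on a basis: the resolution of the identity is
  inserted to the right of A.\<close>

lemma spectral_mat_eqI:
  assumes A: "A \<in> carrier_mat n n" and on: "orthonormal n n u"
    and ev: "\<And>k i. k < n \<Longrightarrow> i < n \<Longrightarrow> (\<Sum>j<n. A $$ (i,j) * u k j) = of_real (\<kappa> k) * u k i"
  shows "A = spectral_mat n u \<kappa>"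
proof (rule eq_matI)
  fix i j assume "i < dim_row (spectral_mat n u \<kappa>)" "j < dim_col (spectral_mat n u \<kappa>)"
  hence i: "i < n" and j: "j < n" by (auto simp: spectral_mat_def)
  have "A $$ (i,j) = (\<Sum>l<n. A $$ (i,l) * (if l = j then 1 else 0))"
    using j by (simp add: if_distrib cong: if_cong)
  also have "\<dots> = (\<Sum>l<n. A $$ (i,l) * (\<Sum>k<n. u k l * cnj (u k j)))"
    by (rule sum.cong) (use orthonormal_complete[OF on] j in auto)
  also have "\<dots> = (\<Sum>k<n. (\<Sum>l<n. A $$ (i,l) * u k l) * cnj (u k j))"
    by (simp add: sum_distrib_left sum_distrib_right mult.assoc) (rule sum.swap)
  also have "\<dots> = spectral_mat n u \<kappa> $$ (i,j)"
    using i j by (simp add: ev spectral_mat_def)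
  finally show "A $$ (i,j) = spectral_mat n u \<kappa> $$ (i,j)" .
qed (use A in \<open>auto simp: spectral_mat_def\<close>)

theorem hermitian_spectral:
  assumes A: "A \<in> carrier_mat n n" "adj A = A"
  obtains u \<kappa> where "orthonormal n n u" "A = spectral_mat n u \<kappa>"
proof -
  obtain u and \<kappa> :: "nat \<Rightarrow> real" where u: "orthonormal n n u"
    "\<forall>k<n. \<forall>i<n. (\<Sum>j<n. A $$ (i,j) * u k j) = of_real (\<kappa> k) * u k i"
    using hermitian_orthonormal_eigenvectors[OF A order_refl] by blast
  with spectral_mat_eqI[OF A(1) u(1), of \<kappa>] show ?thesis using that by blast
qed

section \<open>Positive square roots, trace norm and fidelity\<close>

definition qform :: "nat \<Rightarrow> complex mat \<Rightarrow> (nat \<Rightarrow> complex) \<Rightarrow> complex" where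
  "qform k M v = (\<Sum>i<k. \<Sum>j<k. cnj (v i) * M $$ (i,j) * v j)"

lemma psd_iff: "psd k M \<longleftrightarrow> M \<in> carrier_mat k k \<and> (\<forall>v. Im (qform k M v) = 0 \<and> Re (qform k M v) \<ge> 0)"
  by (simp add: psd_def qform_def Let_def)

lemma qform_pair:
  assumes "i < k" "j < k" "i \<noteq> j"
  shows "qform k M (\<lambda>l. if l = i then 1 else if l = j then z else 0)
    = M $$ (i,i) + M $$ (i,j) * z + cnj z * M $$ (j,i) + cnj z * M $$ (j,j) * z"
proof -
  let ?v = "\<lambda>l. if l = i then 1 else if l = j then z else 0"
  have red: "(\<Sum>l<k. g l) = g i + g j" if "\<And>l. l \<noteq> i \<Longrightarrow> l \<noteq> j \<Longrightarrow> g l = 0" for g :: "nat \<Rightarrow> complex"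
  proof -
    have "(\<Sum>l<k. g l) = (\<Sum>l\<in>{i,j}. g l)"
      by (rule sum.mono_neutral_right) (use assms that in auto)
    thus ?thesis using assms by simp
  qed
  have "qform k M ?v = (\<Sum>l<k. cnj (?v l) * (M $$ (l,i) + M $$ (l,j) * z))"
    unfolding qform_def by (rule sum.cong[OF refl], subst red) (use assms in \<open>auto simp: algebra_simps\<close>)
  also have "\<dots> = (M $$ (i,i) + M $$ (i,j) * z) + cnj z * (M $$ (j,i) + M $$ (j,j) * z)"
    by (subst red) (use assms in auto)
  finally show ?thesis by (simp add: algebra_simps)
qed

lemma qform_unit:
  assumes "i < k"
  shows "qform k M (\<lambda>l. if l = i then 1 else 0) = M $$ (i,i)"
proof -
  have "qform k M (\<lambda>l. if l = i then 1 else 0)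
      = (\<Sum>a<k. if a = i then (\<Sum>b<k. if b = i then M $$ (a,b) else 0) else 0)"
    unfolding qform_def
    by (intro sum.cong refl) (auto simp: if_distrib[of "\<lambda>x. _ * x"] cong: if_cong)
  also have "\<dots> = M $$ (i,i)" using assms by simp
  finally show ?thesis .
qed

text \<open>\<open>psd\<close> only asks for a real nonnegative quadratic form. Polarisation
  recovers the symmetry: the form is real on e_i + e_j, so the imaginary parts of the two
  off-diagonal entries are opposite, and real on e_i + \<i> e_j, so their real parts agree.\<close>

lemma psd_hermitian:
  assumes "psd k M"
  shows "adj M = M"
proof -
  have M: "M \<in> carrier_mat k k" and im: "\<And>v. Im (qform k M v) = 0"
    using assms by (auto simp: psd_iff)
  have diag: "Im (M $$ (i,i)) = 0" if "i < k" for i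
    using im[of "\<lambda>l. if l = i then 1 else 0"] qform_unit[OF that] by simp
  have "cnj (M $$ (j,i)) = M $$ (i,j)" if ij: "i < k" "j < k" for i j
  proof (cases "i = j")
    case True
    thus ?thesis using diag[OF ij(1)] by (simp add: complex_eq_iff)
  next
    case False
    have "Im (M $$ (i,j)) = - Im (M $$ (j,i))"
      using im[of "\<lambda>l. if l = i then 1 else if l = j then 1 else 0"] diag ij
      unfolding qform_pair[OF ij False] by simp
    moreover have "Re (M $$ (i,j)) = Re (M $$ (j,i))"
      using im[of "\<lambda>l. if l = i then 1 else if l = j then \<i> else 0"] diag ij
      unfolding qform_pair[OF ij False] by simp
    ultimately show ?thesis by (simp add: complex_eq_iff)
  qed
  thus ?thesis using M by (intro eq_matI) (auto simp: adj_def)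
qed

lemma cnj_mult_self: "cnj z * z = of_real ((cmod z)\<^sup>2)"
  by (metis complex_norm_square mult.commute)

lemma qform_spectral_mat:
  "qform n (spectral_mat n u \<kappa>) v = of_real (\<Sum>k<n. \<kappa> k * (cmod (\<Sum>j<n. cnj (u k j) * v j))\<^sup>2)"
proof -
  have "qform n (spectral_mat n u \<kappa>) v
      = (\<Sum>i<n. \<Sum>j<n. \<Sum>k<n. cnj (v i) * (of_real (\<kappa> k) * u k i * cnj (u k j)) * v j)"
    unfolding qform_def
    by (intro sum.cong refl) (auto simp: spectral_mat_def sum_distrib_left sum_distrib_right)
  also have "\<dots> = (\<Sum>i<n. \<Sum>k<n. \<Sum>j<n. cnj (v i) * (of_real (\<kappa> k) * u k i * cnj (u k j)) * v j)"
    by (rule sum.cong[OF refl], rule sum.swap)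
  also have "\<dots> = (\<Sum>k<n. \<Sum>i<n. \<Sum>j<n. cnj (v i) * (of_real (\<kappa> k) * u k i * cnj (u k j)) * v j)"
    by (rule sum.swap)
  also have "\<dots> = (\<Sum>k<n. of_real (\<kappa> k) *
      (cnj (\<Sum>i<n. cnj (u k i) * v i) * (\<Sum>j<n. cnj (u k j) * v j)))"
    by (intro sum.cong refl) (simp add: sum_product sum_distrib_left mult_ac)
  also have "\<dots> = of_real (\<Sum>k<n. \<kappa> k * (cmod (\<Sum>j<n. cnj (u k j) * v j))\<^sup>2)"
    unfolding cnj_mult_self by simp
  finally show ?thesis .
qed

lemma psd_spectral_mat:
  assumes "\<And>k. k < n \<Longrightarrow> \<kappa> k \<ge> 0"
  shows "psd n (spectral_mat n u \<kappa>)"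
  unfolding psd_iff qform_spectral_mat by (auto intro!: sum_nonneg mult_nonneg_nonneg assms)

lemma spectral_mat_ge0:
  assumes on: "orthonormal n n u" and p: "psd n (spectral_mat n u \<kappa>)" and k: "k < n"
  shows "\<kappa> k \<ge> 0"
proof -
  have "0 \<le> (\<Sum>l<n. \<kappa> l * (cmod (\<Sum>j<n. cnj (u l j) * u k j))\<^sup>2)"
    using p unfolding psd_iff qform_spectral_mat by simp
  also have "\<dots> = (\<Sum>l<n. if l = k then \<kappa> l else 0)"
    by (rule sum.cong) (use on k in \<open>auto simp: orthonormal_def\<close>)
  finally show ?thesis using k by simp
qed

lemma adj_spectral_mat: "adj (spectral_mat n u \<kappa>) = spectral_mat n u \<kappa>"
  by (rule eq_matI) (auto simp: adj_def spectral_mat_def mult_ac)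

lemma spectral_mat_apply:
  assumes "orthonormal n n u" "k < n" "i < n"
  shows "(\<Sum>j<n. spectral_mat n u \<kappa> $$ (i,j) * u k j) = of_real (\<kappa> k) * u k i"
proof -
  have "(\<Sum>j<n. spectral_mat n u \<kappa> $$ (i,j) * u k j)
      = (\<Sum>j<n. \<Sum>l<n. of_real (\<kappa> l) * u l i * (cnj (u l j) * u k j))"
    using assms by (auto simp: spectral_mat_def sum_distrib_right mult.assoc intro!: sum.cong)
  also have "\<dots> = (\<Sum>l<n. of_real (\<kappa> l) * u l i * (\<Sum>j<n. cnj (u l j) * u k j))"
    by (subst sum.swap) (simp add: sum_distrib_left)
  also have "\<dots> = (\<Sum>l<n. if l = k then of_real (\<kappa> l) * u l i else 0)"
    by (rule sum.cong) (use assms in \<open>auto simp: orthonormal_def\<close>)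
  finally show ?thesis using assms by simp
qed

lemma spectral_mat_mult:
  assumes on: "orthonormal n n u"
  shows "spectral_mat n u \<kappa> * spectral_mat n u \<kappa>' = spectral_mat n u (\<lambda>k. \<kappa> k * \<kappa>' k)"
proof (rule spectral_mat_eqI[OF _ on])
  show "spectral_mat n u \<kappa> * spectral_mat n u \<kappa>' \<in> carrier_mat n n"
    by (rule mult_carrier_mat[OF spectral_mat_carrier spectral_mat_carrier])
  fix k i assume k: "k < n" and i: "i < n"
  let ?A = "spectral_mat n u \<kappa>" and ?B = "spectral_mat n u \<kappa>'"
  have "(\<Sum>j<n. (?A * ?B) $$ (i,j) * u k j) = (\<Sum>j<n. \<Sum>l<n. ?A $$ (i,l) * (?B $$ (l,j) * u k j))"
    using i mult_mat_entry[OF spectral_mat_carrier spectral_mat_carrier]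
    by (simp add: sum_distrib_right mult.assoc del: index_mult_mat(1))
  also have "\<dots> = (\<Sum>l<n. ?A $$ (i,l) * (\<Sum>j<n. ?B $$ (l,j) * u k j))"
    by (subst sum.swap) (simp add: sum_distrib_left)
  also have "\<dots> = (\<Sum>l<n. of_real (\<kappa>' k) * (?A $$ (i,l) * u k l))"
    by (rule sum.cong) (simp_all add: spectral_mat_apply[OF on k])
  also have "\<dots> = of_real (\<kappa> k * \<kappa>' k) * u k i"
    by (simp add: sum_distrib_left[symmetric] spectral_mat_apply[OF on k i])
  finally show "(\<Sum>j<n. (?A * ?B) $$ (i,j) * u k j) = of_real (\<kappa> k * \<kappa>' k) * u k i" .
qed

lemma mtrace_spectral_mat:
  assumes on: "orthonormal n n u"
  shows "mtrace (spectral_mat n u \<kappa>) = of_real (\<Sum>k<n. \<kappa> k)"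
proof -
  have "mtrace (spectral_mat n u \<kappa>) = (\<Sum>i<n. \<Sum>k<n. of_real (\<kappa> k) * (cnj (u k i) * u k i))"
    by (simp add: mtrace_def spectral_mat_def mult_ac)
  also have "\<dots> = (\<Sum>k<n. of_real (\<kappa> k) * (\<Sum>i<n. cnj (u k i) * u k i))"
    by (subst sum.swap) (simp add: sum_distrib_left)
  also have "\<dots> = (\<Sum>k<n. of_real (\<kappa> k))"
    by (rule sum.cong) (use on in \<open>auto simp: orthonormal_def\<close>)
  finally show ?thesis by simp
qed

text \<open>Makes the description in \<open>msqrt\<close> denote. For an eigenvector u of B with
  eigenvalue \<kappa>, the vector w = C u - \<kappa> u satisfies C w = - \<kappa> w, because C and B
  have the same square. Positivity of C then gives \<kappa> |w|^2 \<le> 0, so w = 0 when \<kappa> >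
  0. When \<kappa> = 0, |C u|^2 is the inner product of u with C C u = 0. Thus C acts on the
  eigenbasis as B does.\<close>

lemma psd_sqrt_unique:
  assumes B: "psd n B" and C: "psd n C" and eq: "B * B = C * C"
  shows "C = B"
proof -
  have Bc: "B \<in> carrier_mat n n" and Cc: "C \<in> carrier_mat n n"
    using B C by (auto simp: psd_def)
  obtain u \<kappa> where on: "orthonormal n n u" and Bs: "B = spectral_mat n u \<kappa>"
    using hermitian_spectral[OF Bc psd_hermitian[OF B]] by blast
  have \<kappa>: "\<kappa> k \<ge> 0" if "k < n" for k
    using spectral_mat_ge0[OF on B[unfolded Bs] that] .
  have "C = spectral_mat n u \<kappa>"
  proof (rule spectral_mat_eqI[OF Cc on])
    fix k i assume k: "k < n" and i: "i < n"
    define c where "c i = (\<Sum>j<n. C $$ (i,j) * u k j)" for i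
    define w where "w i = c i - of_real (\<kappa> k) * u k i" for i
    have CC: "(\<Sum>j<n. C $$ (i,j) * c j) = of_real ((\<kappa> k)\<^sup>2) * u k i" if "i < n" for i
    proof -
      have "(\<Sum>j<n. C $$ (i,j) * c j) = (\<Sum>j<n. (\<Sum>l<n. C $$ (i,l) * C $$ (l,j)) * u k j)"
        unfolding c_def by (simp add: sum_distrib_left sum_distrib_right mult.assoc) (rule sum.swap)
      also have "\<dots> = (\<Sum>j<n. (B * B) $$ (i,j) * u k j)"
        using mult_mat_entry[OF Cc Cc] that by (simp add: eq del: index_mult_mat(1))
      finally show ?thesis
        using spectral_mat_apply[OF on k that] by (simp add: Bs spectral_mat_mult[OF on] power2_eq_square)
    qed
    have Cw: "(\<Sum>j<n. C $$ (i,j) * w j) = - (of_real (\<kappa> k) * w i)" if "i < n" for i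
    proof -
      have "(\<Sum>j<n. C $$ (i,j) * w j) = (\<Sum>j<n. C $$ (i,j) * c j) - of_real (\<kappa> k) * c i"
        by (simp add: w_def right_diff_distrib sum_subtractf c_def sum_distrib_left mult_ac)
      thus ?thesis using CC[OF that] by (simp add: w_def algebra_simps power2_eq_square)
    qed
    have "qform n C w = (\<Sum>i<n. cnj (w i) * (\<Sum>j<n. C $$ (i,j) * w j))"
      by (simp add: qform_def sum_distrib_left mult.assoc)
    also have "\<dots> = (\<Sum>i<n. - of_real (\<kappa> k) * (cnj (w i) * w i))"
      by (rule sum.cong) (simp_all add: Cw)
    also have "\<dots> = - of_real (\<kappa> k) * of_real (\<Sum>i<n. (cmod (w i))\<^sup>2)"
      by (simp only: sum_cnj_mult_self[symmetric] sum_distrib_left)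
    finally have "qform n C w = of_real (- (\<kappa> k * (\<Sum>i<n. (cmod (w i))\<^sup>2)))" by simp
    moreover have "Re (qform n C w) \<ge> 0" using C by (simp add: psd_iff)
    ultimately have le: "\<kappa> k * (\<Sum>i<n. (cmod (w i))\<^sup>2) \<le> 0" by simp
    have "(\<Sum>i<n. (cmod (w i))\<^sup>2) = 0"
    proof (cases "\<kappa> k = 0")
      case True
      have "(\<Sum>i<n. cnj (w i) * w i) = (\<Sum>i<n. cnj (\<Sum>j<n. C $$ (i,j) * u k j) * c i)"
        by (simp add: w_def True c_def)
      also have "\<dots> = (\<Sum>i<n. cnj (u k i) * (\<Sum>j<n. C $$ (i,j) * c j))"
        by (rule hermitian_form_swap[OF Cc psd_hermitian[OF C]])
      also have "\<dots> = 0" by (rule sum.neutral) (simp add: CC True)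
      finally show ?thesis by (simp only: sum_cnj_mult_self of_real_eq_0_iff)
    next
      case False
      with \<kappa>[OF k] have "\<kappa> k > 0" by simp
      with le have "(\<Sum>i<n. (cmod (w i))\<^sup>2) \<le> 0" by (simp add: mult_le_0_iff)
      thus ?thesis by (intro antisym sum_nonneg) auto
    qed
    hence "w i = 0" using i by (subst (asm) sum_nonneg_eq_0_iff) auto
    thus "(\<Sum>j<n. C $$ (i,j) * u k j) = of_real (\<kappa> k) * u k i" by (simp add: w_def c_def)
  qed
  thus ?thesis by (simp add: Bs)
qed

lemma msqrt_eqI:
  assumes "psd n B" "B * B = M"
  shows "msqrt n M = B"
  unfolding msqrt_def
proof (rule the_equality)
  fix C assume "psd n C \<and> C * C = M"
  thus "C = B" using psd_sqrt_unique[OF assms(1), of C] assms(2) by simp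
qed (use assms in simp)

lemma psd_msqrt:
  assumes "psd n M"
  shows "psd n (msqrt n M)" "msqrt n M * msqrt n M = M"
proof -
  have Mc: "M \<in> carrier_mat n n" using assms by (auto simp: psd_def)
  obtain u \<kappa> where on: "orthonormal n n u" and Ms: "M = spectral_mat n u \<kappa>"
    using hermitian_spectral[OF Mc psd_hermitian[OF assms]] by blast
  let ?B = "spectral_mat n u (\<lambda>k. sqrt \<bar>\<kappa> k\<bar>)"
  have "\<kappa> k \<ge> 0" if "k < n" for k
    using spectral_mat_ge0[OF on assms[unfolded Ms] that] .
  hence "?B * ?B = M" unfolding Ms spectral_mat_mult[OF on]
    by (auto simp: spectral_mat_def intro!: cong_mat sum.cong)
  moreover have "psd n ?B" by (rule psd_spectral_mat) auto
  ultimately show "psd n (msqrt n M)" "msqrt n M * msqrt n M = M"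
    using msqrt_eqI[of n ?B M] by simp_all
qed

lemma trace_norm_spectral_mat:
  assumes on: "orthonormal n n u"
  shows "trace_norm (spectral_mat n u \<kappa>) = (\<Sum>k<n. \<bar>\<kappa> k\<bar>)"
proof -
  have "msqrt n (adj (spectral_mat n u \<kappa>) * spectral_mat n u \<kappa>) = spectral_mat n u (\<lambda>k. \<bar>\<kappa> k\<bar>)"
    by (rule msqrt_eqI) (auto intro!: psd_spectral_mat simp: adj_spectral_mat spectral_mat_mult[OF on])
  moreover have "dim_col (spectral_mat n u \<kappa>) = n" by (simp add: spectral_mat_def)
  ultimately show ?thesis by (simp add: trace_norm_def mtrace_spectral_mat[OF on])
qed

section \<open>Fidelity with a pure state\<close>

definition rank_one :: "nat \<Rightarrow> (nat \<Rightarrow> complex) \<Rightarrow> complex mat" where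
  "rank_one k p = mat k k (\<lambda>(i,j). p i * cnj (p j))"

lemma qform_rank_one:
  "qform k (rank_one k p) v = of_real ((cmod (\<Sum>j<k. cnj (p j) * v j))\<^sup>2)"
proof -
  have "qform k (rank_one k p) v = cnj (\<Sum>i<k. cnj (p i) * v i) * (\<Sum>j<k. cnj (p j) * v j)"
    by (simp add: qform_def rank_one_def sum_product mult_ac)
  thus ?thesis unfolding cnj_mult_self .
qed

lemma psd_rank_one: "psd k (rank_one k p)"
  unfolding psd_iff qform_rank_one by (simp add: rank_one_def)

lemma psd_smult:
  assumes "psd k M" "c \<ge> 0"
  shows "psd k (of_real c \<cdot>\<^sub>m M)"
proof -
  have M: "M \<in> carrier_mat k k" using assms(1) by (simp add: psd_iff)
  have "qform k (of_real c \<cdot>\<^sub>m M) v = of_real c * qform k M v" for v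
    using M by (simp add: qform_def sum_distrib_left mult_ac)
  thus ?thesis using assms by (simp add: psd_iff)
qed

text \<open>For the projection P onto a unit vector p, P M P is \<open>qform k M p\<close> times P.
  With M = 1 this makes P its own square root; with M = \<rho> it makes the squared modulus of sqrt
  \<rho> P a multiple of P, whose root has an explicit trace. The squared fidelity is therefore
  linear in \<rho>.\<close>

lemma fidelity_rank_one:
  assumes \<rho>: "psd k \<rho>" and p: "(\<Sum>i<k. (cmod (p i))\<^sup>2) = 1"
  shows "fidelity k \<rho> (rank_one k p) = sqrt (Re (qform k \<rho> p))"
proof -
  let ?P = "rank_one k p"
  have Pc: "?P \<in> carrier_mat k k" by (simp add: rank_one_def)
  have \<rho>c: "\<rho> \<in> carrier_mat k k" using \<rho> by (simp add: psd_iff)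
  have pp: "(\<Sum>i<k. cnj (p i) * p i) = 1" unfolding sum_cnj_mult_self p by simp
  have PMP: "?P * (M * ?P) = qform k M p \<cdot>\<^sub>m ?P" if M: "M \<in> carrier_mat k k" for M
  proof (rule eq_matI)
    fix i j assume "i < dim_row (qform k M p \<cdot>\<^sub>m ?P)" "j < dim_col (qform k M p \<cdot>\<^sub>m ?P)"
    hence i: "i < k" and j: "j < k" by (simp_all add: rank_one_def)
    have "(?P * (M * ?P)) $$ (i,j) = (\<Sum>a<k. ?P $$ (i,a) * (\<Sum>b<k. M $$ (a,b) * ?P $$ (b,j)))"
      using mult_mat_entry[OF Pc mult_carrier_mat[OF M Pc] i j] mult_mat_entry[OF M Pc _ j] by simp
    also have "\<dots> = qform k M p * (p i * cnj (p j))"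
      using i j by (simp add: rank_one_def qform_def sum_distrib_left sum_distrib_right mult_ac)
    finally show "(?P * (M * ?P)) $$ (i,j) = (qform k M p \<cdot>\<^sub>m ?P) $$ (i,j)"
      using i j by (simp add: rank_one_def)
  qed (use Pc M in auto)
  have PP: "?P * ?P = ?P"
  proof -
    have "qform k (1\<^sub>m k) p = (\<Sum>i<k. \<Sum>j<k. if j = i then cnj (p i) * p j else 0)"
      unfolding qform_def by (intro sum.cong refl) auto
    hence "qform k (1\<^sub>m k) p = 1" using pp by simp
    thus ?thesis using PMP[of "1\<^sub>m k"] Pc by auto
  qed
  have sP: "msqrt k ?P = ?P" by (rule msqrt_eqI[OF psd_rank_one PP])
  define S where "S = msqrt k \<rho>"
  have S: "psd k S" "S * S = \<rho>" using psd_msqrt[OF \<rho>] by (simp_all add: S_def)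
  have Sc: "S \<in> carrier_mat k k" using S by (simp add: psd_iff)
  have adj_mult: "adj (S * ?P) = ?P * S"
  proof (rule eq_matI)
    fix i j assume "i < dim_row (?P * S)" "j < dim_col (?P * S)"
    hence i: "i < k" and j: "j < k" using Pc Sc by auto
    have h: "cnj (S $$ (j,a)) = S $$ (a,j)" if "a < k" for a
      using hermitian_entry[OF Sc psd_hermitian[OF S(1)] that j] .
    have "adj (S * ?P) $$ (i,j) = cnj (\<Sum>a<k. S $$ (j,a) * ?P $$ (a,i))"
      using adj_entry[OF mult_carrier_mat[OF Sc Pc] i j] mult_mat_entry[OF Sc Pc j i] by simp
    also have "\<dots> = (\<Sum>a<k. ?P $$ (i,a) * S $$ (a,j))"
      using i by (simp add: h rank_one_def mult_ac)
    finally show "adj (S * ?P) $$ (i,j) = (?P * S) $$ (i,j)"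
      using mult_mat_entry[OF Pc Sc i j] by simp
  qed (use Pc Sc in \<open>auto simp: adj_def\<close>)
  define c where "c = Re (qform k \<rho> p)"
  have c0: "c \<ge> 0" and qc: "qform k \<rho> p = of_real c"
    using \<rho> by (auto simp: psd_iff c_def complex_eq_iff)
  have "adj (S * ?P) * (S * ?P) = ?P * (\<rho> * ?P)"
    unfolding adj_mult S(2)[symmetric] using Pc Sc
    by (metis assoc_mult_mat mult_carrier_mat)
  also have "\<dots> = of_real c \<cdot>\<^sub>m ?P" using PMP[OF \<rho>c] qc by simp
  finally have AA: "adj (S * ?P) * (S * ?P) = of_real c \<cdot>\<^sub>m ?P" .
  have "msqrt k (of_real c \<cdot>\<^sub>m ?P) = of_real (sqrt c) \<cdot>\<^sub>m ?P"
  proof (rule msqrt_eqI)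
    show "psd k (of_real (sqrt c) \<cdot>\<^sub>m ?P)" using psd_smult[OF psd_rank_one] c0 by simp
    have "(of_real (sqrt c) \<cdot>\<^sub>m ?P) * (of_real (sqrt c) \<cdot>\<^sub>m ?P)
        = (of_real (sqrt c) * of_real (sqrt c)) \<cdot>\<^sub>m (?P * ?P)"
      using mult_smult_assoc_mat[OF Pc smult_carrier_mat[OF Pc]] mult_smult_distrib[OF Pc Pc]
      by (auto intro!: eq_matI simp: mult.assoc simp del: index_mult_mat(1))
    thus "(of_real (sqrt c) \<cdot>\<^sub>m ?P) * (of_real (sqrt c) \<cdot>\<^sub>m ?P) = of_real c \<cdot>\<^sub>m ?P"
      using c0 by (simp add: PP flip: of_real_mult)
  qed
  moreover have "dim_col (S * ?P) = k" using Pc by simp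
  moreover have "mtrace (of_real (sqrt c) \<cdot>\<^sub>m ?P) = of_real (sqrt c)"
  proof -
    have "mtrace (of_real (sqrt c) \<cdot>\<^sub>m ?P) = of_real (sqrt c) * (\<Sum>i<k. cnj (p i) * p i)"
      by (simp add: mtrace_def rank_one_def sum_distrib_left mult_ac)
    thus ?thesis by (simp only: pp) simp
  qed
  ultimately show ?thesis
    unfolding fidelity_def trace_norm_def sP S_def[symmetric] AA c_def[symmetric] by simp
qed

lemma sum_mult_index:
  "(\<Sum>r<m * k. f r) = (\<Sum>l<m. \<Sum>t<k. f (l * k + t))" for k :: nat
proof -
  have "(\<Sum>r<m * k. f r) = (\<Sum>l<m. sum f {l * k..<l * k + k})"
    by (rule sum.nat_group[symmetric])
  also have "\<dots> = (\<Sum>l<m. \<Sum>t<k. f (l * k + t))"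
  proof (rule sum.cong[OF refl])
    fix l
    have "sum f {l * k..<l * k + k} = sum (\<lambda>t. f (t + l * k)) {0..<k}"
      using sum.shift_bounds_nat_ivl[of f 0 "l * k" k] by (simp add: add.commute)
    thus "sum f {l * k..<l * k + k} = (\<Sum>t<k. f (l * k + t))"
      by (simp add: lessThan_atLeast0 add.commute)
  qed
  finally show ?thesis .
qed

lemma index_pair_less:
  fixes l k :: nat
  assumes "l < m" "t < k"
  shows "l * k + t < m * k"
proof -
  have "l * k + t < Suc l * k" using assms by simp
  also have "\<dots> \<le> m * k" using assms by (intro mult_le_mono1) simp
  finally show ?thesis .
qed

text \<open>The expectation of \<rho> in the maximally entangled vector. It is the squared fidelity,
  and all estimates use it because it is linear in \<rho>.\<close>

definition ent_overlap :: "nat \<Rightarrow> complex mat \<Rightarrow> complex" where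
  "ent_overlap d \<rho> = (\<Sum>l<d. \<Sum>l'<d. \<rho> $$ (l * d + l, l' * d + l')) / of_nat d"

lemma fidelity_max_ent:
  assumes \<rho>: "psd (d * d) \<rho>" and d: "d > 0"
  shows "fidelity (d * d) \<rho> (max_ent d) = sqrt (Re (ent_overlap d \<rho>))"
proof -
  define p :: "nat \<Rightarrow> complex" where
    "p r = (if r div d = r mod d then of_real (1 / sqrt (real d)) else 0)" for r
  have pp: "p r * cnj (p c) = (if r div d = r mod d \<and> c div d = c mod d then 1 / of_nat d else 0)" for r c
  proof -
    have "(of_real (1 / sqrt (real d)) :: complex) * of_real (1 / sqrt (real d)) = of_real (1 / real d)"
      using d by (simp add: field_simps flip: of_real_mult)
    thus ?thesis by (auto simp: p_def simp del: of_real_divide) simp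
  qed
  have P: "max_ent d = rank_one (d * d) p"
    unfolding max_ent_def rank_one_def pp by simp
  have "(\<Sum>r<d * d. (cmod (p r))\<^sup>2) = (\<Sum>l<d. \<Sum>t<d. if t = l then 1 / real d else 0)"
    unfolding sum_mult_index by (intro sum.cong refl) (auto simp: p_def norm_divide power_divide)
  also have "\<dots> = 1" using d by simp
  finally have p1: "(\<Sum>r<d * d. (cmod (p r))\<^sup>2) = 1" .
  have "qform (d * d) \<rho> p = (\<Sum>l<d. \<Sum>t<d. \<Sum>l'<d. \<Sum>t'<d.
      if t' = l' then (if t = l then \<rho> $$ (l * d + l, l' * d + l') / of_nat d else 0) else 0)"
    unfolding qform_def sum_mult_index
  proof (intro sum.cong refl)
    fix l t l' t' assume *: "l \<in> {..<d}" "t \<in> {..<d}" "l' \<in> {..<d}" "t' \<in> {..<d}"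
    have "cnj (p (l * d + t)) * \<rho> $$ (l * d + t, l' * d + t') * p (l' * d + t')
        = \<rho> $$ (l * d + t, l' * d + t') * (p (l' * d + t') * cnj (p (l * d + t)))"
      by (simp add: mult_ac)
    also have "\<dots> = (if t' = l' then (if t = l then \<rho> $$ (l * d + l, l' * d + l') / of_nat d else 0) else 0)"
      unfolding pp using * by auto
    finally show "cnj (p (l * d + t)) * \<rho> $$ (l * d + t, l' * d + t') * p (l' * d + t')
        = (if t' = l' then (if t = l then \<rho> $$ (l * d + l, l' * d + l') / of_nat d else 0) else 0)" .
  qed
  also have "\<dots> = (\<Sum>l<d. \<Sum>t<d. if t = l then (\<Sum>l'<d. \<rho> $$ (l * d + l, l' * d + l') / of_nat d) else 0)"
    by (intro sum.cong refl) simp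
  also have "\<dots> = ent_overlap d \<rho>" by (simp add: ent_overlap_def sum_divide_distrib)
  finally show ?thesis using fidelity_rank_one[OF \<rho> p1] unfolding P by simp
qed

section \<open>Mixed-radix digits\<close>

text \<open>The joint dimension of the factors from \<open>j\<close> on. It covers both the strides
  and the full dimension, and its one-step recursion in \<open>j\<close> drives every induction on
  digits.\<close>

definition tail_dim :: "(nat \<Rightarrow> nat) \<Rightarrow> nat \<Rightarrow> nat \<Rightarrow> nat" where
  "tail_dim d n j = (\<Prod>k\<in>{j..<n}. d k)"

lemma stride_eq_tail_dim: "stride d n i = tail_dim d n (Suc i)"
  by (simp add: stride_def tail_dim_def atLeastSucLessThan_greaterThanLessThan)

lemma dimA_eq_tail_dim: "dimA d n = tail_dim d n 0"
  by (simp add: dimA_def tail_dim_def lessThan_atLeast0)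

lemma tail_dim_step: "j < n \<Longrightarrow> tail_dim d n j = tail_dim d n (Suc j) * d j"
  by (simp add: tail_dim_def prod.atLeast_Suc_lessThan mult.commute)

lemma tail_dim_dvd: "j \<le> k \<Longrightarrow> tail_dim d n k dvd tail_dim d n j"
  unfolding tail_dim_def by (rule prod_dvd_prod_subset) auto

lemma digit_tail: "digit d n i r = (r div tail_dim d n (Suc i)) mod d i"
  by (simp add: digit_def stride_eq_tail_dim)

lemma mod_tail_dim_step:
  "j < n \<Longrightarrow> r mod tail_dim d n j = tail_dim d n (Suc j) * digit d n j r + r mod tail_dim d n (Suc j)"
  by (simp add: tail_dim_step mod_mult2_eq digit_tail)

text \<open>The remainder modulo \<open>tail_dim d n j\<close> is the number spelled by the digits
  from \<open>j\<close> on, which downward induction on \<open>j\<close> makes precise.\<close>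

lemma mod_tail_dim_eqI:
  assumes "j \<le> n" "\<And>k. j \<le> k \<Longrightarrow> k < n \<Longrightarrow> digit d n k r = digit d n k c"
  shows "r mod tail_dim d n j = c mod tail_dim d n j"
  using assms
proof (induction j rule: inc_induct)
  case base
  show ?case by (simp add: tail_dim_def)
next
  case (step j)
  have "r mod tail_dim d n (Suc j) = c mod tail_dim d n (Suc j)"
    by (rule step.IH) (use step.prems in auto)
  thus ?case using step by (simp add: mod_tail_dim_step)
qed

lemma digit_cong_mod:
  assumes "j \<le> k" "k < n" "r mod tail_dim d n j = c mod tail_dim d n j"
    and pos: "tail_dim d n (Suc k) > 0"
  shows "digit d n k r = digit d n k c"
proof -
  have gen: "(S * q + y) div S = q" if "y < S" for q y S :: nat
    by (rule div_nat_eqI) (use that in simp_all)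
  have dig: "digit d n k x = (x mod tail_dim d n k) div tail_dim d n (Suc k)" for x
    unfolding tail_dim_step[OF assms(2)] mod_mult2_eq digit_tail by (rule gen[OF mod_less_divisor[OF pos], symmetric])
  have "r mod tail_dim d n k = c mod tail_dim d n k"
    using assms(3) tail_dim_dvd[OF assms(1)] by (metis mod_mod_cancel)
  thus ?thesis by (simp add: dig)
qed

lemma div_tail_dim_step:
  assumes "j < n"
  shows "r div tail_dim d n (Suc j) = r div tail_dim d n j * d j + digit d n j r"
  by (simp only: tail_dim_step[OF assms] div_mult2_eq digit_tail div_mult_mod_eq)

text \<open>The quotient is spelled by the digits before \<open>j\<close>. The bounds on
  \<open>r\<close> and \<open>c\<close> start the induction: at \<open>j = 0\<close> both quotients
  vanish.\<close>

lemma div_tail_dim_eqI: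
  assumes "r < dimA d n" "c < dimA d n" "j \<le> n" "\<And>k. k < j \<Longrightarrow> digit d n k r = digit d n k c"
  shows "r div tail_dim d n j = c div tail_dim d n j"
  using assms(3,4)
proof (induction j)
  case 0
  thus ?case using assms(1,2) by (simp add: dimA_eq_tail_dim)
next
  case (Suc j)
  thus ?case by (simp add: div_tail_dim_step)
qed

lemma digit_cong_div:
  assumes "k < j" "r div tail_dim d n j = c div tail_dim d n j"
  shows "digit d n k r = digit d n k c"
proof -
  obtain m where m: "tail_dim d n (Suc k) = tail_dim d n j * m"
    using tail_dim_dvd[of "Suc k" j d n] assms(1) by (auto simp: dvd_def)
  show ?thesis using assms(2) by (simp add: digit_tail m div_mult2_eq)
qed

lemma embed_op_entry:
  assumes "r < dimA d n" "c < dimA d n"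
  shows "embed_op d n i T $$ (r,c) = (if \<forall>k<n. k \<noteq> i \<longrightarrow> digit d n k r = digit d n k c
          then T $$ (digit d n i r, digit d n i c) else 0)"
  unfolding embed_op_def using assms by (subst index_mat(1)) (simp_all only: prod.case)

lemma mult_if_zero: "e = (if P then t else 0) \<Longrightarrow> u * e * w = (if P then u * t * w else (0::complex))"
  by simp

locale tensor_factors =
  fixes d :: "nat \<Rightarrow> nat" and n i :: nat
  assumes d_pos: "k < n \<Longrightarrow> d k > 0" and i: "i < n"
begin

lemma tail_pos: "tail_dim d n j > 0"
  unfolding tail_dim_def by (rule prod_pos) (use d_pos in auto)

lemma digit_less: "digit d n i r < d i"
  by (simp add: digit_def d_pos i)

text \<open>An index splits into the part above its \<open>i\<close>-th digit, the digit, and the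
  part below. The subtraction on naturals in \<open>set_digit\<close> is thereby seen to be exact,
  and no later argument meets it again.\<close>

lemma set_digit_eq:
  "set_digit d n i a r = (r div tail_dim d n i * d i + a) * tail_dim d n (Suc i) + r mod tail_dim d n (Suc i)"
proof -
  let ?S = "tail_dim d n (Suc i)"
  have "r = (r div ?S) * ?S + r mod ?S" by simp
  also have "\<dots> = (r div tail_dim d n i * d i + digit d n i r) * ?S + r mod ?S"
    by (simp only: div_tail_dim_step[OF i])
  finally have r: "r = r div tail_dim d n i * d i * ?S + digit d n i r * ?S + r mod ?S"
    by (simp only: add_mult_distrib)
  have "r - digit d n i r * ?S = r div tail_dim d n i * d i * ?S + r mod ?S"
    by (subst r) simp
  thus ?thesis by (simp add: set_digit_def stride_eq_tail_dim add_mult_distrib)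
qed

lemma
  assumes a: "a < d i"
  shows mod_set_digit: "set_digit d n i a r mod tail_dim d n (Suc i) = r mod tail_dim d n (Suc i)"
    and digit_set_digit: "digit d n i (set_digit d n i a r) = a"
    and div_set_digit: "set_digit d n i a r div tail_dim d n i = r div tail_dim d n i"
proof -
  let ?S = "tail_dim d n (Suc i)"
  have div: "set_digit d n i a r div ?S = r div tail_dim d n i * d i + a"
    using tail_pos[of "Suc i"] by (simp add: set_digit_eq)
  show "set_digit d n i a r mod ?S = r mod ?S" by (simp add: set_digit_eq)
  show "digit d n i (set_digit d n i a r) = a" using a by (simp add: digit_tail div)
  show "set_digit d n i a r div tail_dim d n i = r div tail_dim d n i"
  proof -
    have "set_digit d n i a r div tail_dim d n i = set_digit d n i a r div ?S div d i"
      by (simp only: tail_dim_step[OF i] div_mult2_eq)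
    thus ?thesis using a by (simp add: div)
  qed
qed

lemma digit_set_digit_other:
  assumes "a < d i" "k < n" "k \<noteq> i"
  shows "digit d n k (set_digit d n i a r) = digit d n k r"
proof (cases "k < i")
  case True
  thus ?thesis by (rule digit_cong_div) (rule div_set_digit[OF assms(1)])
next
  case False
  hence "Suc i \<le> k" using assms(3) by simp
  thus ?thesis
    by (rule digit_cong_mod[OF _ assms(2) _ tail_pos]) (rule mod_set_digit[OF assms(1)])
qed

lemma set_digit_less:
  assumes "a < d i" "r < dimA d n"
  shows "set_digit d n i a r < dimA d n"
proof -
  obtain m where m: "dimA d n = m * tail_dim d n i"
    using tail_dim_dvd[of 0 i d n] by (auto simp: dvd_def dimA_eq_tail_dim mult.commute)
  have "r div tail_dim d n i < m" using assms(2) tail_pos[of i] by (simp add: m div_less_iff_less_mult)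
  hence "set_digit d n i a r div tail_dim d n i < m" by (simp add: div_set_digit[OF assms(1)])
  thus ?thesis using tail_pos[of i] by (simp add: m div_less_iff_less_mult)
qed

lemma set_digit_set_digit: "b < d i \<Longrightarrow> set_digit d n i a (set_digit d n i b r) = set_digit d n i a r"
  by (simp add: set_digit_eq[of a] mod_set_digit div_set_digit)

lemma set_digit_digit: "set_digit d n i (digit d n i r) r = r"
  by (simp add: set_digit_eq flip: div_tail_dim_step[OF i])

text \<open>Agreement with \<open>r\<close> in the digits before \<open>i\<close> fixes the quotient
  and in the digits after \<open>i\<close> the remainder, so the indices in question are exactly
  \<open>r\<close> with its \<open>i\<close>-th digit replaced.\<close>

lemma sum_agree_off_factor:
  assumes r: "r < dimA d n"
  shows "(\<Sum>c<dimA d n. if \<forall>k<n. k \<noteq> i \<longrightarrow> digit d n k r = digit d n k c then g c else (0::complex))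
    = (\<Sum>a<d i. g (set_digit d n i a r))"
proof -
  let ?C = "{c \<in> {..<dimA d n}. \<forall>k<n. k \<noteq> i \<longrightarrow> digit d n k r = digit d n k c}"
  have "(\<Sum>c<dimA d n. if \<forall>k<n. k \<noteq> i \<longrightarrow> digit d n k r = digit d n k c then g c else 0) = sum g ?C"
    by (subst sum.inter_filter) simp_all
  also have "\<dots> = (\<Sum>a<d i. g (set_digit d n i a r))"
  proof (rule sum.reindex_bij_witness[where j = "digit d n i" and i = "\<lambda>a. set_digit d n i a r"])
    fix c assume c: "c \<in> ?C"
    have "r div tail_dim d n i = c div tail_dim d n i"
      by (rule div_tail_dim_eqI) (use c r i in auto)
    moreover have "r mod tail_dim d n (Suc i) = c mod tail_dim d n (Suc i)"
      by (rule mod_tail_dim_eqI) (use c r i in auto)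
    ultimately have "set_digit d n i (digit d n i c) r = set_digit d n i (digit d n i c) c"
      by (simp add: set_digit_eq)
    thus "set_digit d n i (digit d n i c) r = c" "g (set_digit d n i (digit d n i c) r) = g c"
      by (simp_all add: set_digit_digit)
    show "digit d n i c \<in> {..<d i}" by (simp add: digit_less)
  next
    fix a assume a: "a \<in> {..<d i}"
    show "digit d n i (set_digit d n i a r) = a" using a digit_set_digit by simp
    show "set_digit d n i a r \<in> ?C" using a r set_digit_less digit_set_digit_other by simp
  qed
  finally show ?thesis .
qed

text \<open>Indices whose \<open>i\<close>-th digit is 0 stand for the basis of the remaining factors.\<close>

definition zero_digit :: "nat set" where
  "zero_digit = {b. b < dimA d n \<and> digit d n i b = 0}"

lemma sum_split_digit:
  "(\<Sum>r<dimA d n. h r) = (\<Sum>b\<in>zero_digit. \<Sum>a<d i. h (set_digit d n i a b))"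
proof -
  have 0: "0 < d i" by (rule d_pos[OF i])
  have "(\<Sum>r<dimA d n. h r) = (\<Sum>x\<in>zero_digit \<times> {..<d i}. h (set_digit d n i (snd x) (fst x)))"
  proof (rule sum.reindex_bij_witness[where i = "\<lambda>x. set_digit d n i (snd x) (fst x)"
        and j = "\<lambda>r. (set_digit d n i 0 r, digit d n i r)"])
    fix r assume r: "r \<in> {..<dimA d n}"
    show "set_digit d n i (snd (set_digit d n i 0 r, digit d n i r)) (fst (set_digit d n i 0 r, digit d n i r)) = r"
      "h (set_digit d n i (snd (set_digit d n i 0 r, digit d n i r)) (fst (set_digit d n i 0 r, digit d n i r))) = h r"
      by (simp_all add: set_digit_set_digit[OF 0] set_digit_digit)
    show "(set_digit d n i 0 r, digit d n i r) \<in> zero_digit \<times> {..<d i}"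
      using r by (simp add: zero_digit_def set_digit_less[OF 0] digit_set_digit[OF 0] digit_less)
  next
    fix x assume "x \<in> zero_digit \<times> {..<d i}"
    hence x: "fst x < dimA d n" "digit d n i (fst x) = 0" "snd x < d i"
      by (simp_all add: mem_Times_iff zero_digit_def)
    have "set_digit d n i 0 (set_digit d n i (snd x) (fst x)) = fst x"
      unfolding set_digit_set_digit[OF x(3)] using set_digit_digit[of "fst x"] x(2) by simp
    thus "(set_digit d n i 0 (set_digit d n i (snd x) (fst x)),
        digit d n i (set_digit d n i (snd x) (fst x))) = x"
      by (simp add: digit_set_digit[OF x(3)])
    show "set_digit d n i (snd x) (fst x) \<in> {..<dimA d n}"
      by (simp add: set_digit_less[OF x(3,1)])
  qed
  thus ?thesis by (simp add: sum.cartesian_product split_def)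
qed

text \<open>With A split into factor \<open>i\<close> and the rest, the operator is T tensored with
  the identity: one copy of the form of T for each index \<open>b\<close> of the rest.\<close>

lemma embed_op_form:
  "(\<Sum>r<dimA d n. \<Sum>c<dimA d n. x r * embed_op d n i T $$ (r,c) * y c)
   = (\<Sum>b\<in>zero_digit. \<Sum>a'<d i. \<Sum>a<d i. x (set_digit d n i a' b) * T $$ (a',a) * y (set_digit d n i a b))"
proof -
  have row: "(\<Sum>c<dimA d n. x r * embed_op d n i T $$ (r,c) * y c)
      = (\<Sum>a<d i. x r * T $$ (digit d n i r, a) * y (set_digit d n i a r))" if r: "r < dimA d n" for r
  proof -
    have "(\<Sum>c<dimA d n. x r * embed_op d n i T $$ (r,c) * y c)
        = (\<Sum>c<dimA d n. if \<forall>k<n. k \<noteq> i \<longrightarrow> digit d n k r = digit d n k c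
            then x r * T $$ (digit d n i r, digit d n i c) * y c else 0)"
      using r by (intro sum.cong refl mult_if_zero[OF embed_op_entry]) simp_all
    also have "\<dots> = (\<Sum>a<d i. x r * T $$ (digit d n i r, digit d n i (set_digit d n i a r)) * y (set_digit d n i a r))"
      by (rule sum_agree_off_factor[OF r])
    finally show ?thesis by (simp add: digit_set_digit)
  qed
  have "(\<Sum>r<dimA d n. \<Sum>c<dimA d n. x r * embed_op d n i T $$ (r,c) * y c)
      = (\<Sum>r<dimA d n. \<Sum>a<d i. x r * T $$ (digit d n i r, a) * y (set_digit d n i a r))"
    by (rule sum.cong[OF refl], rule row) simp
  also have "\<dots> = (\<Sum>b\<in>zero_digit. \<Sum>a'<d i. \<Sum>a<d i. x (set_digit d n i a' b) *
      T $$ (digit d n i (set_digit d n i a' b), a) * y (set_digit d n i a (set_digit d n i a' b)))"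
    by (rule sum_split_digit)
  finally show ?thesis by (simp add: digit_set_digit set_digit_set_digit)
qed

end

section \<open>Decoupling from the lost factor\<close>

text \<open>The case of a diagonal observable. Since |z|^2 - |w|^2 is the real part of cnj (z - w)
  (z + w), Cauchy-Schwarz bounds the difference by m times the norms of F - G and F + G. Their
  squares are 2 - 2 f and 2 + 2 f, which multiply to 4 (1 - f^2).\<close>

lemma weighted_square_difference_bound:
  fixes F G :: "'y \<Rightarrow> complex" and w :: "'y \<Rightarrow> real"
  assumes w: "\<And>y. y \<in> Y \<Longrightarrow> \<bar>w y\<bar> \<le> m" and m: "m \<ge> 0"
    and F: "(\<Sum>y\<in>Y. (cmod (F y))\<^sup>2) = 1" and G: "(\<Sum>y\<in>Y. (cmod (G y))\<^sup>2) = 1"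
    and FG: "(\<Sum>y\<in>Y. cnj (G y) * F y) = of_real f"
  shows "\<bar>(\<Sum>y\<in>Y. w y * (cmod (F y))\<^sup>2) - (\<Sum>y\<in>Y. w y * (cmod (G y))\<^sup>2)\<bar> \<le> 2 * m * sqrt (1 - f\<^sup>2)"
proof -
  have re: "(\<Sum>y\<in>Y. Re (cnj (G y) * F y)) = f"
    using FG by (metis Re_complex_of_real Re_sum)
  have plus: "(cmod (z + w))\<^sup>2 = (cmod z)\<^sup>2 + (cmod w)\<^sup>2 + 2 * Re (cnj w * z)" for z w
    unfolding cmod_power2 by (simp add: power2_eq_square algebra_simps)
  have minus: "(cmod (z - w))\<^sup>2 = (cmod z)\<^sup>2 + (cmod w)\<^sup>2 - 2 * Re (cnj w * z)" for z w
    unfolding cmod_power2 by (simp add: power2_eq_square algebra_simps)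
  have diff: "(cmod z)\<^sup>2 - (cmod w)\<^sup>2 = Re (cnj (z - w) * (z + w))" for z w
    unfolding cmod_power2 by (simp add: power2_eq_square algebra_simps)
  have P: "(\<Sum>y\<in>Y. (cmod (F y + G y))\<^sup>2) = 2 + 2 * f"
    unfolding plus by (simp only: sum.distrib sum_distrib_left[symmetric] F G re)
  have M: "(\<Sum>y\<in>Y. (cmod (F y - G y))\<^sup>2) = 2 - 2 * f"
    unfolding minus by (simp only: sum.distrib sum_subtractf sum_distrib_left[symmetric] F G re)
  have cs: "(\<Sum>y\<in>Y. cmod (F y - G y) * cmod (F y + G y)) \<le> 2 * sqrt (1 - f\<^sup>2)"
  proof -
    have "(\<Sum>y\<in>Y. cmod (F y - G y) * cmod (F y + G y))\<^sup>2 \<le> (2 - 2 * f) * (2 + 2 * f)"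
      using Cauchy_Schwarz_ineq_sum[of "\<lambda>y. cmod (F y - G y)" "\<lambda>y. cmod (F y + G y)" Y] by (simp add: P M)
    also have "\<dots> = 4 * (1 - f\<^sup>2)" by (simp add: power2_eq_square algebra_simps)
    finally have "(\<Sum>y\<in>Y. cmod (F y - G y) * cmod (F y + G y)) \<le> sqrt (4 * (1 - f\<^sup>2))"
      by (rule real_le_rsqrt)
    thus ?thesis by (simp only: real_sqrt_mult real_sqrt_four)
  qed
  have "\<bar>(\<Sum>y\<in>Y. w y * (cmod (F y))\<^sup>2) - (\<Sum>y\<in>Y. w y * (cmod (G y))\<^sup>2)\<bar>
      = \<bar>\<Sum>y\<in>Y. w y * Re (cnj (F y - G y) * (F y + G y))\<bar>"
    by (simp only: diff[symmetric] sum_subtractf right_diff_distrib)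
  also have "\<dots> \<le> (\<Sum>y\<in>Y. \<bar>w y * Re (cnj (F y - G y) * (F y + G y))\<bar>)" by (rule sum_abs)
  also have "\<dots> \<le> (\<Sum>y\<in>Y. m * (cmod (F y - G y) * cmod (F y + G y)))"
  proof (rule sum_mono)
    fix y assume y: "y \<in> Y"
    have "\<bar>Re (cnj (F y - G y) * (F y + G y))\<bar> \<le> cmod (F y - G y) * cmod (F y + G y)"
      using abs_Re_le_cmod[of "cnj (F y - G y) * (F y + G y)"] by (simp add: norm_mult del: complex_cnj_diff)
    thus "\<bar>w y * Re (cnj (F y - G y) * (F y + G y))\<bar> \<le> m * (cmod (F y - G y) * cmod (F y + G y))"
      unfolding abs_mult using w[OF y] m by (intro mult_mono) auto
  qed
  also have "\<dots> \<le> m * (2 * sqrt (1 - f\<^sup>2))"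
    unfolding sum_distrib_left[symmetric] by (rule mult_left_mono[OF cs m])
  finally show ?thesis by simp
qed

text \<open>With c = 1 and a complete family \<open>e\<close> this gives Parseval, with c the
  eigenvalues it diagonalises a kernel; the next bound uses both.\<close>

lemma diagonal_form_eq_kernel_form:
  fixes e :: "'x \<Rightarrow> 'p \<Rightarrow> complex"
  shows "(\<Sum>x\<in>X. c x * (cnj (\<Sum>p\<in>P. cnj (e x p) * g p) * (\<Sum>q\<in>P. cnj (e x q) * f q)))
    = (\<Sum>p\<in>P. \<Sum>q\<in>P. cnj (g p) * (\<Sum>x\<in>X. c x * e x p * cnj (e x q)) * f q)"
proof -
  have "(\<Sum>x\<in>X. c x * (cnj (\<Sum>p\<in>P. cnj (e x p) * g p) * (\<Sum>q\<in>P. cnj (e x q) * f q)))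
      = (\<Sum>x\<in>X. \<Sum>p\<in>P. \<Sum>q\<in>P. cnj (g p) * (c x * e x p * cnj (e x q)) * f q)"
    by (simp add: sum_product sum_distrib_left mult_ac)
  also have "\<dots> = (\<Sum>p\<in>P. \<Sum>x\<in>X. \<Sum>q\<in>P. cnj (g p) * (c x * e x p * cnj (e x q)) * f q)"
    by (rule sum.swap)
  also have "\<dots> = (\<Sum>p\<in>P. \<Sum>q\<in>P. \<Sum>x\<in>X. cnj (g p) * (c x * e x p * cnj (e x q)) * f q)"
    by (rule sum.cong[OF refl], rule sum.swap)
  finally show ?thesis by (simp add: sum_distrib_left sum_distrib_right)
qed

text \<open>Expanding in the eigenbasis \<open>e\<close> of the kernel reduces to the diagonal case:
  \<open>hat\<close> preserves inner products by completeness and turns \<open>K\<close> into the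
  weights \<open>w\<close>. The index \<open>j\<close> is a spectator on which the observable acts
  as the identity.\<close>

lemma kernel_form_difference_bound:
  fixes f g :: "'j \<Rightarrow> 'p \<Rightarrow> complex" and w :: "'x \<Rightarrow> real" and e :: "'x \<Rightarrow> 'p \<Rightarrow> complex"
  assumes fin: "finite J" "finite X" "finite P"
    and w: "\<And>x. x \<in> X \<Longrightarrow> \<bar>w x\<bar> \<le> m" and m: "m \<ge> 0"
    and complete: "\<And>p q. p \<in> P \<Longrightarrow> q \<in> P \<Longrightarrow> (\<Sum>x\<in>X. e x p * cnj (e x q)) = (if p = q then 1 else 0)"
    and f: "(\<Sum>j\<in>J. \<Sum>p\<in>P. (cmod (f j p))\<^sup>2) = 1" and g: "(\<Sum>j\<in>J. \<Sum>p\<in>P. (cmod (g j p))\<^sup>2) = 1"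
    and fg: "(\<Sum>j\<in>J. \<Sum>p\<in>P. cnj (g j p) * f j p) = of_real r"
    and K: "\<And>p q. p \<in> P \<Longrightarrow> q \<in> P \<Longrightarrow> K p q = (\<Sum>x\<in>X. of_real (w x) * e x p * cnj (e x q))"
  shows "cmod ((\<Sum>j\<in>J. \<Sum>p\<in>P. \<Sum>q\<in>P. cnj (f j p) * K p q * f j q)
     - (\<Sum>j\<in>J. \<Sum>p\<in>P. \<Sum>q\<in>P. cnj (g j p) * K p q * g j q)) \<le> 2 * m * sqrt (1 - r\<^sup>2)"
proof -
  define hat where "hat h y = (\<Sum>p\<in>P. cnj (e (snd y) p) * h (fst y) p)" for h :: "'j \<Rightarrow> 'p \<Rightarrow> complex" and y
  have inner: "(\<Sum>y\<in>J\<times>X. cnj (hat h y) * hat k y) = (\<Sum>j\<in>J. \<Sum>p\<in>P. cnj (h j p) * k j p)" for h k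
  proof -
    have "(\<Sum>y\<in>J\<times>X. cnj (hat h y) * hat k y)
        = (\<Sum>j\<in>J. \<Sum>x\<in>X. 1 * (cnj (\<Sum>p\<in>P. cnj (e x p) * h j p) * (\<Sum>q\<in>P. cnj (e x q) * k j q)))"
      by (simp only: hat_def sum.cartesian_product split_def mult_1)
    also have "\<dots> = (\<Sum>j\<in>J. \<Sum>p\<in>P. \<Sum>q\<in>P. cnj (h j p) * (\<Sum>x\<in>X. 1 * e x p * cnj (e x q)) * k j q)"
      by (simp only: diagonal_form_eq_kernel_form)
    also have "\<dots> = (\<Sum>j\<in>J. \<Sum>p\<in>P. \<Sum>q\<in>P. if q = p then cnj (h j p) * k j q else 0)"
      by (intro sum.cong refl) (auto simp: complete)
    finally show ?thesis using fin by simp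
  qed
  have norm: "(\<Sum>y\<in>J\<times>X. (cmod (hat h y))\<^sup>2) = (\<Sum>j\<in>J. \<Sum>p\<in>P. (cmod (h j p))\<^sup>2)" for h
  proof -
    have "complex_of_real (\<Sum>y\<in>J\<times>X. (cmod (hat h y))\<^sup>2) = of_real (\<Sum>j\<in>J. \<Sum>p\<in>P. (cmod (h j p))\<^sup>2)"
      using inner[of h h] unfolding cnj_mult_self by (simp only: of_real_sum)
    thus ?thesis by (simp only: of_real_eq_iff)
  qed
  have form: "(\<Sum>j\<in>J. \<Sum>p\<in>P. \<Sum>q\<in>P. cnj (h j p) * K p q * h j q)
      = of_real (\<Sum>y\<in>J\<times>X. w (snd y) * (cmod (hat h y))\<^sup>2)" for h
  proof -
    have "(\<Sum>j\<in>J. \<Sum>p\<in>P. \<Sum>q\<in>P. cnj (h j p) * K p q * h j q)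
        = (\<Sum>j\<in>J. \<Sum>p\<in>P. \<Sum>q\<in>P. cnj (h j p) * (\<Sum>x\<in>X. of_real (w x) * e x p * cnj (e x q)) * h j q)"
      by (intro sum.cong refl) (simp add: K)
    also have "\<dots> = (\<Sum>j\<in>J. \<Sum>x\<in>X. of_real (w x) *
        (cnj (\<Sum>p\<in>P. cnj (e x p) * h j p) * (\<Sum>q\<in>P. cnj (e x q) * h j q)))"
      by (simp only: diagonal_form_eq_kernel_form)
    also have "\<dots> = (\<Sum>y\<in>J\<times>X. of_real (w (snd y)) * (cnj (hat h y) * hat h y))"
      by (simp only: hat_def sum.cartesian_product split_def)
    finally show ?thesis unfolding cnj_mult_self by (simp only: of_real_sum of_real_mult)
  qed
  have "\<bar>(\<Sum>y\<in>J\<times>X. w (snd y) * (cmod (hat f y))\<^sup>2) - (\<Sum>y\<in>J\<times>X. w (snd y) * (cmod (hat g y))\<^sup>2)\<bar>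
      \<le> 2 * m * sqrt (1 - r\<^sup>2)"
    by (rule weighted_square_difference_bound) (use w m in \<open>auto simp: norm f g inner fg\<close>)
  thus ?thesis unfolding form by (simp only: of_real_diff[symmetric] norm_of_real)
qed

lemma cmod_sum_mult_square_le:
  "(cmod (\<Sum>y\<in>Y. a y * b y))\<^sup>2 \<le> (\<Sum>y\<in>Y. (cmod (a y))\<^sup>2) * (\<Sum>y\<in>Y. (cmod (b y))\<^sup>2)"
proof -
  have "cmod (\<Sum>y\<in>Y. a y * b y) \<le> (\<Sum>y\<in>Y. cmod (a y) * cmod (b y))"
    by (rule order_trans[OF norm_sum]) (simp add: norm_mult)
  hence "(cmod (\<Sum>y\<in>Y. a y * b y))\<^sup>2 \<le> (\<Sum>y\<in>Y. cmod (a y) * cmod (b y))\<^sup>2"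
    by (rule power_mono) simp
  also have "\<dots> \<le> (\<Sum>y\<in>Y. (cmod (a y))\<^sup>2) * (\<Sum>y\<in>Y. (cmod (b y))\<^sup>2)"
    by (rule Cauchy_Schwarz_ineq_sum)
  finally show ?thesis .
qed

text \<open>Eigenvectors scaled by the roots of their eigenvalues. Read as one vector in
  \<open>(j, x)\<close>, the family \<open>w\<close> is a purification of M with environment
  \<open>j\<close>.\<close>

lemma psd_gram:
  assumes "psd k M"
  obtains w :: "nat \<Rightarrow> nat \<Rightarrow> complex"
    where "\<And>x y. x < k \<Longrightarrow> y < k \<Longrightarrow> M $$ (x,y) = (\<Sum>j<k. w j x * cnj (w j y))"
proof -
  have M: "M \<in> carrier_mat k k" using assms by (simp add: psd_def)
  obtain u \<kappa> where on: "orthonormal k k u" and Ms: "M = spectral_mat k u \<kappa>"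
    using hermitian_spectral[OF M psd_hermitian[OF assms]] by blast
  have \<kappa>: "\<kappa> j \<ge> 0" if "j < k" for j
    using spectral_mat_ge0[OF on assms[unfolded Ms] that] .
  define w where "w j x = of_real (sqrt (\<kappa> j)) * u j x" for j x
  have "M $$ (x,y) = (\<Sum>j<k. w j x * cnj (w j y))" if "x < k" "y < k" for x y
  proof -
    have "of_real (\<kappa> j) * u j x * cnj (u j y) = w j x * cnj (w j y)" if "j < k" for j
    proof -
      have "w j x * cnj (w j y) = of_real (sqrt (\<kappa> j) * sqrt (\<kappa> j)) * u j x * cnj (u j y)"
        unfolding of_real_mult by (simp add: w_def mult_ac)
      thus ?thesis using \<kappa>[OF that] by simp
    qed
    thus ?thesis using that by (simp add: Ms spectral_mat_def)
  qed
  thus ?thesis using that by blast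
qed

text \<open>Index of a tripartite system: recovered copy \<open>l\<close>, lost factor
  \<open>a\<close>, reference \<open>t\<close>. The last two are grouped so that
  \<open>tensor_id\<close> sees them as a single ancilla of dimension \<open>N * d\<close>.\<close>

definition recovery_index :: "nat \<Rightarrow> nat \<Rightarrow> nat \<Rightarrow> nat \<Rightarrow> nat \<Rightarrow> nat" where
  "recovery_index N d l a t = l * (N * d) + (a * d + t)"

lemma recovery_index_less:
  "l < d \<Longrightarrow> a < N \<Longrightarrow> t < d \<Longrightarrow> recovery_index N d l a t < d * (N * d)"
  unfolding recovery_index_def by (intro index_pair_less)

lemma sum_recovery_index:
  "(\<Sum>x<d * (N * d). g x) = (\<Sum>l<d. \<Sum>a<N. \<Sum>t<d. g (recovery_index N d l a t))"
  by (simp only: sum_mult_index recovery_index_def)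

text \<open>\<open>ent_overlap\<close> of the state left on recovered copy and reference after
  tracing out the lost factor, whence the single index \<open>a\<close> on both sides.\<close>

definition recovery_overlap :: "nat \<Rightarrow> nat \<Rightarrow> complex mat \<Rightarrow> complex" where
  "recovery_overlap N d \<omega> =
     (\<Sum>a<N. \<Sum>l<d. \<Sum>l'<d. \<omega> $$ (recovery_index N d l a l, recovery_index N d l' a l')) / of_nat d"

text \<open>A unit vector whose overlap with \<eta> is the norm of \<eta>: the normalisation of
  \<eta> if \<eta> is nonzero.\<close>

lemma normalized_companion:
  fixes \<eta> :: "nat \<Rightarrow> nat \<Rightarrow> complex"
  assumes "K > 0" "N > 0"
  obtains \<eta>' where "(\<Sum>j<K. \<Sum>a<N. (cmod (\<eta>' j a))\<^sup>2) = 1"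
    "(\<Sum>j<K. \<Sum>a<N. cnj (\<eta>' j a) * \<eta> j a) = of_real (sqrt (\<Sum>j<K. \<Sum>a<N. (cmod (\<eta> j a))\<^sup>2))"
proof (cases "(\<Sum>j<K. \<Sum>a<N. (cmod (\<eta> j a))\<^sup>2) = 0")
  case True
  hence 0: "(cmod (\<eta> j a))\<^sup>2 = 0" if "j < K" "a < N" for j a
    using that by (simp add: sum_nonneg sum_nonneg_eq_0_iff)
  \<comment> \<open>For \<eta> = 0 the required overlap is 0, so any unit vector serves; the first
    basis vector exists as \<open>K\<close> and \<open>N\<close> are positive.\<close>
  define \<eta>' :: "nat \<Rightarrow> nat \<Rightarrow> complex" where "\<eta>' j a = (if j = 0 then if a = 0 then 1 else 0 else 0)" for j a
  have "(\<Sum>j<K. \<Sum>a<N. (cmod (\<eta>' j a))\<^sup>2) = (\<Sum>j<K. if j = 0 then (\<Sum>a<N. if a = 0 then 1 else 0) else 0)"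
    by (intro sum.cong refl) (auto simp: \<eta>'_def if_distrib[of cmod] if_distrib[of "\<lambda>x. x\<^sup>2"] cong: if_cong)
  hence "(\<Sum>j<K. \<Sum>a<N. (cmod (\<eta>' j a))\<^sup>2) = 1" using assms by simp
  moreover have "(\<Sum>j<K. \<Sum>a<N. cnj (\<eta>' j a) * \<eta> j a) = 0"
    using 0 by (intro sum.neutral ballI) simp
  ultimately show ?thesis using that True by simp
next
  case False
  define S where "S = (\<Sum>j<K. \<Sum>a<N. (cmod (\<eta> j a))\<^sup>2)"
  have S: "S > 0" using False unfolding S_def by (simp add: sum_nonneg less_le)
  define \<eta>' where "\<eta>' j a = \<eta> j a / of_real (sqrt S)" for j a
  have "(\<Sum>j<K. \<Sum>a<N. (cmod (\<eta>' j a))\<^sup>2) = S / S"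
    using S by (simp add: \<eta>'_def norm_divide power_divide S_def flip: sum_divide_distrib)
  moreover have "(\<Sum>j<K. \<Sum>a<N. cnj (\<eta>' j a) * \<eta> j a) = of_real S / of_real (sqrt S)"
    by (simp add: \<eta>'_def S_def cnj_mult_self flip: sum_divide_distrib)
  moreover have "complex_of_real S / of_real (sqrt S) = of_real (sqrt S)"
    using S by (simp add: real_div_sqrt flip: of_real_divide)
  ultimately show ?thesis using that[of \<eta>'] S by (simp add: S_def)
qed

text \<open>The vector w purifies the recovered state, with environment \<open>j\<close>.
  Contracting it with the maximally entangled vector on \<open>(l, t)\<close> leaves \<eta> on
  environment and lost factor, of squared norm S. The product of the normalised \<eta> with the
  maximally entangled vector then has overlap sqrt S with w, and there the expectation of M tensor Z
  factorises. Its first factor \<tau> depends only on M and \<eta>, not on Z.\<close>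

lemma decoupling_bound_vectors:
  fixes w :: "nat \<Rightarrow> nat \<Rightarrow> nat \<Rightarrow> nat \<Rightarrow> complex"
  assumes d: "d > 0" and m: "m \<ge> 0"
    and on: "orthonormal N N u" and \<kappa>: "\<And>k. k < N \<Longrightarrow> \<bar>\<kappa> k\<bar> \<le> m"
    and norm: "(\<Sum>j<K. \<Sum>l<d. \<Sum>a<N. \<Sum>t<d. (cmod (w j l a t))\<^sup>2) = 1"
    and S: "S = (\<Sum>j<K. \<Sum>a<N. (cmod (\<Sum>l<d. w j l a l))\<^sup>2) / real d"
  obtains \<tau> :: real where "\<And>v \<sigma>. orthonormal d d v \<Longrightarrow> (\<And>s. s < d \<Longrightarrow> \<bar>\<sigma> s\<bar> \<le> 1) \<Longrightarrow>
    cmod ((\<Sum>j<K. \<Sum>l<d. \<Sum>a'<N. \<Sum>t'<d. \<Sum>a<N. \<Sum>t<d. cnj (w j l a' t') *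
        (spectral_mat N u \<kappa> $$ (a',a) * spectral_mat d v \<sigma> $$ (t',t)) * w j l a t)
      - of_real \<tau> * (mtrace (spectral_mat d v \<sigma>) / of_nat d)) \<le> 2 * m * sqrt (1 - S)"
proof -
  have KN: "K > 0" "N > 0" using norm by (auto intro!: Nat.gr0I)
  let ?r = "of_real (sqrt (real d)) :: complex"
  have rr: "?r * ?r = of_nat d" by (simp flip: of_real_mult)
  have r0: "?r \<noteq> 0" using d by simp
  have rc: "cnj ?r = ?r" by simp
  define \<eta> where "\<eta> j a = (\<Sum>l<d. w j l a l) / ?r" for j a
  have S\<eta>: "(\<Sum>j<K. \<Sum>a<N. (cmod (\<eta> j a))\<^sup>2) = S"
    by (simp add: \<eta>_def S norm_divide power_divide flip: sum_divide_distrib)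
  have S0: "S \<ge> 0" unfolding S\<eta>[symmetric] by (intro sum_nonneg) auto
  obtain \<eta>' where \<eta>': "(\<Sum>j<K. \<Sum>a<N. (cmod (\<eta>' j a))\<^sup>2) = 1"
    "(\<Sum>j<K. \<Sum>a<N. cnj (\<eta>' j a) * \<eta> j a) = of_real (sqrt S)"
    using normalized_companion[OF KN, of \<eta>] unfolding S\<eta> by blast
  \<comment> \<open>The product vector: \<open>\<eta>'\<close> on environment and lost factor, the
    maximally entangled vector on \<open>l\<close> and \<open>t\<close>.\<close>
  define g where "g j l a t = (if t = l then \<eta>' j a / ?r else 0)" for j l a t :: nat
  define \<tau>' where "\<tau>' = (\<Sum>j<K. \<Sum>k<N. \<kappa> k * (cmod (\<Sum>a<N. cnj (u k a) * \<eta>' j a))\<^sup>2)"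
  let ?J = "{..<K} \<times> {..<d}" and ?P = "{..<N} \<times> {..<d}"
  define fJ where "fJ y p = w (fst y) (snd y) (fst p) (snd p)" for y p :: "nat \<times> nat"
  define gJ where "gJ y p = g (fst y) (snd y) (fst p) (snd p)" for y p :: "nat \<times> nat"
  have g1: "(\<Sum>j<K. \<Sum>l<d. \<Sum>a<N. \<Sum>t<d. (cmod (g j l a t))\<^sup>2) = 1"
  proof -
    have "(\<Sum>j<K. \<Sum>l<d. \<Sum>a<N. \<Sum>t<d. (cmod (g j l a t))\<^sup>2)
        = (\<Sum>j<K. \<Sum>l<d. \<Sum>a<N. \<Sum>t<d. if t = l then (cmod (\<eta>' j a))\<^sup>2 / real d else 0)"
      by (intro sum.cong refl) (auto simp: g_def norm_divide power_divide)
    also have "\<dots> = (\<Sum>j<K. \<Sum>l<d. \<Sum>a<N. (cmod (\<eta>' j a))\<^sup>2 / real d)"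
      by (intro sum.cong refl) simp
    also have "\<dots> = 1" using d by (simp add: \<eta>'(1) flip: sum_divide_distrib sum_distrib_left)
    finally show ?thesis .
  qed
  have gw: "(\<Sum>j<K. \<Sum>l<d. \<Sum>a<N. \<Sum>t<d. cnj (g j l a t) * w j l a t) = of_real (sqrt S)"
  proof -
    have "(\<Sum>j<K. \<Sum>l<d. \<Sum>a<N. \<Sum>t<d. cnj (g j l a t) * w j l a t)
        = (\<Sum>j<K. \<Sum>l<d. \<Sum>a<N. \<Sum>t<d. if t = l then cnj (\<eta>' j a) / ?r * w j l a l else 0)"
      by (intro sum.cong refl) (auto simp: g_def)
    also have "\<dots> = (\<Sum>j<K. \<Sum>l<d. \<Sum>a<N. cnj (\<eta>' j a) / ?r * w j l a l)"
      by (intro sum.cong refl) simp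
    also have "\<dots> = (\<Sum>j<K. \<Sum>a<N. \<Sum>l<d. cnj (\<eta>' j a) / ?r * w j l a l)"
      by (rule sum.cong[OF refl], rule sum.swap)
    also have "\<dots> = (\<Sum>j<K. \<Sum>a<N. cnj (\<eta>' j a) * \<eta> j a)"
      by (simp add: \<eta>_def sum_distrib_left sum_divide_distrib)
    finally show ?thesis using \<eta>'(2) by simp
  qed
  have main: "cmod ((\<Sum>j<K. \<Sum>l<d. \<Sum>a'<N. \<Sum>t'<d. \<Sum>a<N. \<Sum>t<d. cnj (w j l a' t') *
        (spectral_mat N u \<kappa> $$ (a',a) * spectral_mat d v \<sigma> $$ (t',t)) * w j l a t)
      - of_real \<tau>' * (mtrace (spectral_mat d v \<sigma>) / of_nat d)) \<le> 2 * m * sqrt (1 - S)"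
    if onv: "orthonormal d d v" and \<sigma>: "\<And>s. s < d \<Longrightarrow> \<bar>\<sigma> s\<bar> \<le> 1" for v \<sigma>
  proof -
    let ?M = "spectral_mat N u \<kappa>" and ?Z = "spectral_mat d v \<sigma>"
    \<comment> \<open>The product eigenbasis of M tensor Z. Its eigenvalues are products of \<kappa>
      and \<sigma>, bounded by \<open>m\<close> because \<sigma> is bounded by 1.\<close>
    define e where "e x p = u (fst x) (fst p) * v (snd x) (snd p)" for x p :: "nat \<times> nat"
    define K' where "K' p q = ?M $$ (fst p, fst q) * ?Z $$ (snd p, snd q)" for p q
    have "cmod ((\<Sum>y\<in>?J. \<Sum>p\<in>?P. \<Sum>q\<in>?P. cnj (fJ y p) * K' p q * fJ y q)
        - (\<Sum>y\<in>?J. \<Sum>p\<in>?P. \<Sum>q\<in>?P. cnj (gJ y p) * K' p q * gJ y q)) \<le> 2 * m * sqrt (1 - (sqrt S)\<^sup>2)"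
    proof (rule kernel_form_difference_bound[where X = ?P and e = e and w = "\<lambda>x. \<kappa> (fst x) * \<sigma> (snd x)"])
      show "\<bar>\<kappa> (fst x) * \<sigma> (snd x)\<bar> \<le> m" if "x \<in> ?P" for x
        unfolding abs_mult using mult_mono[OF \<kappa>[of "fst x"] \<sigma>[of "snd x"]] that m by auto
      show "(\<Sum>x\<in>?P. e x p * cnj (e x q)) = (if p = q then 1 else 0)" if "p \<in> ?P" "q \<in> ?P" for p q
      proof -
        have "(\<Sum>x\<in>?P. e x p * cnj (e x q)) =
            (\<Sum>k<N. u k (fst p) * cnj (u k (fst q))) * (\<Sum>s<d. v s (snd p) * cnj (v s (snd q)))"
          by (simp add: sum.cartesian_product' e_def sum_product mult_ac)
        thus ?thesis using that orthonormal_complete[OF on] orthonormal_complete[OF onv]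
          by (auto simp: prod_eq_iff)
      qed
      show "K' p q = (\<Sum>x\<in>?P. of_real (\<kappa> (fst x) * \<sigma> (snd x)) * e x p * cnj (e x q))"
        if "p \<in> ?P" "q \<in> ?P" for p q
        using that unfolding K'_def sum.cartesian_product' spectral_mat_def
        by (auto simp: e_def sum_product mult_ac intro!: sum.cong)
      show "(\<Sum>y\<in>?J. \<Sum>p\<in>?P. (cmod (fJ y p))\<^sup>2) = 1"
        "(\<Sum>y\<in>?J. \<Sum>p\<in>?P. (cmod (gJ y p))\<^sup>2) = 1"
        "(\<Sum>y\<in>?J. \<Sum>p\<in>?P. cnj (gJ y p) * fJ y p) = of_real (sqrt S)"
        using norm g1 gw by (simp_all add: fJ_def gJ_def sum.cartesian_product')
    qed (use m in simp_all)
    moreover have "(\<Sum>y\<in>?J. \<Sum>p\<in>?P. \<Sum>q\<in>?P. cnj (gJ y p) * K' p q * gJ y q)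
        = of_real \<tau>' * (mtrace ?Z / of_nat d)"
    proof -
      have "(\<Sum>y\<in>?J. \<Sum>p\<in>?P. \<Sum>q\<in>?P. cnj (gJ y p) * K' p q * gJ y q)
          = (\<Sum>j<K. \<Sum>l<d. \<Sum>a'<N. \<Sum>t'<d. \<Sum>a<N. \<Sum>t<d.
              cnj (g j l a' t') * (?M $$ (a',a) * ?Z $$ (t',t)) * g j l a t)"
        by (simp only: sum.cartesian_product' gJ_def K'_def fst_conv snd_conv)
      also have "\<dots> = (\<Sum>j<K. \<Sum>l<d. \<Sum>a'<N. \<Sum>t'<d. \<Sum>a<N. \<Sum>t<d. if t = l then
          if t' = l then cnj (\<eta>' j a') * ?M $$ (a',a) * \<eta>' j a * (?Z $$ (l,l) / of_nat d) else 0 else 0)"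
        unfolding rr[symmetric]
        by (intro sum.cong refl) (auto simp: g_def)
      also have "\<dots> = (\<Sum>j<K. \<Sum>l<d. \<Sum>a'<N. \<Sum>t'<d. if t' = l then \<Sum>a<N.
          cnj (\<eta>' j a') * ?M $$ (a',a) * \<eta>' j a * (?Z $$ (l,l) / of_nat d) else 0)"
        by (intro sum.cong refl) simp
      also have "\<dots> = (\<Sum>j<K. \<Sum>l<d. \<Sum>a'<N. \<Sum>a<N. cnj (\<eta>' j a') * ?M $$ (a',a) * \<eta>' j a * (?Z $$ (l,l) / of_nat d))"
        by (rule sum.cong[OF refl], rule sum.cong[OF refl], rule sum.cong[OF refl]) simp
      also have "\<dots> = (\<Sum>j<K. \<Sum>l<d. qform N ?M (\<eta>' j) * (?Z $$ (l,l) / of_nat d))"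
        by (simp only: qform_def sum_distrib_right)
      also have "\<dots> = (\<Sum>j<K. qform N ?M (\<eta>' j)) * (\<Sum>l<d. ?Z $$ (l,l) / of_nat d)"
        by (simp only: sum_product)
      also have "\<dots> = of_real \<tau>' * (mtrace ?Z / of_nat d)"
        by (simp add: qform_spectral_mat \<tau>'_def mtrace_def sum_divide_distrib)
      finally show ?thesis .
    qed
    moreover have "(\<Sum>y\<in>?J. \<Sum>p\<in>?P. \<Sum>q\<in>?P. cnj (fJ y p) * K' p q * fJ y q)
        = (\<Sum>j<K. \<Sum>l<d. \<Sum>a'<N. \<Sum>t'<d. \<Sum>a<N. \<Sum>t<d.
              cnj (w j l a' t') * (?M $$ (a',a) * ?Z $$ (t',t)) * w j l a t)"
      by (simp only: sum.cartesian_product' fJ_def K'_def fst_conv snd_conv)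
    ultimately show ?thesis using S0 by simp
  qed
  show ?thesis using that[of \<tau>'] main by blast
qed

lemma sum_swap_into5:
  fixes h :: "nat \<Rightarrow> nat \<Rightarrow> nat \<Rightarrow> nat \<Rightarrow> nat \<Rightarrow> nat \<Rightarrow> complex"
  shows "(\<Sum>j\<in>J. \<Sum>l\<in>A. \<Sum>b\<in>B. \<Sum>c\<in>C. \<Sum>e\<in>D. \<Sum>f\<in>E. h j l b c e f)
    = (\<Sum>l\<in>A. \<Sum>b\<in>B. \<Sum>c\<in>C. \<Sum>e\<in>D. \<Sum>f\<in>E. \<Sum>j\<in>J. h j l b c e f)"
  by (simp only: sum.swap[of _ _ J])

text \<open>The same bound for a density matrix, through its Gram vectors. Trace 1 normalises the
  purification, and the overlap becomes the S of the vector version. It is at most 1 because the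
  diagonal \<open>t = l\<close> carries only part of the norm.\<close>

lemma decoupling_bound:
  assumes d: "d > 0" and m: "m \<ge> 0"
    and on: "orthonormal N N u" and \<kappa>: "\<And>k. k < N \<Longrightarrow> \<bar>\<kappa> k\<bar> \<le> m"
    and \<omega>: "psd (d * (N * d)) \<omega>" and tr: "mtrace \<omega> = 1"
  obtains \<tau> :: real where "\<And>v \<sigma>. orthonormal d d v \<Longrightarrow> (\<And>s. s < d \<Longrightarrow> \<bar>\<sigma> s\<bar> \<le> 1) \<Longrightarrow>
    cmod ((\<Sum>l<d. \<Sum>a'<N. \<Sum>t'<d. \<Sum>a<N. \<Sum>t<d.
        spectral_mat N u \<kappa> $$ (a',a) * spectral_mat d v \<sigma> $$ (t',t) *
          \<omega> $$ (recovery_index N d l a t, recovery_index N d l a' t'))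
      - of_real \<tau> * (mtrace (spectral_mat d v \<sigma>) / of_nat d)) \<le> 2 * m * sqrt (1 - Re (recovery_overlap N d \<omega>))"
    "Re (recovery_overlap N d \<omega>) \<ge> 0" "Re (recovery_overlap N d \<omega>) \<le> 1"
proof -
  let ?K = "d * (N * d)" and ?ix = "recovery_index N d"
  obtain W where W: "\<And>x y. x < ?K \<Longrightarrow> y < ?K \<Longrightarrow> \<omega> $$ (x,y) = (\<Sum>j<?K. W j x * cnj (W j y))"
    using psd_gram[OF \<omega>] by blast
  have \<omega>c: "\<omega> \<in> carrier_mat ?K ?K" using \<omega> by (simp add: psd_def)
  define w where "w j l a t = W j (?ix l a t)" for j l a t
  have \<omega>w: "\<omega> $$ (?ix l a t, ?ix l' a' t') = (\<Sum>j<?K. w j l a t * cnj (w j l' a' t'))"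
    if "l < d" "a < N" "t < d" "l' < d" "a' < N" "t' < d" for l a t l' a' t'
    unfolding w_def by (rule W) (intro recovery_index_less that)+
  have norm: "(\<Sum>j<?K. \<Sum>l<d. \<Sum>a<N. \<Sum>t<d. (cmod (w j l a t))\<^sup>2) = 1"
  proof -
    have "complex_of_real (\<Sum>j<?K. \<Sum>l<d. \<Sum>a<N. \<Sum>t<d. (cmod (w j l a t))\<^sup>2)
        = (\<Sum>j<?K. \<Sum>l<d. \<Sum>a<N. \<Sum>t<d. w j l a t * cnj (w j l a t))"
      by (simp only: of_real_sum complex_norm_square)
    also have "\<dots> = (\<Sum>l<d. \<Sum>a<N. \<Sum>t<d. \<Sum>j<?K. w j l a t * cnj (w j l a t))"
      by (simp only: sum.swap[of _ _ "{..<?K}"])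
    also have "\<dots> = (\<Sum>l<d. \<Sum>a<N. \<Sum>t<d. \<omega> $$ (?ix l a t, ?ix l a t))"
      by (intro sum.cong refl) (simp add: \<omega>w)
    also have "\<dots> = mtrace \<omega>"
      using \<omega>c by (simp add: mtrace_def sum_recovery_index)
    finally show ?thesis using tr by (metis of_real_eq_1_iff)
  qed
  define S where "S = (\<Sum>j<?K. \<Sum>a<N. (cmod (\<Sum>l<d. w j l a l))\<^sup>2) / real d"
  have ov: "recovery_overlap N d \<omega> = of_real S"
  proof -
    have "complex_of_real (\<Sum>j<?K. \<Sum>a<N. (cmod (\<Sum>l<d. w j l a l))\<^sup>2)
        = (\<Sum>j<?K. \<Sum>a<N. \<Sum>l<d. \<Sum>l'<d. w j l a l * cnj (w j l' a l'))"
      by (simp add: complex_norm_square sum_product del: of_real_power)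
    also have "\<dots> = (\<Sum>a<N. \<Sum>l<d. \<Sum>l'<d. \<Sum>j<?K. w j l a l * cnj (w j l' a l'))"
      by (simp only: sum.swap[of _ _ "{..<?K}"])
    also have "\<dots> = (\<Sum>a<N. \<Sum>l<d. \<Sum>l'<d. \<omega> $$ (?ix l a l, ?ix l' a l'))"
      by (intro sum.cong refl) (simp add: \<omega>w)
    finally show ?thesis by (simp add: recovery_overlap_def S_def)
  qed
  have S0: "S \<ge> 0" unfolding S_def by (intro divide_nonneg_nonneg sum_nonneg) auto
  have S1: "S \<le> 1"
  proof -
    \<comment> \<open>Cauchy-Schwarz against the constant 1; the factor d cancels the 1 / d in
      S.\<close>
    have "(cmod (\<Sum>l<d. w j l a l))\<^sup>2 \<le> real d * (\<Sum>l<d. (cmod (w j l a l))\<^sup>2)" for j a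
      using cmod_sum_mult_square_le[of "\<lambda>_. 1" "\<lambda>l. w j l a l" "{..<d}"] by simp
    hence "S \<le> (\<Sum>j<?K. \<Sum>a<N. real d * (\<Sum>l<d. (cmod (w j l a l))\<^sup>2)) / real d"
      unfolding S_def by (intro divide_right_mono sum_mono) auto
    also have "\<dots> = (\<Sum>j<?K. \<Sum>a<N. \<Sum>l<d. (cmod (w j l a l))\<^sup>2)"
      using d by (simp flip: sum_distrib_left)
    also have "\<dots> = (\<Sum>j<?K. \<Sum>l<d. \<Sum>a<N. (cmod (w j l a l))\<^sup>2)"
      by (rule sum.cong[OF refl], rule sum.swap)
    also have "\<dots> \<le> (\<Sum>j<?K. \<Sum>l<d. \<Sum>a<N. \<Sum>t<d. (cmod (w j l a t))\<^sup>2)"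
      by (intro sum_mono member_le_sum) auto
    finally show ?thesis using norm by simp
  qed
  obtain \<tau> :: real where \<tau>: "\<And>v \<sigma>. orthonormal d d v \<Longrightarrow> (\<And>s. s < d \<Longrightarrow> \<bar>\<sigma> s\<bar> \<le> 1) \<Longrightarrow>
    cmod ((\<Sum>j<?K. \<Sum>l<d. \<Sum>a'<N. \<Sum>t'<d. \<Sum>a<N. \<Sum>t<d. cnj (w j l a' t') *
        (spectral_mat N u \<kappa> $$ (a',a) * spectral_mat d v \<sigma> $$ (t',t)) * w j l a t)
      - of_real \<tau> * (mtrace (spectral_mat d v \<sigma>) / of_nat d)) \<le> 2 * m * sqrt (1 - S)"
    using decoupling_bound_vectors[where \<kappa> = \<kappa>, OF d m on \<kappa> norm S_def] by blast
  have "(\<Sum>j<?K. \<Sum>l<d. \<Sum>a'<N. \<Sum>t'<d. \<Sum>a<N. \<Sum>t<d. cnj (w j l a' t') * (M $$ (a',a) * Z $$ (t',t)) * w j l a t)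
      = (\<Sum>l<d. \<Sum>a'<N. \<Sum>t'<d. \<Sum>a<N. \<Sum>t<d. M $$ (a',a) * Z $$ (t',t) * \<omega> $$ (?ix l a t, ?ix l a' t'))"
    for M Z :: "complex mat"
    by (rule trans[OF sum_swap_into5], intro sum.cong refl) (simp add: \<omega>w sum_distrib_left mult_ac)
  with \<tau> ov S0 S1 show ?thesis using that[of \<tau>] by simp
qed

section \<open>Recovery channels after an erasure\<close>

lemma spread_spectral_mat:
  assumes N: "N > 0" and on: "orthonormal N N u"
  obtains c where "\<And>k. k < N \<Longrightarrow> \<bar>\<kappa> k - c\<bar> \<le> spread (spectral_mat N u \<kappa>) / 2"
    "spread (spectral_mat N u \<kappa>) \<ge> 0"
proof -
  let ?M = "spectral_mat N u \<kappa>"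
  let ?S = "Re ` {k. eigenvalue ?M k}"
  have "finite (spectrum ?M)" using card_finite_spectrum[OF spectral_mat_carrier] by blast
  hence fin: "finite ?S" by (simp add: spectrum_def)
  have mem: "\<kappa> k \<in> ?S" if k: "k < N" for k
  proof -
    have "(\<Sum>i<N. cnj (u k i) * u k i) = 1" using on k by (simp add: orthonormal_def)
    hence "\<exists>i<N. u k i \<noteq> 0" by (metis (no_types, lifting) lessThan_iff mult_zero_right sum.neutral zero_neq_one)
    hence "eigenvalue ?M (of_real (\<kappa> k))"
      using eigenvalue_of_function[OF spectral_mat_carrier, of N u \<kappa> "u k"] spectral_mat_apply[OF on k] by blast
    thus ?thesis by (metis (mono_tags, lifting) Re_complex_of_real imageI mem_Collect_eq)
  qed
  \<comment> \<open>The midpoint of the spectrum, the shift that brings every eigenvalue within half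
    the spread.\<close>
  define c where "c = (Max ?S + Min ?S) / 2"
  have b: "Min ?S \<le> \<kappa> k" "\<kappa> k \<le> Max ?S" if "k < N" for k
    using mem[OF that] fin by simp_all
  have "\<bar>\<kappa> k - c\<bar> \<le> spread ?M / 2" if "k < N" for k
    using b[OF that] by (simp add: spread_def c_def abs_le_iff field_simps)
  moreover have "spread ?M \<ge> 0" using b[OF N] by (simp add: spread_def)
  ultimately show ?thesis using that by blast
qed

section \<open>Channels and their ampliations entrywise\<close>

lemma is_channelD:
  assumes "is_channel m k \<Phi>"
  shows "X \<in> carrier_mat m m \<Longrightarrow> \<Phi> X \<in> carrier_mat k k"
    "X \<in> carrier_mat m m \<Longrightarrow> Y \<in> carrier_mat m m \<Longrightarrow> \<Phi> (X + Y) = \<Phi> X + \<Phi> Y"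
    "X \<in> carrier_mat m m \<Longrightarrow> \<Phi> (a \<cdot>\<^sub>m X) = a \<cdot>\<^sub>m \<Phi> X"
    "X \<in> carrier_mat m m \<Longrightarrow> mtrace (\<Phi> X) = mtrace X"
    "psd (m * r) X \<Longrightarrow> psd (k * r) (tensor_id \<Phi> m k r X)"
  using assms by (auto simp: is_channel_def)

lemma is_channel_sum:
  fixes c :: "nat \<Rightarrow> complex"
  assumes \<Phi>: "is_channel m k \<Phi>" and B: "\<And>a. a < s \<Longrightarrow> B a \<in> carrier_mat m m"
    and l: "l < k" "l' < k"
  shows "\<Phi> (mat m m (\<lambda>(x,y). \<Sum>a<s. c a * B a $$ (x,y))) $$ (l,l') = (\<Sum>a<s. c a * \<Phi> (B a) $$ (l,l'))"
  using B
proof (induction s)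
  case 0
  \<comment> \<open>The empty sum is written as a multiple by 0, so that homogeneity gives the value
    of the channel at 0.\<close>
  have eq: "mat m m (\<lambda>(x,y). \<Sum>a<(0::nat). c a * B a $$ (x,y)) = 0 \<cdot>\<^sub>m 1\<^sub>m m"
    by (rule eq_matI) auto
  show ?case unfolding eq using is_channelD(3)[OF \<Phi>, of "1\<^sub>m m" 0] is_channelD(1)[OF \<Phi>, of "1\<^sub>m m"] l by simp
next
  case (Suc s)
  let ?S = "mat m m (\<lambda>(x,y). \<Sum>a<s. c a * B a $$ (x,y))"
  have Bs: "B s \<in> carrier_mat m m" using Suc.prems by simp
  have eq: "mat m m (\<lambda>(x,y). \<Sum>a<Suc s. c a * B a $$ (x,y)) = ?S + c s \<cdot>\<^sub>m B s"
    using Bs by (intro eq_matI) auto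
  have "\<Phi> (?S + c s \<cdot>\<^sub>m B s) = \<Phi> ?S + c s \<cdot>\<^sub>m \<Phi> (B s)"
    using is_channelD(2)[OF \<Phi>, of ?S "c s \<cdot>\<^sub>m B s"] is_channelD(3)[OF \<Phi> Bs] Bs by simp
  moreover have "(\<Phi> ?S + c s \<cdot>\<^sub>m \<Phi> (B s)) $$ (l,l') = \<Phi> ?S $$ (l,l') + c s * \<Phi> (B s) $$ (l,l')"
    using is_channelD(1)[OF \<Phi> Bs] l by simp
  moreover have "\<Phi> ?S $$ (l,l') = (\<Sum>a<s. c a * \<Phi> (B a) $$ (l,l'))"
    by (rule Suc.IH) (use Suc.prems in simp)
  ultimately show ?case unfolding eq unfolding sum.lessThan_Suc by (simp only:)
qed

lemma tensor_id_entry: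
  assumes "l < k" "l' < k" "q < r" "q' < r"
  shows "tensor_id \<Phi> m k r X $$ (l * r + q, l' * r + q')
    = \<Phi> (mat m m (\<lambda>(s,s'). X $$ (s * r + q, s' * r + q'))) $$ (l,l')"
  using assms index_pair_less[OF assms(1,3)] index_pair_less[OF assms(2,4)]
  by (simp add: tensor_id_def)

text \<open>An ampliation evaluates its map only on the blocks cut out by a pair of ancilla indices.
  A composite map on one input can thus be replaced by a plain channel on another, possibly of
  different dimension, whose complete positivity is then available.\<close>

lemma tensor_id_cong:
  assumes "\<And>q q'. q < r \<Longrightarrow> q' < r \<Longrightarrow>
    \<Phi> (mat m m (\<lambda>(s,s'). X $$ (s * r + q, s' * r + q'))) = \<Phi>' (mat m' m' (\<lambda>(s,s'). X' $$ (s * r + q, s' * r + q')))"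
  shows "tensor_id \<Phi> m k r X = tensor_id \<Phi>' m' k r X'"
  unfolding tensor_id_def
proof (rule cong_mat[OF refl refl])
  fix x y assume "x < k * r" "y < k * r"
  hence "r > 0" by (cases r) auto
  hence "x mod r < r" "y mod r < r" by simp_all
  from assms[OF this] show
    "(case (x,y) of (ra, c) \<Rightarrow> \<Phi> (mat m m (\<lambda>(s, s'). X $$ (s * r + ra mod r, s' * r + c mod r))) $$ (ra div r, c div r))
    = (case (x,y) of (ra, c) \<Rightarrow> \<Phi>' (mat m' m' (\<lambda>(s, s'). X' $$ (s * r + ra mod r, s' * r + c mod r))) $$ (ra div r, c div r))"
    by simp
qed

lemma psd_weighted_sum:
  assumes "\<And>i. i < s \<Longrightarrow> psd k (M i)" "\<And>i. i < s \<Longrightarrow> q i \<ge> 0"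
  shows "psd k (mat k k (\<lambda>(x,y). \<Sum>i<s. of_real (q i) * M i $$ (x,y)))"
proof -
  have "qform k (mat k k (\<lambda>(x,y). \<Sum>i<s. of_real (q i) * M i $$ (x,y))) v = (\<Sum>i<s. of_real (q i) * qform k (M i) v)" for v
  proof -
    have "qform k (mat k k (\<lambda>(x,y). \<Sum>i<s. of_real (q i) * M i $$ (x,y))) v
        = (\<Sum>x<k. \<Sum>y<k. \<Sum>i<s. of_real (q i) * (cnj (v x) * M i $$ (x,y) * v y))"
      unfolding qform_def by (intro sum.cong refl) (auto simp: sum_distrib_left sum_distrib_right mult_ac)
    also have "\<dots> = (\<Sum>x<k. \<Sum>i<s. \<Sum>y<k. of_real (q i) * (cnj (v x) * M i $$ (x,y) * v y))"
      by (rule sum.cong[OF refl], rule sum.swap)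
    also have "\<dots> = (\<Sum>i<s. \<Sum>x<k. \<Sum>y<k. of_real (q i) * (cnj (v x) * M i $$ (x,y) * v y))"
      by (rule sum.swap)
    finally show ?thesis by (simp add: qform_def sum_distrib_left)
  qed
  thus ?thesis using assms by (auto simp: psd_iff intro!: sum_nonneg)
qed

lemma psd_gram_matrix: "psd k (mat k k (\<lambda>(x,y). \<Sum>a<s. f a x * cnj (f a y)))" for s :: nat
proof -
  have "mat k k (\<lambda>(x,y). \<Sum>a<s. f a x * cnj (f a y))
      = mat k k (\<lambda>(x,y). \<Sum>a<s. of_real 1 * rank_one k (f a) $$ (x,y))"
    by (rule cong_mat) (auto simp: rank_one_def)
  thus ?thesis using psd_weighted_sum[of s k "\<lambda>a. rank_one k (f a)" "\<lambda>_. 1"] psd_rank_one by simp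
qed

locale erased_code = tensor_factors +
  fixes dL :: nat and V :: "complex mat" and \<phi> :: "complex vec"
    and R :: "complex mat \<Rightarrow> complex mat"
  assumes dL_pos: "dL > 0"
    and V_dim: "V \<in> carrier_mat (dimA d n) dL"
    and V_isometry: "adj V * V = 1\<^sub>m dL"
    and phi_norm: "(\<Sum>a<d i. (cmod (\<phi> $ a))\<^sup>2) = 1"
    and R: "is_channel (dimA d n) dL R"
begin

abbreviation "D \<equiv> dimA d n"
abbreviation "N \<equiv> d i"

text \<open>Erasure in dilated form: the amplitude of the encoded maximally entangled state after
  the content \<open>a\<close> of factor \<open>i\<close> is moved to an ancilla and \<phi> put in
  its place. Here \<open>s\<close> indexes A after the replacement and \<open>t\<close> the
  reference.\<close>

definition amp :: "nat \<Rightarrow> nat \<Rightarrow> nat \<Rightarrow> complex" where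
  "amp s a t = \<phi> $ digit d n i s * V $$ (set_digit d n i a s, t) / of_real (sqrt (real dL))"

lemma amp_mult:
  "amp s a t * cnj (amp s' a' t') = \<phi> $ digit d n i s * cnj (\<phi> $ digit d n i s') *
     (V $$ (set_digit d n i a s, t) * cnj (V $$ (set_digit d n i a' s', t')) / of_nat dL)"
proof -
  have "complex_of_real (sqrt (real dL)) * of_real (sqrt (real dL)) = of_nat dL"
    by (simp flip: of_real_mult)
  thus ?thesis by (simp add: amp_def mult_ac)
qed

definition block :: "nat \<Rightarrow> nat \<Rightarrow> nat \<Rightarrow> nat \<Rightarrow> complex mat" where
  "block a t a' t' = mat D D (\<lambda>(s,s'). amp s a t * cnj (amp s' a' t'))"

lemma block_carrier: "block a t a' t' \<in> carrier_mat D D"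
  by (simp add: block_def)

text \<open>Erasure makes the recovery ignore factor \<open>i\<close>, so that factor can be kept aside as an ancilla:
  \<open>omega\<close> is the joint state of the recovered system, the lost factor and the reference.\<close>

definition omega :: "complex mat" where
  "omega = tensor_id R D dL (N * dL) (rank_one (D * (N * dL))
     (\<lambda>x. amp (x div (N * dL)) (x mod (N * dL) div dL) (x mod (N * dL) mod dL)))"

lemma psd_omega: "psd (dL * (N * dL)) omega"
  unfolding omega_def by (rule is_channelD(5)[OF R psd_rank_one])

lemma omega_entry:
  assumes "l < dL" "a < N" "t < dL" "l' < dL" "a' < N" "t' < dL"
  shows "omega $$ (recovery_index N dL l a t, recovery_index N dL l' a' t') = R (block a t a' t') $$ (l,l')"
proof -
  let ?k = "N * dL"
  have q: "a * dL + t < ?k" "a' * dL + t' < ?k" using assms by (auto intro: index_pair_less)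
  show ?thesis
    unfolding omega_def recovery_index_def tensor_id_entry[OF assms(1,4) q]
  proof (rule arg_cong[where f = "\<lambda>X. R X $$ (l,l')"])
    show "mat D D (\<lambda>(s, s'). rank_one (D * ?k)
            (\<lambda>x. amp (x div ?k) (x mod ?k div dL) (x mod ?k mod dL)) $$ (s * ?k + (a * dL + t), s' * ?k + (a' * dL + t')))
        = block a t a' t'"
      unfolding block_def
    proof (rule cong_mat[OF refl refl])
      fix s s' assume s: "s < D" "s' < D"
      have "s * ?k + (a * dL + t) < D * ?k" "s' * ?k + (a' * dL + t') < D * ?k"
        using s q by (auto intro: index_pair_less)
      moreover have "(s * ?k + (a * dL + t)) div ?k = s" "(s * ?k + (a * dL + t)) mod ?k = a * dL + t"
        "(s' * ?k + (a' * dL + t')) div ?k = s'" "(s' * ?k + (a' * dL + t')) mod ?k = a' * dL + t'"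
        using q by (simp_all only: div_mult_self3 mod_mult_self3 div_less mod_less add_0_right)
      moreover have "(a * dL + t) div dL = a" "(a * dL + t) mod dL = t"
        "(a' * dL + t') div dL = a'" "(a' * dL + t') mod dL = t'"
        using assms by simp_all
      ultimately show "(case (s, s') of (s, s') \<Rightarrow> rank_one (D * ?k)
            (\<lambda>x. amp (x div ?k) (x mod ?k div dL) (x mod ?k mod dL)) $$ (s * ?k + (a * dL + t), s' * ?k + (a' * dL + t')))
          = (case (s, s') of (s, s') \<Rightarrow> amp s a t * cnj (amp s' a' t'))"
        by (simp only: rank_one_def index_mat prod.case)
    qed
  qed
qed

text \<open>The trace over A sums out the replaced digit, where \<phi> has norm 1, and the remaining
  factors. The result is the marginal of the encoded state on lost factor and reference.\<close>

lemma mtrace_block: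
  assumes "a < N" "a' < N"
  shows "mtrace (block a t a' t') =
    (\<Sum>b\<in>zero_digit. V $$ (set_digit d n i a b, t) * cnj (V $$ (set_digit d n i a' b, t'))) / of_nat dL"
proof -
  have "mtrace (block a t a' t') = (\<Sum>s<D. amp s a t * cnj (amp s a' t'))"
    by (simp add: mtrace_def block_def)
  also have "\<dots> = (\<Sum>b\<in>zero_digit. \<Sum>a0<N. of_real ((cmod (\<phi> $ a0))\<^sup>2) *
      (V $$ (set_digit d n i a b, t) * cnj (V $$ (set_digit d n i a' b, t')) / of_nat dL))"
    unfolding sum_split_digit amp_mult
    by (intro sum.cong refl) (simp only: lessThan_iff set_digit_set_digit digit_set_digit complex_norm_square)
  also have "\<dots> = (\<Sum>b\<in>zero_digit. V $$ (set_digit d n i a b, t) * cnj (V $$ (set_digit d n i a' b, t')) / of_nat dL)"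
    by (simp only: sum_distrib_right[symmetric] of_real_sum[symmetric] phi_norm of_real_1 mult_1)
  finally show ?thesis by (simp add: sum_divide_distrib)
qed

text \<open>Tracing out the recovered copy undoes the recovery because \<open>R\<close> preserves
  the trace. Lost factor and reference thus keep the joint state they had in the code, and this lets
  their observables be evaluated without \<open>R\<close>.\<close>

lemma sum_omega_diagonal:
  assumes "a < N" "t < dL" "a' < N" "t' < dL"
  shows "(\<Sum>l<dL. omega $$ (recovery_index N dL l a t, recovery_index N dL l a' t')) =
    (\<Sum>b\<in>zero_digit. V $$ (set_digit d n i a b, t) * cnj (V $$ (set_digit d n i a' b, t'))) / of_nat dL"
proof -
  have "(\<Sum>l<dL. omega $$ (recovery_index N dL l a t, recovery_index N dL l a' t')) = mtrace (R (block a t a' t'))"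
    using is_channelD(1)[OF R block_carrier, of a t a' t'] assms by (simp add: mtrace_def omega_entry)
  thus ?thesis using is_channelD(4)[OF R block_carrier] mtrace_block[OF assms(1,3)] by simp
qed

lemma isometry_split:
  assumes "t' < dL" "t < dL"
  shows "(\<Sum>b\<in>zero_digit. \<Sum>a<N. cnj (V $$ (set_digit d n i a b, t')) * V $$ (set_digit d n i a b, t))
    = (if t' = t then 1 else 0)"
proof -
  have "(\<Sum>r<D. cnj (V $$ (r,t')) * V $$ (r,t)) = (adj V * V) $$ (t',t)"
    using mult_mat_entry[OF adj_carrier[OF V_dim] V_dim assms] assms by (simp add: adj_entry[OF V_dim])
  thus ?thesis using V_isometry assms by (simp add: sum_split_digit)
qed

lemma mtrace_omega: "mtrace omega = 1"
proof -
  have "dim_row omega = dL * (N * dL)" using psd_omega by (auto simp: psd_iff)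
  hence "mtrace omega = (\<Sum>l<dL. \<Sum>a<N. \<Sum>t<dL. omega $$ (recovery_index N dL l a t, recovery_index N dL l a t))"
    by (simp only: mtrace_def sum_recovery_index)
  also have "\<dots> = (\<Sum>a<N. \<Sum>t<dL. \<Sum>l<dL. omega $$ (recovery_index N dL l a t, recovery_index N dL l a t))"
    by (rule trans[OF sum.swap], rule sum.cong[OF refl], rule sum.swap)
  also have "\<dots> = (\<Sum>a<N. \<Sum>t<dL. \<Sum>b\<in>zero_digit.
      cnj (V $$ (set_digit d n i a b, t)) * V $$ (set_digit d n i a b, t) / of_nat dL)"
    by (rule sum.cong[OF refl], rule sum.cong[OF refl]) (simp add: sum_omega_diagonal sum_divide_distrib mult.commute)
  also have "\<dots> = (\<Sum>t<dL. \<Sum>b\<in>zero_digit. \<Sum>a<N.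
      cnj (V $$ (set_digit d n i a b, t)) * V $$ (set_digit d n i a b, t) / of_nat dL)"
    by (subst sum.swap, rule sum.cong[OF refl], rule sum.swap)
  also have "\<dots> = (\<Sum>t<dL. 1 / of_nat dL)"
    by (intro sum.cong refl) (simp add: isometry_split flip: sum_divide_distrib)
  finally show ?thesis using dL_pos by simp
qed

text \<open>M acts on the lost factor and Z on the reference, so only their marginal enters and
  \<open>R\<close> disappears. What is left pairs Z entrywise with V^dagger (M tensor 1) V, that is,
  up to a transposition inside the trace.\<close>

lemma omega_form:
  "(\<Sum>l<dL. \<Sum>a'<N. \<Sum>t'<dL. \<Sum>a<N. \<Sum>t<dL. M $$ (a',a) * Z $$ (t',t) *
      omega $$ (recovery_index N dL l a t, recovery_index N dL l a' t'))
   = (\<Sum>t'<dL. \<Sum>t<dL. Z $$ (t',t) * (\<Sum>b\<in>zero_digit. \<Sum>a'<N. \<Sum>a<N.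
        cnj (V $$ (set_digit d n i a' b, t')) * M $$ (a',a) * V $$ (set_digit d n i a b, t))) / of_nat dL"
proof -
  let ?v = "\<lambda>a b t. V $$ (set_digit d n i a b, t)"
  let ?o = "\<lambda>l a t a' t'. omega $$ (recovery_index N dL l a t, recovery_index N dL l a' t')"
  have inner: "(\<Sum>l<dL. M $$ (a',a) * Z $$ (t',t) * ?o l a t a' t')
      = (\<Sum>b\<in>zero_digit. Z $$ (t',t) * (cnj (?v a' b t') * M $$ (a',a) * ?v a b t) / of_nat dL)"
    if "a' < N" "t' < dL" "a < N" "t < dL" for a' t' a t
    unfolding sum_distrib_left[symmetric] sum_omega_diagonal[OF that(3,4,1,2)]
    by (simp add: sum_distrib_left sum_divide_distrib mult_ac)
  \<comment> \<open>The four inner sums are packed into one over a product set, so that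
    \<open>l\<close> passes them in a single exchange.\<close>
  have "(\<Sum>l<dL. \<Sum>a'<N. \<Sum>t'<dL. \<Sum>a<N. \<Sum>t<dL. M $$ (a',a) * Z $$ (t',t) * ?o l a t a' t')
      = (\<Sum>l<dL. \<Sum>x\<in>(({..<N} \<times> {..<dL}) \<times> ({..<N} \<times> {..<dL})).
          M $$ (fst (fst x), fst (snd x)) * Z $$ (snd (fst x), snd (snd x)) *
          ?o l (fst (snd x)) (snd (snd x)) (fst (fst x)) (snd (fst x)))"
    by (simp only: sum.cartesian_product' fst_conv snd_conv)
  also have "\<dots> = (\<Sum>x\<in>(({..<N} \<times> {..<dL}) \<times> ({..<N} \<times> {..<dL})). \<Sum>l<dL.
          M $$ (fst (fst x), fst (snd x)) * Z $$ (snd (fst x), snd (snd x)) *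
          ?o l (fst (snd x)) (snd (snd x)) (fst (fst x)) (snd (fst x)))"
    by (rule sum.swap)
  also have "\<dots> = (\<Sum>a'<N. \<Sum>t'<dL. \<Sum>a<N. \<Sum>t<dL. \<Sum>l<dL. M $$ (a',a) * Z $$ (t',t) * ?o l a t a' t')"
    by (simp only: sum.cartesian_product' fst_conv snd_conv)
  also have "\<dots> = (\<Sum>a'<N. \<Sum>t'<dL. \<Sum>a<N. \<Sum>t<dL. \<Sum>b\<in>zero_digit.
      Z $$ (t',t) * (cnj (?v a' b t') * M $$ (a',a) * ?v a b t) / of_nat dL)"
    by (rule sum.cong[OF refl], rule sum.cong[OF refl], rule sum.cong[OF refl], rule sum.cong[OF refl], rule inner)
       simp_all
  also have "\<dots> = (\<Sum>t'<dL. \<Sum>a'<N. \<Sum>a<N. \<Sum>t<dL. \<Sum>b\<in>zero_digit.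
      Z $$ (t',t) * (cnj (?v a' b t') * M $$ (a',a) * ?v a b t) / of_nat dL)"
    by (rule sum.swap)
  also have "\<dots> = (\<Sum>t'<dL. \<Sum>a'<N. \<Sum>t<dL. \<Sum>a<N. \<Sum>b\<in>zero_digit.
      Z $$ (t',t) * (cnj (?v a' b t') * M $$ (a',a) * ?v a b t) / of_nat dL)"
    by (rule sum.cong[OF refl], rule sum.cong[OF refl], rule sum.swap)
  also have "\<dots> = (\<Sum>t'<dL. \<Sum>t<dL. \<Sum>a'<N. \<Sum>a<N. \<Sum>b\<in>zero_digit.
      Z $$ (t',t) * (cnj (?v a' b t') * M $$ (a',a) * ?v a b t) / of_nat dL)"
    by (rule sum.cong[OF refl], rule sum.swap)
  also have "\<dots> = (\<Sum>t'<dL. \<Sum>t<dL. \<Sum>a'<N. \<Sum>b\<in>zero_digit. \<Sum>a<N.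
      Z $$ (t',t) * (cnj (?v a' b t') * M $$ (a',a) * ?v a b t) / of_nat dL)"
    by (rule sum.cong[OF refl], rule sum.cong[OF refl], rule sum.cong[OF refl], rule sum.swap)
  also have "\<dots> = (\<Sum>t'<dL. \<Sum>t<dL. \<Sum>b\<in>zero_digit. \<Sum>a'<N. \<Sum>a<N.
      Z $$ (t',t) * (cnj (?v a' b t') * M $$ (a',a) * ?v a b t) / of_nat dL)"
    by (rule sum.cong[OF refl], rule sum.cong[OF refl], rule sum.swap)
  finally show ?thesis by (simp add: sum_distrib_left sum_divide_distrib)
qed

definition recovered :: "complex mat" where
  "recovered = tensor_id (\<lambda>X. R (erase d n i \<phi> (V * X * adj V))) dL dL dL (max_ent dL)"

text \<open>The block of the maximally entangled state at reference indices \<open>t\<close>,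
  \<open>t'\<close> is a matrix unit divided by \<open>dL\<close>. Its erasure is the ancilla trace
  of the dilated state, hence the same \<open>a\<close> on both sides; the factor 1 matches the
  linear combinations of \<open>is_channel_sum\<close>.\<close>

lemma erased_matrix_unit:
  assumes t: "t < dL" "t' < dL"
  shows "erase d n i \<phi> (V * mat dL dL (\<lambda>(s,s'). max_ent dL $$ (s * dL + t, s' * dL + t')) * adj V)
    = mat D D (\<lambda>(s,s'). \<Sum>a<N. 1 * block a t a t' $$ (s,s'))"
proof -
  let ?E = "mat dL dL (\<lambda>(s,s'). max_ent dL $$ (s * dL + t, s' * dL + t'))"
  have E: "?E \<in> carrier_mat dL dL" by simp
  have Ee: "?E $$ (s,s') = (if s = t then if s' = t' then 1 / of_nat dL else 0 else 0)" if "s < dL" "s' < dL" for s s'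
    using that t index_pair_less[OF that(1) t(1)] index_pair_less[OF that(2) t(2)] by (auto simp: max_ent_def)
  have VEV: "(V * ?E * adj V) $$ (x,y) = V $$ (x,t) * cnj (V $$ (y,t')) / of_nat dL" if xy: "x < D" "y < D" for x y
  proof -
    have "(V * ?E) $$ (x,s') = (if s' = t' then V $$ (x,t) / of_nat dL else 0)" if s': "s' < dL" for s'
    proof -
      have "(V * ?E) $$ (x,s') = (\<Sum>s<dL. if s = t then if s' = t' then V $$ (x,t) / of_nat dL else 0 else 0)"
        unfolding mult_mat_entry[OF V_dim E xy(1) s']
        by (rule sum.cong[OF refl]) (use Ee s' in auto)
      thus ?thesis using t by simp
    qed
    hence "(V * ?E * adj V) $$ (x,y) = (\<Sum>s'<dL. if s' = t' then V $$ (x,t) / of_nat dL * cnj (V $$ (y,t')) else 0)"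
      unfolding mult_mat_entry[OF mult_carrier_mat[OF V_dim E] adj_carrier[OF V_dim] xy]
      by (intro sum.cong[OF refl]) (use adj_entry[OF V_dim] xy in auto)
    thus ?thesis using t by simp
  qed
  show ?thesis
    unfolding erase_def
  proof (rule cong_mat[OF refl refl])
    fix s s' assume s: "s < D" "s' < D"
    show "(case (s,s') of (r, c) \<Rightarrow> \<phi> $ digit d n i r * cnj (\<phi> $ digit d n i c) *
        (\<Sum>a<N. (V * ?E * adj V) $$ (set_digit d n i a r, set_digit d n i a c)))
      = (case (s,s') of (s,s') \<Rightarrow> \<Sum>a<N. 1 * block a t a t' $$ (s,s'))"
      using s by (simp add: block_def amp_mult VEV set_digit_less sum_distrib_left)
  qed
qed

text \<open>The state whose fidelity is measured is the partial trace of \<open>omega\<close> over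
  the lost factor.\<close>

lemma recovered_entry:
  assumes "l < dL" "t < dL" "l' < dL" "t' < dL"
  shows "recovered $$ (l * dL + t, l' * dL + t')
    = (\<Sum>a<N. omega $$ (recovery_index N dL l a t, recovery_index N dL l' a t'))"
  unfolding recovered_def tensor_id_entry[OF assms(1,3,2,4)] erased_matrix_unit[OF assms(2,4)]
    is_channel_sum[OF R block_carrier assms(1,3)]
  using assms by (simp add: omega_entry)

lemma recovered_overlap: "ent_overlap dL recovered = recovery_overlap N dL omega"
proof -
  have "(\<Sum>l<dL. \<Sum>l'<dL. recovered $$ (l * dL + l, l' * dL + l'))
      = (\<Sum>l<dL. \<Sum>l'<dL. \<Sum>a<N. omega $$ (recovery_index N dL l a l, recovery_index N dL l' a l'))"
    by (intro sum.cong refl) (simp add: recovered_entry)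
  also have "\<dots> = (\<Sum>l<dL. \<Sum>a<N. \<Sum>l'<dL. omega $$ (recovery_index N dL l a l, recovery_index N dL l' a l'))"
    by (rule sum.cong[OF refl], rule sum.swap)
  also have "\<dots> = (\<Sum>a<N. \<Sum>l<dL. \<Sum>l'<dL. omega $$ (recovery_index N dL l a l, recovery_index N dL l' a l'))"
    by (rule sum.swap)
  finally show ?thesis by (simp add: ent_overlap_def recovery_overlap_def)
qed

text \<open>The encoded and erased state is a Gram matrix in the amplitudes, hence positive, and
  complete positivity of \<open>R\<close> carries this over.\<close>

lemma psd_recovered: "psd (dL * dL) recovered"
proof -
  let ?Y = "mat (D * dL) (D * dL) (\<lambda>(x,y). \<Sum>a<N. amp (x div dL) a (x mod dL) * cnj (amp (y div dL) a (y mod dL)))"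
  have "recovered = tensor_id R D dL dL ?Y"
    unfolding recovered_def
  proof (rule tensor_id_cong)
    fix t t' assume t: "t < dL" "t' < dL"
    have "mat D D (\<lambda>(s,s'). \<Sum>a<N. 1 * block a t a t' $$ (s,s')) = mat D D (\<lambda>(s,s'). ?Y $$ (s * dL + t, s' * dL + t'))"
      by (rule cong_mat[OF refl refl]) (use t in \<open>simp add: block_def index_pair_less\<close>)
    thus "R (erase d n i \<phi> (V * mat dL dL (\<lambda>(s, s'). max_ent dL $$ (s * dL + t, s' * dL + t')) * adj V))
        = R (mat D D (\<lambda>(s, s'). ?Y $$ (s * dL + t, s' * dL + t')))"
      unfolding erased_matrix_unit[OF t] by simp
  qed
  thus ?thesis using is_channelD(5)[OF R psd_gram_matrix] by simp
qed

text \<open>Decoupling for T shifted by the midpoint c of its spectrum, where the norm bound is half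
  the spread and cancels the factor 2. As V is an isometry, the shift contributes c times tr Z, so
  it is absorbed by passing from \<tau> to \<tau> + c.\<close>

lemma erasure_decoupling:
  assumes T: "T \<in> carrier_mat N N" "adj T = T"
  obtains \<tau> :: real where "\<And>v \<sigma>. orthonormal dL dL v \<Longrightarrow> (\<And>s. s < dL \<Longrightarrow> \<bar>\<sigma> s\<bar> \<le> 1) \<Longrightarrow>
    cmod ((\<Sum>t'<dL. \<Sum>t<dL. spectral_mat dL v \<sigma> $$ (t',t) *
        (\<Sum>r<D. \<Sum>c<D. cnj (V $$ (r,t')) * embed_op d n i T $$ (r,c) * V $$ (c,t)))
      - of_real \<tau> * mtrace (spectral_mat dL v \<sigma>)) / real dL
    \<le> spread T * sqrt (1 - Re (ent_overlap dL recovered))"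
    "Re (ent_overlap dL recovered) \<ge> 0" "Re (ent_overlap dL recovered) \<le> 1" "spread T \<ge> 0"
proof -
  obtain u \<kappa> where on: "orthonormal N N u" and Ts: "T = spectral_mat N u \<kappa>"
    using hermitian_spectral[OF T] by blast
  have N: "N > 0" using d_pos i by simp
  obtain c where c: "\<And>k. k < N \<Longrightarrow> \<bar>\<kappa> k - c\<bar> \<le> spread T / 2" and sp: "spread T \<ge> 0"
    using spread_spectral_mat[OF N on, of \<kappa>] unfolding Ts by blast
  let ?M = "spectral_mat N u (\<lambda>k. \<kappa> k - c)"
  have M: "?M $$ (a',a) = T $$ (a',a) - (if a = a' then of_real c else 0)" if "a' < N" "a < N" for a a'
  proof -
    have "?M $$ (a',a) = T $$ (a',a) - of_real c * (\<Sum>k<N. u k a' * cnj (u k a))"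
      using that by (simp add: Ts spectral_mat_def left_diff_distrib sum_subtractf sum_distrib_left mult.assoc)
    thus ?thesis using orthonormal_complete[OF on that] by auto
  qed
  obtain \<tau> :: real where \<tau>: "\<And>v \<sigma>. orthonormal dL dL v \<Longrightarrow> (\<And>s. s < dL \<Longrightarrow> \<bar>\<sigma> s\<bar> \<le> 1) \<Longrightarrow>
    cmod ((\<Sum>l<dL. \<Sum>a'<N. \<Sum>t'<dL. \<Sum>a<N. \<Sum>t<dL.
        ?M $$ (a',a) * spectral_mat dL v \<sigma> $$ (t',t) *
          omega $$ (recovery_index N dL l a t, recovery_index N dL l a' t'))
      - of_real \<tau> * (mtrace (spectral_mat dL v \<sigma>) / of_nat dL))
      \<le> 2 * (spread T / 2) * sqrt (1 - Re (recovery_overlap N dL omega))"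
    and ov: "Re (recovery_overlap N dL omega) \<ge> 0" "Re (recovery_overlap N dL omega) \<le> 1"
    using decoupling_bound[where \<kappa> = "\<lambda>k. \<kappa> k - c" and m = "spread T / 2" and u = u and N = N and d = dL,
        OF dL_pos _ on c psd_omega mtrace_omega] sp by auto
  have "cmod ((\<Sum>t'<dL. \<Sum>t<dL. spectral_mat dL v \<sigma> $$ (t',t) *
        (\<Sum>r<D. \<Sum>c<D. cnj (V $$ (r,t')) * embed_op d n i T $$ (r,c) * V $$ (c,t)))
      - of_real (\<tau> + c) * mtrace (spectral_mat dL v \<sigma>)) / real dL
    \<le> spread T * sqrt (1 - Re (ent_overlap dL recovered))"
    if v: "orthonormal dL dL v" "\<And>s. s < dL \<Longrightarrow> \<bar>\<sigma> s\<bar> \<le> 1" for v \<sigma>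
  proof -
    let ?Z = "spectral_mat dL v \<sigma>"
    have shift: "(\<Sum>b\<in>zero_digit. \<Sum>a'<N. \<Sum>a<N. cnj (V $$ (set_digit d n i a' b, t')) * ?M $$ (a',a) * V $$ (set_digit d n i a b, t))
        = (\<Sum>r<D. \<Sum>c<D. cnj (V $$ (r,t')) * embed_op d n i T $$ (r,c) * V $$ (c,t)) - of_real c * (if t' = t then 1 else 0)"
      if t: "t' < dL" "t < dL" for t t'
    proof -
      have "(\<Sum>b\<in>zero_digit. \<Sum>a'<N. \<Sum>a<N. cnj (V $$ (set_digit d n i a' b, t')) * ?M $$ (a',a) * V $$ (set_digit d n i a b, t))
        = (\<Sum>b\<in>zero_digit. \<Sum>a'<N. \<Sum>a<N. cnj (V $$ (set_digit d n i a' b, t')) * T $$ (a',a) * V $$ (set_digit d n i a b, t)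
           - (if a = a' then of_real c * (cnj (V $$ (set_digit d n i a' b, t')) * V $$ (set_digit d n i a' b, t)) else 0))"
        by (intro sum.cong refl) (simp add: M algebra_simps)
      also have "\<dots> = (\<Sum>r<D. \<Sum>c<D. cnj (V $$ (r,t')) * embed_op d n i T $$ (r,c) * V $$ (c,t))
          - of_real c * (\<Sum>b\<in>zero_digit. \<Sum>a<N. cnj (V $$ (set_digit d n i a b, t')) * V $$ (set_digit d n i a b, t))"
        by (simp add: embed_op_form sum_subtractf sum_distrib_left)
      finally show ?thesis by (simp add: isometry_split[OF t])
    qed
    have "(\<Sum>t'<dL. \<Sum>t<dL. ?Z $$ (t',t) * (\<Sum>b\<in>zero_digit. \<Sum>a'<N. \<Sum>a<N.
        cnj (V $$ (set_digit d n i a' b, t')) * ?M $$ (a',a) * V $$ (set_digit d n i a b, t)))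
      = (\<Sum>t'<dL. \<Sum>t<dL. ?Z $$ (t',t) * (\<Sum>r<D. \<Sum>c<D. cnj (V $$ (r,t')) * embed_op d n i T $$ (r,c) * V $$ (c,t))
         - (if t = t' then of_real c * ?Z $$ (t',t') else 0))"
      by (intro sum.cong refl) (simp add: shift right_diff_distrib)
    also have "\<dots> = (\<Sum>t'<dL. \<Sum>t<dL. ?Z $$ (t',t) * (\<Sum>r<D. \<Sum>c<D. cnj (V $$ (r,t')) * embed_op d n i T $$ (r,c) * V $$ (c,t)))
        - of_real c * mtrace ?Z"
      by (simp add: sum_subtractf mtrace_def sum_distrib_left)
    finally have eq0: "(\<Sum>t'<dL. \<Sum>t<dL. ?Z $$ (t',t) * (\<Sum>b\<in>zero_digit. \<Sum>a'<N. \<Sum>a<N.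
        cnj (V $$ (set_digit d n i a' b, t')) * ?M $$ (a',a) * V $$ (set_digit d n i a b, t)))
      = (\<Sum>t'<dL. \<Sum>t<dL. ?Z $$ (t',t) * (\<Sum>r<D. \<Sum>c<D. cnj (V $$ (r,t')) * embed_op d n i T $$ (r,c) * V $$ (c,t)))
        - of_real c * mtrace ?Z" .
    have eq: "(\<Sum>l<dL. \<Sum>a'<N. \<Sum>t'<dL. \<Sum>a<N. \<Sum>t<dL. ?M $$ (a',a) * ?Z $$ (t',t) *
          omega $$ (recovery_index N dL l a t, recovery_index N dL l a' t')) - of_real \<tau> * (mtrace ?Z / of_nat dL)
      = ((\<Sum>t'<dL. \<Sum>t<dL. ?Z $$ (t',t) * (\<Sum>r<D. \<Sum>c<D. cnj (V $$ (r,t')) * embed_op d n i T $$ (r,c) * V $$ (c,t)))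
        - of_real (\<tau> + c) * mtrace ?Z) / of_nat dL"
      unfolding omega_form eq0 by (simp add: diff_divide_distrib add_divide_distrib distrib_right)
    show ?thesis using \<tau>[where \<sigma> = \<sigma>, OF v] unfolding eq by (simp add: norm_divide recovered_overlap)
  qed
  thus ?thesis using that[of "\<tau> + c"] ov sp unfolding recovered_overlap by blast
qed

end

section \<open>Mixtures of channels and optimal recovery\<close>

text \<open>X tensored with the flag |i><i| in front. Precomposing with it restricts a recovery for
  the mixed noise to one for the \<open>i\<close>-th erasure.\<close>

definition inject_block :: "nat \<Rightarrow> nat \<Rightarrow> nat \<Rightarrow> complex mat \<Rightarrow> complex mat" where
  "inject_block n m i X = mat (n * m) (n * m)
     (\<lambda>(x,y). if x div m = i \<and> y div m = i then X $$ (x mod m, y mod m) else 0)"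

lemma inject_block_carrier [simp]: "inject_block n m i X \<in> carrier_mat (n * m) (n * m)"
  by (simp add: inject_block_def)

lemma inject_block_entry:
  assumes "j < n" "s < m" "j' < n" "s' < m"
  shows "inject_block n m i X $$ (j * m + s, j' * m + s') = (if j = i then if j' = i then X $$ (s,s') else 0 else 0)"
  using assms index_pair_less[OF assms(1,2)] index_pair_less[OF assms(3,4)]
  by (simp add: inject_block_def)

lemma psd_inject_block:
  assumes i: "i < n" and X: "psd m X"
  shows "psd (n * m) (inject_block n m i X)"
proof -
  have "qform (n * m) (inject_block n m i X) v = qform m X (\<lambda>s. v (i * m + s))" for v
  proof -
    have "qform (n * m) (inject_block n m i X) v = (\<Sum>j<n. \<Sum>s<m. \<Sum>j'<n. \<Sum>s'<m. if j' = i then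
        (if j = i then cnj (v (i * m + s)) * X $$ (s,s') * v (i * m + s') else 0) else 0)"
      unfolding qform_def sum_mult_index by (intro sum.cong refl) (simp add: inject_block_entry)
    also have "\<dots> = (\<Sum>j<n. \<Sum>s<m. \<Sum>j'<n. if j' = i then \<Sum>s'<m.
        (if j = i then cnj (v (i * m + s)) * X $$ (s,s') * v (i * m + s') else 0) else 0)"
      by (rule sum.cong[OF refl], rule sum.cong[OF refl], rule sum.cong[OF refl]) simp
    also have "\<dots> = (\<Sum>j<n. \<Sum>s<m. \<Sum>s'<m. if j = i then cnj (v (i * m + s)) * X $$ (s,s') * v (i * m + s') else 0)"
      using i by simp
    also have "\<dots> = (\<Sum>j<n. if j = i then qform m X (\<lambda>s. v (i * m + s)) else 0)"
      by (rule sum.cong[OF refl]) (simp add: qform_def)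
    finally show ?thesis using i by simp
  qed
  thus ?thesis using X by (simp add: psd_iff)
qed

lemma mtrace_inject_block:
  assumes i: "i < n" and X: "X \<in> carrier_mat m m"
  shows "mtrace (inject_block n m i X) = mtrace X"
proof -
  have "mtrace (inject_block n m i X) = (\<Sum>j<n. \<Sum>s<m. inject_block n m i X $$ (j * m + s, j * m + s))"
    using carrier_matD[OF inject_block_carrier] by (simp add: mtrace_def sum_mult_index)
  also have "\<dots> = (\<Sum>j<n. if j = i then \<Sum>s<m. X $$ (s,s) else 0)"
    by (rule sum.cong[OF refl]) (simp add: inject_block_entry)
  finally show ?thesis using i X by (simp add: mtrace_def)
qed

text \<open>Complete positivity: as the flag is the most significant index, injecting blockwise and
  ampliating by r is the same as injecting the whole matrix of size m r, which keeps it
  positive.\<close>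

lemma is_channel_inject_block:
  assumes R: "is_channel (n * m) k R" and i: "i < n"
  shows "is_channel m k (\<lambda>X. R (inject_block n m i X))"
  unfolding is_channel_def
proof (intro conjI ballI allI impI)
  fix X :: "complex mat" assume X: "X \<in> carrier_mat m m"
  show "R (inject_block n m i X) \<in> carrier_mat k k" by (rule is_channelD(1)[OF R]) simp
  show "mtrace (R (inject_block n m i X)) = mtrace X"
    by (simp add: is_channelD(4)[OF R] mtrace_inject_block[OF i X])
  have less: "x mod m < m" if "x < n * m" for x using that by (cases m) auto
  show "R (inject_block n m i (X + Y)) = R (inject_block n m i X) + R (inject_block n m i Y)"
    if Y: "Y \<in> carrier_mat m m" for Y
  proof -
    have "inject_block n m i (X + Y) = inject_block n m i X + inject_block n m i Y"
      using X Y less by (intro eq_matI) (auto simp: inject_block_def)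
    thus ?thesis using is_channelD(2)[OF R inject_block_carrier inject_block_carrier] by simp
  qed
  show "R (inject_block n m i (a \<cdot>\<^sub>m X)) = a \<cdot>\<^sub>m R (inject_block n m i X)" for a
  proof -
    have "inject_block n m i (a \<cdot>\<^sub>m X) = a \<cdot>\<^sub>m inject_block n m i X"
      using X less by (intro eq_matI) (auto simp: inject_block_def)
    thus ?thesis using is_channelD(3)[OF R inject_block_carrier] by simp
  qed
next
  fix r X assume X: "psd (m * r) X"
  have "tensor_id (\<lambda>X. R (inject_block n m i X)) m k r X = tensor_id R (n * m) k r (inject_block n (m * r) i X)"
  proof (rule tensor_id_cong, rule arg_cong[where f = R])
    fix q q' assume q: "q < r" "q' < r"
    show "inject_block n m i (mat m m (\<lambda>(s,s'). X $$ (s * r + q, s' * r + q')))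
        = mat (n * m) (n * m) (\<lambda>(s,s'). inject_block n (m * r) i X $$ (s * r + q, s' * r + q'))"
      unfolding inject_block_def[of n m]
    proof (rule cong_mat[OF refl refl])
      fix x y assume xy: "x < n * m" "y < n * m"
      hence m: "m > 0" by (cases m) auto
      have split: "z * r + p = z div m * (m * r) + (z mod m * r + p)" for z p
      proof -
        have "z * r = (z div m * m + z mod m) * r" by (simp only: div_mult_mod_eq)
        thus ?thesis by (simp only: add_mult_distrib add.assoc mult.assoc)
      qed
      have lt: "x div m < n" "y div m < n" using xy m by (simp_all add: div_less_iff_less_mult)
      have lt': "x mod m * r + q < m * r" "y mod m * r + q' < m * r"
        using m q by (auto intro: index_pair_less)
      have "inject_block n (m * r) i X $$ (x * r + q, y * r + q') =
          (if x div m = i then if y div m = i then X $$ (x mod m * r + q, y mod m * r + q') else 0 else 0)"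
        unfolding split[of x] split[of y] by (rule inject_block_entry[OF lt(1) lt'(1) lt(2) lt'(2)])
      thus "(case (x,y) of (x,y) \<Rightarrow> if x div m = i \<and> y div m = i
            then mat m m (\<lambda>(s,s'). X $$ (s * r + q, s' * r + q')) $$ (x mod m, y mod m) else 0)
        = (case (x,y) of (s,s') \<Rightarrow> inject_block n (m * r) i X $$ (s * r + q, s' * r + q'))"
        using m by simp
    qed
  qed
  thus "psd (k * r) (tensor_id (\<lambda>X. R (inject_block n m i X)) m k r X)"
    using is_channelD(5)[OF R, of r] psd_inject_block[OF i X] by (simp add: mult.assoc)
qed

text \<open>The channel that discards its input and prepares the first basis state. It makes the set
  of recoveries nonempty, as its supremum requires.\<close>

lemma is_channel_exists:
  assumes k: "k > 0"
  shows "is_channel m k (\<lambda>X. mat k k (\<lambda>(x,y). if x = 0 \<and> y = 0 then mtrace X else 0))" (is "is_channel m k ?\<Phi>")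
  unfolding is_channel_def
proof (intro conjI ballI allI impI)
  fix X :: "complex mat" assume X: "X \<in> carrier_mat m m"
  show "?\<Phi> X \<in> carrier_mat k k" by simp
  show "mtrace (?\<Phi> X) = mtrace X" using k by (simp add: mtrace_def[of "mat _ _ _"])
  show "?\<Phi> (X + Y) = ?\<Phi> X + ?\<Phi> Y" if "Y \<in> carrier_mat m m" for Y
    using X that by (intro eq_matI) (auto simp: mtrace_def sum.distrib)
  show "?\<Phi> (a \<cdot>\<^sub>m X) = a \<cdot>\<^sub>m ?\<Phi> X" for a
    using X by (intro eq_matI) (auto simp: mtrace_def sum_distrib_left)
next
  fix r X assume X: "psd (m * r) X"
  let ?T = "tensor_id ?\<Phi> m k r X"
  have T: "?T $$ (l * r + q, l' * r + q') = (if l' = 0 then if l = 0 then \<Sum>s<m. X $$ (s * r + q, s * r + q') else 0 else 0)"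
    if "l < k" "q < r" "l' < k" "q' < r" for l q l' q'
    using that by (simp add: tensor_id_entry mtrace_def)
  \<comment> \<open>Only the block of the prepared state is nonzero, and it holds the partial trace
    of X. Its form is a sum of forms of X at the vectors that put v at the basis state
    \<open>s\<close>.\<close>
  have "qform (k * r) ?T v = (\<Sum>s<m. qform (m * r) X (\<lambda>x. if x div r = s then v (x mod r) else 0))" for v
  proof -
    have "qform (k * r) ?T v = (\<Sum>l<k. \<Sum>q<r. \<Sum>l'<k. \<Sum>q'<r. if l' = 0 then if l = 0 then
        \<Sum>s<m. cnj (v q) * X $$ (s * r + q, s * r + q') * v q' else 0 else 0)"
      unfolding qform_def sum_mult_index
      by (intro sum.cong refl) (auto simp: T sum_distrib_left sum_distrib_right)
    also have "\<dots> = (\<Sum>l<k. \<Sum>q<r. \<Sum>l'<k. if l' = 0 then \<Sum>q'<r. if l = 0 then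
        \<Sum>s<m. cnj (v q) * X $$ (s * r + q, s * r + q') * v q' else 0 else 0)"
      by (rule sum.cong[OF refl], rule sum.cong[OF refl], rule sum.cong[OF refl]) simp
    also have "\<dots> = (\<Sum>l<k. if l = 0 then \<Sum>q<r. \<Sum>q'<r. \<Sum>s<m. cnj (v q) * X $$ (s * r + q, s * r + q') * v q' else 0)"
      using k by (intro sum.cong[OF refl]) simp
    also have "\<dots> = (\<Sum>q<r. \<Sum>q'<r. \<Sum>s<m. cnj (v q) * X $$ (s * r + q, s * r + q') * v q')"
      using k by simp
    also have "\<dots> = (\<Sum>q<r. \<Sum>s<m. \<Sum>q'<r. cnj (v q) * X $$ (s * r + q, s * r + q') * v q')"
      by (rule sum.cong[OF refl], rule sum.swap)
    also have "\<dots> = (\<Sum>s<m. \<Sum>q<r. \<Sum>q'<r. cnj (v q) * X $$ (s * r + q, s * r + q') * v q')"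
      by (rule sum.swap)
    also have "\<dots> = (\<Sum>s<m. qform (m * r) X (\<lambda>x. if x div r = s then v (x mod r) else 0))"
    proof (rule sum.cong[OF refl])
      fix s assume s: "s \<in> {..<m}"
      have "qform (m * r) X (\<lambda>x. if x div r = s then v (x mod r) else 0)
          = (\<Sum>l<m. \<Sum>q<r. \<Sum>l'<m. \<Sum>q'<r. if l' = s then if l = s then
              cnj (v q) * X $$ (s * r + q, s * r + q') * v q' else 0 else 0)"
        unfolding qform_def sum_mult_index by (intro sum.cong refl) auto
      also have "\<dots> = (\<Sum>l<m. \<Sum>q<r. \<Sum>l'<m. if l' = s then \<Sum>q'<r. if l = s then
              cnj (v q) * X $$ (s * r + q, s * r + q') * v q' else 0 else 0)"
        by (rule sum.cong[OF refl], rule sum.cong[OF refl], rule sum.cong[OF refl]) simp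
      also have "\<dots> = (\<Sum>l<m. if l = s then \<Sum>q<r. \<Sum>q'<r. cnj (v q) * X $$ (s * r + q, s * r + q') * v q' else 0)"
        using s by (intro sum.cong[OF refl]) simp
      finally show "(\<Sum>q<r. \<Sum>q'<r. cnj (v q) * X $$ (s * r + q, s * r + q') * v q')
          = qform (m * r) X (\<lambda>x. if x div r = s then v (x mod r) else 0)" using s by simp
    qed
    finally show ?thesis .
  qed
  thus "psd (k * r) ?T" using X by (auto simp: psd_iff tensor_id_def intro!: sum_nonneg)
qed

section \<open>Passing to the supremum over recoveries\<close>

lemma Sup_sequence:
  fixes S :: "real set"
  assumes "S \<noteq> {}" "bdd_above S"
  obtains x where "\<And>k. x k \<in> S" "x \<longlonglongrightarrow> Sup S"
proof -
  have "\<exists>y\<in>S. Sup S - 1 / real (Suc k) < y" for k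
    using assms less_cSup_iff[of S "Sup S - 1 / real (Suc k)"] by simp
  then obtain x where x: "\<And>k. x k \<in> S" "\<And>k. Sup S - 1 / real (Suc k) < x k" by metis
  have "x \<longlonglongrightarrow> Sup S"
  proof (rule tendsto_sandwich)
    show "\<forall>\<^sub>F k in sequentially. Sup S - 1 / real (Suc k) \<le> x k"
      using x(2) by (intro always_eventually) (auto simp: less_imp_le)
    show "\<forall>\<^sub>F k in sequentially. x k \<le> Sup S"
      using x(1) assms(2) by (intro always_eventually) (auto intro: cSup_upper)
    have "(\<lambda>k. Sup S - inverse (real (Suc k))) \<longlonglongrightarrow> Sup S - 0"
      by (intro tendsto_intros LIMSEQ_inverse_real_of_nat)
    thus "(\<lambda>k. Sup S - 1 / real (Suc k)) \<longlonglongrightarrow> Sup S" by (simp add: inverse_eq_divide)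
  qed simp
  with x(1) show ?thesis using that by blast
qed

definition recovery_state :: "nat \<Rightarrow> (complex mat \<Rightarrow> complex mat) \<Rightarrow> (complex mat \<Rightarrow> complex mat) \<Rightarrow> complex mat" where
  "recovery_state dL R M = tensor_id (\<lambda>X. R (M X)) dL dL dL (max_ent dL)"

definition recovery_fid :: "nat \<Rightarrow> (complex mat \<Rightarrow> complex mat) \<Rightarrow> (complex mat \<Rightarrow> complex mat) \<Rightarrow> real" where
  "recovery_fid dL R M = Re (ent_overlap dL (recovery_state dL R M))"

text \<open>The error depends continuously on the fidelity, so it is the limit of the errors of a
  maximising sequence. The range required by \<open>good\<close> bounds the set of fidelities and
  makes each squared fidelity equal to \<open>recovery_fid\<close>.\<close>

lemma ent_err_sequence:
  assumes dL: "dL > 0"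
    and good: "\<And>R. is_channel dB dL R \<Longrightarrow> psd (dL * dL) (recovery_state dL R M) \<and>
      0 \<le> recovery_fid dL R M \<and> recovery_fid dL R M \<le> 1"
  obtains R where "\<And>k :: nat. is_channel dB dL (R k)"
    "(\<lambda>k. sqrt (1 - recovery_fid dL (R k) M)) \<longlonglongrightarrow> ent_err dL dB M"
    "ent_err dL dB M \<ge> 0"
proof -
  let ?f = "\<lambda>R. fidelity (dL * dL) (tensor_id (\<lambda>X. R (M X)) dL dL dL (max_ent dL)) (max_ent dL)"
  let ?S = "{?f R | R. is_channel dB dL R}"
  have f: "?f R = sqrt (recovery_fid dL R M)" if "is_channel dB dL R" for R
    using fidelity_max_ent[OF _ dL] good[OF that] by (simp add: recovery_fid_def recovery_state_def)
  have b: "0 \<le> x \<and> x \<le> 1" if "x \<in> ?S" for x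
    using that good by (auto simp: f)
  have ne: "?S \<noteq> {}" using is_channel_exists[OF dL] by blast
  have bdd: "bdd_above ?S" using b by (intro bdd_aboveI[of _ 1]) blast
  obtain x where x: "\<And>k. x k \<in> ?S" "x \<longlonglongrightarrow> Sup ?S"
    using Sup_sequence[OF ne bdd] by blast
  have "\<forall>k. \<exists>R. x k = ?f R \<and> is_channel dB dL R" using x(1) by blast
  then obtain R where R: "\<And>k. x k = ?f (R k)" "\<And>k. is_channel dB dL (R k)" by metis
  have "(x k)\<^sup>2 = recovery_fid dL (R k) M" for k
    using R good[OF R(2)] by (simp add: f)
  moreover have "(\<lambda>k. sqrt (1 - (x k)\<^sup>2)) \<longlonglongrightarrow> ent_err dL dB M"
    unfolding ent_err_def ent_fid_def using x(2) by (intro tendsto_intros)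
  ultimately have lim: "(\<lambda>k. sqrt (1 - recovery_fid dL (R k) M)) \<longlonglongrightarrow> ent_err dL dB M" by simp
  have "ent_err dL dB M \<ge> 0"
    by (rule LIMSEQ_le_const[OF lim]) (use good[OF R(2)] in auto)
  with R(2) lim show ?thesis using that by blast
qed

text \<open>Concavity obtained from Cauchy-Schwarz by splitting each weight into two roots.\<close>

lemma weighted_sum_le_sqrt:
  fixes q x :: "nat \<Rightarrow> real"
  assumes "\<And>i. i < n \<Longrightarrow> q i \<ge> 0" "(\<Sum>i<n. q i) = 1" "\<And>i. i < n \<Longrightarrow> x i \<ge> 0"
  shows "(\<Sum>i<n. q i * sqrt (x i)) \<le> sqrt (\<Sum>i<n. q i * x i)"
proof (rule real_le_rsqrt)
  have "(\<Sum>i<n. q i * sqrt (x i)) = (\<Sum>i<n. sqrt (q i) * (sqrt (q i) * sqrt (x i)))"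
    by (rule sum.cong) (use assms in \<open>auto simp flip: mult.assoc\<close>)
  also have "\<dots>\<^sup>2 \<le> (\<Sum>i<n. (sqrt (q i))\<^sup>2) * (\<Sum>i<n. (sqrt (q i) * sqrt (x i))\<^sup>2)"
    by (rule Cauchy_Schwarz_ineq_sum)
  also have "\<dots> = (\<Sum>i<n. q i) * (\<Sum>i<n. q i * x i)"
    by (intro arg_cong2[where f = "(*)"] sum.cong) (use assms in \<open>auto simp: power_mult_distrib\<close>)
  finally show "(\<Sum>i<n. q i * sqrt (x i))\<^sup>2 \<le> (\<Sum>i<n. q i * x i)" using assms(2) by simp
qed

text \<open>The mean m of the eigenvalues is within their average distance from any real \<mu>, so
  replacing \<mu> by m adds at most the same sum once more. This is the source of the 1/2 in the
  final bounds.\<close>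

lemma trace_norm_centered_le:
  fixes \<mu> :: real
  assumes dL: "dL > 0" and on: "orthonormal dL dL v"
  shows "trace_norm (spectral_mat dL v \<kappa> - (mtrace (spectral_mat dL v \<kappa>) / of_nat dL) \<cdot>\<^sub>m 1\<^sub>m dL)
    \<le> 2 * (\<Sum>s<dL. \<bar>\<kappa> s - \<mu>\<bar>)"
proof -
  define m where "m = (\<Sum>s<dL. \<kappa> s) / real dL"
  have "spectral_mat dL v \<kappa> - (mtrace (spectral_mat dL v \<kappa>) / of_nat dL) \<cdot>\<^sub>m 1\<^sub>m dL = spectral_mat dL v (\<lambda>s. \<kappa> s - m)"
  proof (rule eq_matI)
    fix x y assume "x < dim_row (spectral_mat dL v (\<lambda>s. \<kappa> s - m))" "y < dim_col (spectral_mat dL v (\<lambda>s. \<kappa> s - m))"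
    hence xy: "x < dL" "y < dL" by simp_all
    have "spectral_mat dL v (\<lambda>s. \<kappa> s - m) $$ (x,y) = spectral_mat dL v \<kappa> $$ (x,y) - of_real m * (\<Sum>s<dL. v s x * cnj (v s y))"
      using xy by (simp add: spectral_mat_def left_diff_distrib sum_subtractf sum_distrib_left mult.assoc)
    thus "(spectral_mat dL v \<kappa> - (mtrace (spectral_mat dL v \<kappa>) / of_nat dL) \<cdot>\<^sub>m 1\<^sub>m dL) $$ (x,y)
        = spectral_mat dL v (\<lambda>s. \<kappa> s - m) $$ (x,y)"
      using xy orthonormal_complete[OF on xy] by (simp add: mtrace_spectral_mat[OF on] m_def)
  qed simp_all
  hence "trace_norm (spectral_mat dL v \<kappa> - (mtrace (spectral_mat dL v \<kappa>) / of_nat dL) \<cdot>\<^sub>m 1\<^sub>m dL)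
      = (\<Sum>s<dL. \<bar>\<kappa> s - m\<bar>)"
    by (simp only: trace_norm_spectral_mat[OF on])
  also have "\<dots> \<le> (\<Sum>s<dL. \<bar>\<kappa> s - \<mu>\<bar> + \<bar>\<mu> - m\<bar>)" by (rule sum_mono) linarith
  also have "\<dots> = (\<Sum>s<dL. \<bar>\<kappa> s - \<mu>\<bar>) + real dL * \<bar>\<mu> - m\<bar>" by (simp add: sum.distrib)
  also have "real dL * \<bar>\<mu> - m\<bar> = \<bar>\<Sum>s<dL. \<kappa> s - \<mu>\<bar>"
  proof -
    have "(\<Sum>s<dL. \<kappa> s - \<mu>) = - (real dL * (\<mu> - m))"
      using dL by (simp add: m_def sum_subtractf field_simps)
    thus ?thesis by (simp add: abs_mult)
  qed
  also have "\<dots> \<le> (\<Sum>s<dL. \<bar>\<kappa> s - \<mu>\<bar>)" by (rule sum_abs)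
  finally show ?thesis by simp
qed

section \<open>Covariant codes\<close>

locale covariant_code =
  fixes n dL :: nat and d :: "nat \<Rightarrow> nat"
    and V TL :: "complex mat" and T :: "nat \<Rightarrow> complex mat"
    and \<nu> :: real and \<phi> :: "nat \<Rightarrow> complex vec"
  assumes dL_pos: "dL > 0"
    and d_pos: "\<forall>i<n. d i > 0"
    and V_dim: "V \<in> carrier_mat (dimA d n) dL"
    and V_isometry: "adj V * V = 1\<^sub>m dL"
    and TL_herm: "TL \<in> carrier_mat dL dL" "adj TL = TL"
    and T_herm: "\<forall>i<n. T i \<in> carrier_mat (d i) (d i) \<and> adj (T i) = T i"
    and covariant: "local_sum d n T * V = V * (TL - complex_of_real \<nu> \<cdot>\<^sub>m 1\<^sub>m dL)"
    and phi_state: "\<forall>i<n. \<phi> i \<in> carrier_vec (d i) \<and> (\<Sum>a<d i. (cmod (\<phi> i $ a))\<^sup>2) = 1"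
begin

abbreviation "D \<equiv> dimA d n"

definition erased :: "nat \<Rightarrow> complex mat \<Rightarrow> complex mat" where
  "erased i X = erase d n i (\<phi> i) (V * X * adj V)"

definition noisy :: "(nat \<Rightarrow> real) \<Rightarrow> complex mat \<Rightarrow> complex mat" where
  "noisy q X = noise d n q \<phi> (V * X * adj V)"

definition charge_deviation :: real where
  "charge_deviation = trace_norm (TL - (mtrace TL / of_nat dL) \<cdot>\<^sub>m 1\<^sub>m dL) / (2 * real dL)"

lemma erased_code:
  assumes "i < n" "is_channel D dL R"
  shows "erased_code d n i dL V (\<phi> i) R"
  by unfold_locales (use assms d_pos dL_pos V_dim V_isometry phi_state in auto)

lemma recovered_eq:
  assumes "i < n" "is_channel D dL R"
  shows "erased_code.recovered d n i dL V (\<phi> i) R = recovery_state dL R (erased i)"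
  by (simp add: erased_code.recovered_def[OF erased_code[OF assms]] recovery_state_def erased_def)

lemma recovery_state_erased:
  assumes "i < n" "is_channel D dL R"
  shows "psd (dL * dL) (recovery_state dL R (erased i))"
    "recovery_fid dL R (erased i) \<ge> 0" "recovery_fid dL R (erased i) \<le> 1" "spread (T i) \<ge> 0"
proof -
  interpret E: erased_code d n i dL V "\<phi> i" R by (rule erased_code[OF assms])
  show "psd (dL * dL) (recovery_state dL R (erased i))"
    using E.psd_recovered by (simp add: recovered_eq[OF assms])
  have Ti: "T i \<in> carrier_mat (d i) (d i)" "adj (T i) = T i" using T_herm assms(1) by auto
  show "recovery_fid dL R (erased i) \<ge> 0" "recovery_fid dL R (erased i) \<le> 1" "spread (T i) \<ge> 0"
    unfolding recovery_fid_def recovered_eq[OF assms, symmetric]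
    by (rule E.erasure_decoupling[OF Ti], assumption)+
qed

text \<open>The covariance relation multiplied by \<open>adj V\<close> from the left: the
  compressions of the local charges add up to \<open>TL - \<nu>\<close>.\<close>

lemma charge_matrix:
  assumes t: "t' < dL" "t < dL"
  shows "(\<Sum>i<n. \<Sum>r<D. \<Sum>c<D. cnj (V $$ (r,t')) * embed_op d n i (T i) $$ (r,c) * V $$ (c,t))
    = TL $$ (t',t) - of_real \<nu> * (if t' = t then 1 else 0)"
proof -
  let ?A = "local_sum d n T" and ?B = "TL - complex_of_real \<nu> \<cdot>\<^sub>m 1\<^sub>m dL"
  have A: "?A \<in> carrier_mat D D" by (simp add: local_sum_def)
  have B: "?B \<in> carrier_mat dL dL" by (intro minus_carrier_mat smult_carrier_mat one_carrier_mat)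
  have "(\<Sum>i<n. \<Sum>r<D. \<Sum>c<D. cnj (V $$ (r,t')) * embed_op d n i (T i) $$ (r,c) * V $$ (c,t))
      = (\<Sum>r<D. \<Sum>i<n. \<Sum>c<D. cnj (V $$ (r,t')) * embed_op d n i (T i) $$ (r,c) * V $$ (c,t))"
    by (rule sum.swap)
  also have "\<dots> = (\<Sum>r<D. \<Sum>c<D. \<Sum>i<n. cnj (V $$ (r,t')) * embed_op d n i (T i) $$ (r,c) * V $$ (c,t))"
    by (rule sum.cong[OF refl], rule sum.swap)
  also have "\<dots> = (\<Sum>r<D. adj V $$ (t',r) * (?A * V) $$ (r,t))"
  proof (rule sum.cong[OF refl])
    fix r assume "r \<in> {..<D}"
    hence r: "r < D" by simp
    show "(\<Sum>c<D. \<Sum>i<n. cnj (V $$ (r,t')) * embed_op d n i (T i) $$ (r,c) * V $$ (c,t)) = adj V $$ (t',r) * (?A * V) $$ (r,t)"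
      unfolding mult_mat_entry[OF A V_dim r t(2)] adj_entry[OF V_dim t(1) r] sum_distrib_left
      by (rule sum.cong[OF refl]) (use r in \<open>simp add: local_sum_def sum_distrib_left sum_distrib_right mult.assoc\<close>)
  qed
  also have "\<dots> = (adj V * (V * ?B)) $$ (t',t)"
    using mult_mat_entry[OF adj_carrier[OF V_dim] mult_carrier_mat[OF A V_dim] t] by (simp only: covariant)
  also have "adj V * (V * ?B) = ?B"
    using assoc_mult_mat[OF adj_carrier[OF V_dim] V_dim B] V_isometry B by simp
  finally show ?thesis using t TL_herm by simp
qed

text \<open>The recovery may vary with \<open>i\<close>. Near-optimal ones for the separate erasures
  lead to the first bound, the restrictions of a single recovery for the mixed noise to the
  second.\<close>

lemma charge_deviation_le:
  assumes R: "\<And>i. i < n \<Longrightarrow> is_channel D dL (R i)"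
  shows "charge_deviation \<le> (\<Sum>i<n. spread (T i) * sqrt (1 - recovery_fid dL (R i) (erased i)))"
proof -
  let ?X = "\<lambda>i t' t. \<Sum>r<D. \<Sum>c<D. cnj (V $$ (r,t')) * embed_op d n i (T i) $$ (r,c) * V $$ (c,t)"
  \<comment> \<open>The bound for all Z is folded into a predicate of \<tau>, so that one \<tau> per
    factor can be chosen before Z is defined from them.\<close>
  define P where "P i \<tau> \<longleftrightarrow> (\<forall>v \<sigma>. orthonormal dL dL v \<longrightarrow> (\<forall>s<dL. \<bar>\<sigma> s\<bar> \<le> 1) \<longrightarrow>
    cmod ((\<Sum>t'<dL. \<Sum>t<dL. spectral_mat dL v \<sigma> $$ (t',t) * ?X i t' t)
      - of_real \<tau> * mtrace (spectral_mat dL v \<sigma>)) / real dL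
    \<le> spread (T i) * sqrt (1 - recovery_fid dL (R i) (erased i)))" for i and \<tau> :: real
  have "\<exists>\<tau>. P i \<tau>" if i: "i < n" for i
  proof -
    interpret E: erased_code d n i dL V "\<phi> i" "R i" by (rule erased_code[OF i R[OF i]])
    have Ti: "T i \<in> carrier_mat (d i) (d i)" "adj (T i) = T i" using T_herm i by auto
    show ?thesis
      unfolding P_def recovery_fid_def recovered_eq[OF i R[OF i], symmetric]
      by (rule E.erasure_decoupling[OF Ti]) blast
  qed
  then obtain \<tau> where P: "\<And>i. i < n \<Longrightarrow> P i (\<tau> i)" by metis
  have \<tau>: "i < n \<Longrightarrow> orthonormal dL dL v \<Longrightarrow> (\<forall>s<dL. \<bar>\<sigma> s\<bar> \<le> 1) \<Longrightarrow>
    cmod ((\<Sum>t'<dL. \<Sum>t<dL. spectral_mat dL v \<sigma> $$ (t',t) * ?X i t' t)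
      - of_real (\<tau> i) * mtrace (spectral_mat dL v \<sigma>)) / real dL
    \<le> spread (T i) * sqrt (1 - recovery_fid dL (R i) (erased i))" for i v \<sigma>
    using P[of i] unfolding P_def by blast
  obtain v \<kappa> where on: "orthonormal dL dL v" and TLs: "TL = spectral_mat dL v \<kappa>"
    using hermitian_spectral[OF TL_herm] by blast
  \<comment> \<open>The coefficients of tr Z: \<nu> from covariance and one \<tau> from each
    decoupling. The sign of \<kappa> - \<mu> then turns the total pairing into a sum of absolute
    values.\<close>
  define \<mu> where "\<mu> = \<nu> + (\<Sum>i<n. \<tau> i)"
  define \<sigma> where "\<sigma> s = sgn (\<kappa> s - \<mu>)" for s
  define v' where "v' k x = cnj (v k x)" for k x
  \<comment> \<open>Conjugating the eigenbasis transposes the sign of \<open>TL - \<mu>\<close>: the pairing with the reference is entrywise.\<close>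
  let ?Z = "spectral_mat dL v' \<sigma>"
  have on': "orthonormal dL dL v'"
    unfolding orthonormal_def
  proof (intro allI impI)
    fix k l assume kl: "k < dL" "l < dL"
    have "(\<Sum>x<dL. cnj (v' k x) * v' l x) = cnj (\<Sum>x<dL. cnj (v k x) * v l x)"
      by (simp add: v'_def)
    also have "\<dots> = (if k = l then 1 else 0)"
      using on kl by (simp add: orthonormal_def del: cnj_sum)
    finally show "(\<Sum>x<dL. cnj (v' k x) * v' l x) = (if k = l then 1 else 0)" .
  qed
  have \<sigma>: "\<forall>s<dL. \<bar>\<sigma> s\<bar> \<le> 1" by (simp add: \<sigma>_def abs_sgn_eq)
  \<comment> \<open>The trace of the sign of \<open>TL - \<mu>\<close> times
    \<open>TL - \<nu>\<close>, evaluated in the eigenbasis of \<open>TL\<close>; the \<tau> part of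
    \<mu> is subtracted only afterwards.\<close>
  have total: "(\<Sum>i<n. \<Sum>t'<dL. \<Sum>t<dL. ?Z $$ (t',t) * ?X i t' t) = of_real (\<Sum>s<dL. \<sigma> s * (\<kappa> s - \<nu>))"
  proof -
    have "(\<Sum>i<n. \<Sum>t'<dL. \<Sum>t<dL. ?Z $$ (t',t) * ?X i t' t) = (\<Sum>t'<dL. \<Sum>i<n. \<Sum>t<dL. ?Z $$ (t',t) * ?X i t' t)"
      by (rule sum.swap)
    also have "\<dots> = (\<Sum>t'<dL. \<Sum>t<dL. \<Sum>i<n. ?Z $$ (t',t) * ?X i t' t)"
      by (rule sum.cong[OF refl], rule sum.swap)
    also have "\<dots> = (\<Sum>t'<dL. \<Sum>t<dL. ?Z $$ (t',t) * TL $$ (t',t) - (if t = t' then of_real \<nu> * ?Z $$ (t',t') else 0))"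
      by (rule sum.cong[OF refl], rule sum.cong[OF refl])
         (simp only: sum_distrib_left[symmetric] charge_matrix lessThan_iff, simp add: right_diff_distrib)
    also have "\<dots> = (\<Sum>t'<dL. \<Sum>t<dL. ?Z $$ (t',t) * TL $$ (t',t)) - of_real \<nu> * mtrace ?Z"
      by (simp add: sum_subtractf mtrace_def sum_distrib_left)
    also have "(\<Sum>t'<dL. \<Sum>t<dL. ?Z $$ (t',t) * TL $$ (t',t))
        = (\<Sum>t'<dL. \<Sum>t<dL. \<Sum>s<dL. of_real (\<sigma> s) * (cnj (v s t') * TL $$ (t',t) * v s t))"
      by (intro sum.cong refl) (simp add: spectral_mat_def[of dL v'] v'_def sum_distrib_left sum_distrib_right mult_ac)
    also have "\<dots> = (\<Sum>t'<dL. \<Sum>s<dL. \<Sum>t<dL. of_real (\<sigma> s) * (cnj (v s t') * TL $$ (t',t) * v s t))"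
      by (rule sum.cong[OF refl], rule sum.swap)
    also have "\<dots> = (\<Sum>s<dL. \<Sum>t'<dL. \<Sum>t<dL. of_real (\<sigma> s) * (cnj (v s t') * TL $$ (t',t) * v s t))"
      by (rule sum.swap)
    also have "\<dots> = (\<Sum>s<dL. of_real (\<sigma> s) * (\<Sum>t'<dL. cnj (v s t') * (\<Sum>t<dL. TL $$ (t',t) * v s t)))"
      by (simp add: sum_distrib_left mult.assoc)
    also have "\<dots> = (\<Sum>s<dL. of_real (\<sigma> s * \<kappa> s))"
    proof (rule sum.cong[OF refl])
      fix s assume "s \<in> {..<dL}"
      hence s: "s < dL" by simp
      have "(\<Sum>t'<dL. cnj (v s t') * (\<Sum>t<dL. TL $$ (t',t) * v s t)) = of_real (\<kappa> s) * (\<Sum>t'<dL. cnj (v s t') * v s t')"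
        unfolding TLs sum_distrib_left[of "of_real (\<kappa> s)"]
        by (rule sum.cong[OF refl]) (simp add: spectral_mat_apply[OF on s])
      thus "of_real (\<sigma> s) * (\<Sum>t'<dL. cnj (v s t') * (\<Sum>t<dL. TL $$ (t',t) * v s t)) = complex_of_real (\<sigma> s * \<kappa> s)"
        using on s by (simp add: orthonormal_def)
    qed
    finally show ?thesis
      by (simp add: mtrace_spectral_mat[OF on'] right_diff_distrib sum_subtractf sum_distrib_left mult.commute)
  qed
  have "(\<Sum>s<dL. \<bar>\<kappa> s - \<mu>\<bar>) = (\<Sum>s<dL. \<sigma> s * (\<kappa> s - \<nu>)) - (\<Sum>i<n. \<tau> i) * (\<Sum>s<dL. \<sigma> s)"
  proof -
    have "\<bar>\<kappa> s - \<mu>\<bar> = \<sigma> s * (\<kappa> s - \<nu>) - (\<Sum>i<n. \<tau> i) * \<sigma> s" for s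
      by (simp add: \<sigma>_def \<mu>_def abs_sgn algebra_simps)
    thus ?thesis by (simp add: sum_subtractf sum_distrib_left)
  qed
  hence eq: "complex_of_real (\<Sum>s<dL. \<bar>\<kappa> s - \<mu>\<bar>)
      = (\<Sum>i<n. (\<Sum>t'<dL. \<Sum>t<dL. ?Z $$ (t',t) * ?X i t' t) - of_real (\<tau> i) * mtrace ?Z)"
    unfolding sum_subtractf total mtrace_spectral_mat[OF on'] sum_distrib_right[symmetric] of_real_sum[symmetric]
    by simp
  have "(\<Sum>s<dL. \<bar>\<kappa> s - \<mu>\<bar>) \<ge> 0" by (intro sum_nonneg) simp
  hence "(\<Sum>s<dL. \<bar>\<kappa> s - \<mu>\<bar>)
      = cmod (\<Sum>i<n. (\<Sum>t'<dL. \<Sum>t<dL. ?Z $$ (t',t) * ?X i t' t) - of_real (\<tau> i) * mtrace ?Z)"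
    by (simp only: eq[symmetric] norm_of_real abs_of_nonneg)
  also have "\<dots> \<le> (\<Sum>i<n. cmod ((\<Sum>t'<dL. \<Sum>t<dL. ?Z $$ (t',t) * ?X i t' t) - of_real (\<tau> i) * mtrace ?Z))"
    by (rule norm_sum)
  finally have "(\<Sum>s<dL. \<bar>\<kappa> s - \<mu>\<bar>) / real dL
      \<le> (\<Sum>i<n. cmod ((\<Sum>t'<dL. \<Sum>t<dL. ?Z $$ (t',t) * ?X i t' t) - of_real (\<tau> i) * mtrace ?Z) / real dL)"
    unfolding sum_divide_distrib[symmetric] by (rule divide_right_mono) simp
  also have "\<dots> \<le> (\<Sum>i<n. spread (T i) * sqrt (1 - recovery_fid dL (R i) (erased i)))"
    by (rule sum_mono) (use \<tau>[OF _ on' \<sigma>] in simp)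
  finally have bound: "(\<Sum>s<dL. \<bar>\<kappa> s - \<mu>\<bar>) / real dL \<le> (\<Sum>i<n. spread (T i) * sqrt (1 - recovery_fid dL (R i) (erased i)))" .
  have "charge_deviation \<le> 2 * (\<Sum>s<dL. \<bar>\<kappa> s - \<mu>\<bar>) / (2 * real dL)"
    unfolding charge_deviation_def unfolding TLs by (rule divide_right_mono[OF trace_norm_centered_le[OF dL_pos on]]) simp
  with bound show ?thesis by simp
qed

lemma erased_bound:
  "charge_deviation \<le> (\<Sum>i<n. spread (T i) * ent_err dL D (erased i))"
proof -
  have "\<exists>R. (\<forall>k :: nat. is_channel D dL (R k)) \<and>
      (\<lambda>k. sqrt (1 - recovery_fid dL (R k) (erased i))) \<longlonglongrightarrow> ent_err dL D (erased i)" if i: "i < n" for i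
    by (rule ent_err_sequence[OF dL_pos, of D "erased i"]) (use recovery_state_erased[OF i] in blast)+
  then obtain R where R: "\<And>i k. i < n \<Longrightarrow> is_channel D dL (R i (k :: nat))"
    "\<And>i. i < n \<Longrightarrow> (\<lambda>k. sqrt (1 - recovery_fid dL (R i k) (erased i))) \<longlonglongrightarrow> ent_err dL D (erased i)"
    by metis
  have "(\<lambda>k. \<Sum>i<n. spread (T i) * sqrt (1 - recovery_fid dL (R i k) (erased i)))
      \<longlonglongrightarrow> (\<Sum>i<n. spread (T i) * ent_err dL D (erased i))"
    by (intro tendsto_intros R(2)) simp
  moreover have "charge_deviation \<le> (\<Sum>i<n. spread (T i) * sqrt (1 - recovery_fid dL (R i k) (erased i)))" for k
    by (rule charge_deviation_le[OF R(1)])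
  ultimately show ?thesis using LIMSEQ_le_const by blast
qed

lemma noisy_decomposition:
  "noisy q X = mat (n * D) (n * D) (\<lambda>(x,y). \<Sum>i<n. of_real (q i) * inject_block n D i (erased i X) $$ (x,y))"
  unfolding noisy_def noise_def
proof (rule cong_mat[OF refl refl])
  fix x y assume xy: "x < n * D" "y < n * D"
  have D: "D > 0" using xy by (cases D) auto
  have lt: "x div D < n" using xy D by (simp add: div_less_iff_less_mult)
  have "(\<Sum>i<n. of_real (q i) * inject_block n D i (erased i X) $$ (x,y))
      = (\<Sum>i<n. if i = x div D then if x div D = y div D
          then of_real (q i) * erased i X $$ (x mod D, y mod D) else 0 else 0)"
    using xy by (intro sum.cong refl) (auto simp: inject_block_def)
  thus "(case (x,y) of (r,c) \<Rightarrow> if r div D = c div D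
      then of_real (q (r div D)) * erase d n (r div D) (\<phi> (r div D)) (V * X * adj V) $$ (r mod D, c mod D) else 0)
    = (case (x,y) of (x,y) \<Rightarrow> \<Sum>i<n. of_real (q i) * inject_block n D i (erased i X) $$ (x,y))"
    using lt by (simp add: erased_def)
qed

text \<open>The noise output is a mixture of flagged erasures, so by linearity the recovered state
  is the mixture of what the restrictions of \<open>R\<close> recover.\<close>

lemma recovery_state_noisy:
  assumes R: "is_channel (n * D) dL R"
  shows "recovery_state dL R (noisy q) = mat (dL * dL) (dL * dL)
    (\<lambda>(x,y). \<Sum>i<n. of_real (q i) * recovery_state dL (\<lambda>X. R (inject_block n D i X)) (erased i) $$ (x,y))"
proof (rule eq_matI)
  fix x y
  assume "x < dim_row (mat (dL * dL) (dL * dL)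
      (\<lambda>(x,y). \<Sum>i<n. of_real (q i) * recovery_state dL (\<lambda>X. R (inject_block n D i X)) (erased i) $$ (x,y)))"
    "y < dim_col (mat (dL * dL) (dL * dL)
      (\<lambda>(x,y). \<Sum>i<n. of_real (q i) * recovery_state dL (\<lambda>X. R (inject_block n D i X)) (erased i) $$ (x,y)))"
  hence xy: "x < dL * dL" "y < dL * dL" by simp_all
  have lt: "x div dL < dL" "y div dL < dL" using xy dL_pos by (simp_all add: div_less_iff_less_mult)
  show "recovery_state dL R (noisy q) $$ (x,y) = mat (dL * dL) (dL * dL)
    (\<lambda>(x,y). \<Sum>i<n. of_real (q i) * recovery_state dL (\<lambda>X. R (inject_block n D i X)) (erased i) $$ (x,y)) $$ (x,y)"
    using xy unfolding recovery_state_def tensor_id_def noisy_decomposition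
    by (simp add: is_channel_sum[OF R inject_block_carrier lt] del: case_prod_eta cond_case_prod_eta)
qed (simp_all add: recovery_state_def tensor_id_def)

text \<open>Positivity and the range pass to mixtures, and the squared fidelity averages because the
  overlap is linear in the state.\<close>

lemma recovery_noisy:
  assumes R: "is_channel (n * D) dL R" and q: "\<And>i. i < n \<Longrightarrow> q i > 0" "(\<Sum>i<n. q i) = 1"
  shows "psd (dL * dL) (recovery_state dL R (noisy q))"
    "recovery_fid dL R (noisy q) = (\<Sum>i<n. q i * recovery_fid dL (\<lambda>X. R (inject_block n D i X)) (erased i))"
    "recovery_fid dL R (noisy q) \<ge> 0" "recovery_fid dL R (noisy q) \<le> 1"
proof -
  let ?R = "\<lambda>i X. R (inject_block n D i X)"
  let ?\<rho> = "\<lambda>i. recovery_state dL (?R i) (erased i)"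
  have Ri: "is_channel D dL (?R i)" if "i < n" for i
    by (rule is_channel_inject_block[OF R that])
  note good = recovery_state_erased[OF _ Ri]
  show "psd (dL * dL) (recovery_state dL R (noisy q))"
    unfolding recovery_state_noisy[OF R]
    by (rule psd_weighted_sum) (use good(1) q(1) in \<open>auto intro: less_imp_le\<close>)
  have "(\<Sum>l<dL. \<Sum>l'<dL. recovery_state dL R (noisy q) $$ (l * dL + l, l' * dL + l'))
      = (\<Sum>l<dL. \<Sum>l'<dL. \<Sum>i<n. of_real (q i) * ?\<rho> i $$ (l * dL + l, l' * dL + l'))"
    unfolding recovery_state_noisy[OF R]
    by (rule sum.cong[OF refl], rule sum.cong[OF refl]) (simp add: index_pair_less)
  also have "\<dots> = (\<Sum>l<dL. \<Sum>i<n. \<Sum>l'<dL. of_real (q i) * ?\<rho> i $$ (l * dL + l, l' * dL + l'))"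
    by (rule sum.cong[OF refl], rule sum.swap)
  also have "\<dots> = (\<Sum>i<n. \<Sum>l<dL. \<Sum>l'<dL. of_real (q i) * ?\<rho> i $$ (l * dL + l, l' * dL + l'))"
    by (rule sum.swap)
  finally have "ent_overlap dL (recovery_state dL R (noisy q)) = (\<Sum>i<n. of_real (q i) * ent_overlap dL (?\<rho> i))"
    by (simp add: ent_overlap_def sum_divide_distrib sum_distrib_left)
  thus eq: "recovery_fid dL R (noisy q) = (\<Sum>i<n. q i * recovery_fid dL (?R i) (erased i))"
    by (simp add: recovery_fid_def)
  show "recovery_fid dL R (noisy q) \<ge> 0"
    unfolding eq by (intro sum_nonneg mult_nonneg_nonneg) (use good(2) q(1) in \<open>auto intro: less_imp_le\<close>)
  have "recovery_fid dL R (noisy q) \<le> (\<Sum>i<n. q i * 1)"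
    unfolding eq by (intro sum_mono mult_left_mono) (use good(3) q(1) in \<open>auto intro: less_imp_le\<close>)
  thus "recovery_fid dL R (noisy q) \<le> 1" using q(2) by simp
qed

text \<open>By the choice of \<open>M\<close>, each spread is at most \<open>M * q i\<close>. The
  sum over factors thus becomes \<open>M\<close> times a q-average of roots, and concavity replaces
  it by the root of the averaged squared error.\<close>

lemma noisy_bound:
  assumes q: "\<And>i. i < n \<Longrightarrow> q i > 0" "(\<Sum>i<n. q i) = 1"
  shows "charge_deviation / Max ((\<lambda>i. spread (T i) / q i) ` {..<n}) \<le> ent_err dL (n * D) (noisy q)"
proof -
  define M where "M = Max ((\<lambda>i. spread (T i) / q i) ` {..<n})"
  \<comment> \<open>Weights that sum to 1 exclude \<open>n = 0\<close>, so the maximum is over a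
    nonempty set.\<close>
  have n: "n > 0" using q(2) by (cases n) auto
  have le_M: "spread (T i) / q i \<le> M" if "i < n" for i
    unfolding M_def using that by (intro Max_ge) auto
  have sp: "spread (T i) \<ge> 0" if "i < n" for i
    using recovery_state_erased(4)[OF that is_channel_exists[OF dL_pos]] .
  have M0: "M \<ge> 0" using le_M[OF n] sp[OF n] q(1)[OF n] by (meson divide_nonneg_pos order_trans)
  have step: "charge_deviation \<le> M * sqrt (1 - recovery_fid dL R (noisy q))" if R: "is_channel (n * D) dL R" for R
  proof -
    let ?f = "\<lambda>i. recovery_fid dL (\<lambda>X. R (inject_block n D i X)) (erased i)"
    have Ri: "is_channel D dL (\<lambda>X. R (inject_block n D i X))" if "i < n" for i
      by (rule is_channel_inject_block[OF R that])
    have f1: "?f i \<le> 1" if "i < n" for i using recovery_state_erased(3)[OF that Ri[OF that]] .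
    have "charge_deviation \<le> (\<Sum>i<n. spread (T i) * sqrt (1 - ?f i))"
      by (rule charge_deviation_le[OF Ri])
    also have "\<dots> \<le> (\<Sum>i<n. M * (q i * sqrt (1 - ?f i)))"
    proof (rule sum_mono)
      fix i assume "i \<in> {..<n}"
      hence i: "i < n" by simp
      have "spread (T i) \<le> M * q i" using le_M[OF i] q(1)[OF i] by (simp add: pos_divide_le_eq)
      thus "spread (T i) * sqrt (1 - ?f i) \<le> M * (q i * sqrt (1 - ?f i))"
        unfolding mult.assoc[symmetric] using f1[OF i] by (intro mult_right_mono) auto
    qed
    also have "\<dots> = M * (\<Sum>i<n. q i * sqrt (1 - ?f i))" by (simp add: sum_distrib_left)
    also have "\<dots> \<le> M * sqrt (\<Sum>i<n. q i * (1 - ?f i))"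
      by (intro mult_left_mono[OF _ M0] weighted_sum_le_sqrt) (use q f1 in \<open>auto intro: less_imp_le\<close>)
    also have "(\<Sum>i<n. q i * (1 - ?f i)) = 1 - recovery_fid dL R (noisy q)"
    proof -
      have "recovery_fid dL R (noisy q) = (\<Sum>i<n. q i * ?f i)" by (rule recovery_noisy(2)[OF R q])
      thus ?thesis by (simp add: right_diff_distrib sum_subtractf q(2))
    qed
    finally show ?thesis .
  qed
  have good: "psd (dL * dL) (recovery_state dL R (noisy q)) \<and> 0 \<le> recovery_fid dL R (noisy q) \<and> recovery_fid dL R (noisy q) \<le> 1"
    if "is_channel (n * D) dL R" for R
    using recovery_noisy[OF that q] by blast
  obtain R where R: "\<And>k :: nat. is_channel (n * D) dL (R k)"
    and lim: "(\<lambda>k. sqrt (1 - recovery_fid dL (R k) (noisy q))) \<longlonglongrightarrow> ent_err dL (n * D) (noisy q)"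
    and e0: "ent_err dL (n * D) (noisy q) \<ge> 0"
    by (rule ent_err_sequence[OF dL_pos good], assumption, rule that)
  have "(\<lambda>k. M * sqrt (1 - recovery_fid dL (R k) (noisy q))) \<longlonglongrightarrow> M * ent_err dL (n * D) (noisy q)"
    by (intro tendsto_intros lim)
  hence "charge_deviation \<le> M * ent_err dL (n * D) (noisy q)"
    by (rule LIMSEQ_le_const) (use step[OF R] in blast)
  \<comment> \<open>If \<open>M = 0\<close>, the quotient is 0 by the convention for division by
    zero, and the claim is that the error is nonnegative.\<close>
  thus ?thesis
    unfolding M_def[symmetric] using M0 e0
    by (cases "M = 0") (simp_all add: pos_divide_le_eq mult.commute)
qed

end

theorem theorem6:
  fixes n dL :: nat and d :: "nat \<Rightarrow> nat"
    and V TL :: "complex mat" and T :: "nat \<Rightarrow> complex mat"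
    and \<nu> :: real and \<phi> :: "nat \<Rightarrow> complex vec"
  assumes dL_pos: "dL > 0"
    and d_pos: "\<forall>i<n. d i > 0"
    and V_dim: "V \<in> carrier_mat (dimA d n) dL"
    and V_isometry: "adj V * V = 1\<^sub>m dL"
    and TL_herm: "TL \<in> carrier_mat dL dL" "adj TL = TL"
    and T_herm: "\<forall>i<n. T i \<in> carrier_mat (d i) (d i) \<and> adj (T i) = T i"
    and covariant: "local_sum d n T * V = V * (TL - complex_of_real \<nu> \<cdot>\<^sub>m 1\<^sub>m dL)"
    and phi_state: "\<forall>i<n. \<phi> i \<in> carrier_vec (d i) \<and> (\<Sum>a<d i. (cmod (\<phi> i $ a))\<^sup>2) = 1"
  shows "trace_norm (TL - (mtrace TL / of_nat dL) \<cdot>\<^sub>m 1\<^sub>m dL) / (2 * real dL)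
           \<le> (\<Sum>i<n. spread (T i) *
                 ent_err dL (dimA d n) (\<lambda>X. erase d n i (\<phi> i) (V * X * adj V))) \<and>
         (\<forall>q :: nat \<Rightarrow> real. (\<forall>i<n. q i > 0) \<and> (\<Sum>i<n. q i) = 1 \<longrightarrow>
           ent_err dL (n * dimA d n) (\<lambda>X. noise d n q \<phi> (V * X * adj V))
             \<ge> trace_norm (TL - (mtrace TL / of_nat dL) \<cdot>\<^sub>m 1\<^sub>m dL) / (2 * real dL)
                / Max ((\<lambda>i. spread (T i) / q i) ` {..<n}))"
proof -
  interpret covariant_code n dL d V TL T \<nu> \<phi>
    by unfold_locales (fact assms)+
  show ?thesis
    using erased_bound noisy_bound
    unfolding charge_deviation_def erased_def[abs_def] noisy_def[abs_def] by blast
qed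

end
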